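(* Let $(M,\omega)$ be a Hermitian manifold of complex dimension $n$ and $(E,h^E)$ a holomorphic Hermitian vector bundle of rank $r$ on $M$. Equip $P(E^* )$ with the Hermitian metric $\omega_{P(E^* )}:=\omega(x)+\omega_{P(E^*_x)}([v^*])$. Then for every positive integer $p$ the $L^2$ version of the Le Potier isomorphism holds: $$H^0_{(2)}(M,S^p(E))\simeq H^0_{(2)}(P(E^* ),\mathcal{O}_{P(E^* )}(p)).$$
   Context: $P(E^* )$ is the projectivization (lines in the fibers) of the dual bundle $E^*$, with projection $\pi:P(E^* )\to M$ and fibers $P(E_x^* )$; $\mathcal{O}_{P(E^* )}(-1)$ is the tautological line bundle, $\mathcal{O}_{P(E^* )}(1)$ its dual, $\mathcal{O}_{P(E^* )}(p)=\mathcal{O}_{P(E^* )}(1)^{\otimes p}$. $S^p(E)$ is the $p$-th symmetric tensor power. These bundles carry the Hermitian metrics induced by $h^E$ ($S^p(E)$ with the metric restricted from $E^{\otimes p}$). The Le Potier isomorphism is $\rho:H^0(M,S^p(E))\to H^0(P(E^* ),\mathcal{O}_{P(E^* )}(p))$, $S\mapsto\mathbb{S}$, determined by $\mathbb{S}([v^*])(v^{*\otimes p})=S(x)(v^{*\otimes p})$ for $v\in E_x\setminus\{0\}$, where $v^*=h^E(\cdot,v)\in E_x^*$. The $L^2$ version means that $\rho$ restricts to an isomorphism between the subspaces $H^0_{(2)}$ of square-integrable holomorphic sections. The $L^2$ norm on $M$ uses $dV_M=\omega^n/n!$. In $\omega_{P(E^* )}$, $\omega_{P(E^*_x)}$ is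 the Fubini-Study metric of the fiber $P(E^*_x)\cong P(\mathbb{C}^r)$ determined by an orthonormal basis of $(E_x,h^E)$, normalized so that in affine coordinates $u^{j+1}=x_j+\sqrt{-1}y_j$, $1\le j\le r-1$, its volume form is $dV_{P(E_x^* )}=\frac{\omega_{P(E_x^* )}^{r-1}}{(r-1)!}=\frac{dx_1\wedge dy_1\wedge\cdots\wedge dx_{r-1}\wedge dy_{r-1}}{\pi^{r-1}(1+\sum_j(x_j^2+y_j^2))^r}$. The volume form on $P(E^* )$ is $dV_{P(E^* )}(x,[v^*])=dV_M(x)\wedge dV_{P(E_x^* )}([v^*])$. *)

theory Defs
  imports "HOL-Analysis.Analysis" "Jordan_Normal_Form.Determinant"
begin

section \<open>Functions on open subsets of complex coordinate space\<close>

text \<open>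
  Complex coordinate space of dimension \<open>d\<close> is the set of extensional functions
  \<open>{..<d} \<rightarrow>\<^sub>E UNIV\<close>, which is also the space of the product Lebesgue measure used below. The
  dimension is a natural number and not a type because the dimension \<open>n + r - 1\<close> of a
  projectivized bundle has to be formed from \<open>n\<close> and \<open>r\<close>.
\<close>

type_synonym cn = "nat \<Rightarrow> complex"

definition cspace :: "nat \<Rightarrow> cn topology" where
  "cspace d = product_topology (\<lambda>_. euclidean) {..<d}"

definition cmeasure :: "nat \<Rightarrow> cn measure" where
  "cmeasure d = Pi\<^sub>M {..<d} (\<lambda>_. lborel)"

definition cnorm :: "nat \<Rightarrow> cn \<Rightarrow> real" where
  "cnorm d z = L2_set (\<lambda>i. cmod (z i)) {..<d}"

text \<open>Complex Frechet differentiability at every point; \<open>c\<close> lists the partial derivatives.\<close>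

definition holo_on :: "nat \<Rightarrow> cn set \<Rightarrow> (cn \<Rightarrow> complex) \<Rightarrow> bool" where
  "holo_on d W f \<longleftrightarrow>
     (\<forall>a\<in>W. \<exists>c::nat \<Rightarrow> complex. \<forall>\<epsilon>>0. \<exists>\<delta>>0. \<forall>z\<in>W. cnorm d (\<lambda>i. z i - a i) < \<delta> \<longrightarrow>
        cmod (f z - f a - (\<Sum>i<d. c i * (z i - a i))) \<le> \<epsilon> * cnorm d (\<lambda>i. z i - a i))"

text \<open>
  \<open>ck_on d k W f\<close>: all iterated real partial derivatives of order at most \<open>k\<close>, in the directions
  \<open>v = 1\<close> and \<open>v = \<i>\<close> of each complex coordinate, exist and are continuous on \<open>W\<close>.
\<close>

primrec ck_on :: "nat \<Rightarrow> nat \<Rightarrow> cn set \<Rightarrow> (cn \<Rightarrow> complex) \<Rightarrow> bool" where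
  "ck_on d 0 W f \<longleftrightarrow> continuous_map (subtopology (cspace d) W) euclidean f"
| "ck_on d (Suc k) W f \<longleftrightarrow>
     continuous_map (subtopology (cspace d) W) euclidean f \<and>
     (\<forall>i<d. \<forall>v\<in>{1, \<i>}. \<exists>f'. ck_on d k W f' \<and>
        (\<forall>a\<in>W. ((\<lambda>t::real. f (a(i := a i + of_real t * v))) has_vector_derivative f' a) (at 0)))"

definition smooth_on :: "nat \<Rightarrow> cn set \<Rightarrow> (cn \<Rightarrow> complex) \<Rightarrow> bool" where
  "smooth_on d W f \<longleftrightarrow> (\<forall>k. ck_on d k W f)"


section \<open>Complex manifolds and Hermitian metrics\<close>

type_synonym 'a chart = "'a set \<times> ('a \<Rightarrow> cn)"

definition holo_fun :: "nat \<Rightarrow> 'a chart set \<Rightarrow> 'a set \<Rightarrow> ('a \<Rightarrow> complex) \<Rightarrow> bool" where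
  "holo_fun d A W f \<longleftrightarrow>
     (\<forall>(U, \<phi>)\<in>A. holo_on d (\<phi> ` (U \<inter> W)) (\<lambda>z. f (inv_into U \<phi> z)))"

definition smooth_fun :: "nat \<Rightarrow> 'a chart set \<Rightarrow> 'a set \<Rightarrow> ('a \<Rightarrow> complex) \<Rightarrow> bool" where
  "smooth_fun d A W f \<longleftrightarrow>
     (\<forall>(U, \<phi>)\<in>A. smooth_on d (\<phi> ` (U \<inter> W)) (\<lambda>z. f (inv_into U \<phi> z)))"

definition complex_atlas :: "nat \<Rightarrow> 'm::topological_space chart set \<Rightarrow> bool" where
  "complex_atlas n A \<longleftrightarrow>
     (\<Union>(U, \<phi>)\<in>A. U) = UNIV \<and>
     (\<forall>(U, \<phi>)\<in>A. open U \<and> openin (cspace n) (\<phi> ` U) \<and>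
        homeomorphic_map (top_of_set U) (subtopology (cspace n) (\<phi> ` U)) \<phi>) \<and>
     (\<forall>(V, \<psi>)\<in>A. \<forall>i<n. holo_fun n A V (\<lambda>x. \<psi> x i))"

text \<open>
  The metric is recorded by its coefficients: \<open>met (U, \<phi>) x j k\<close> is the coefficient \<open>g\<^sub>j\<^sub>k\<close> at
  \<open>x \<in> U\<close> of \<open>\<omega> = (\<i>/2) \<Sum>\<^sub>j\<^sub>,\<^sub>k g\<^sub>j\<^sub>k dz\<^sub>j \<and> d(cnj z\<^sub>k)\<close>, where \<open>z = \<phi>\<close>.
\<close>

record 'm herm_manifold =
  mdim :: nat
  atlas :: "'m chart set"
  met :: "'m chart \<Rightarrow> 'm \<Rightarrow> nat \<Rightarrow> nat \<Rightarrow> complex"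

text \<open>\<open>jacobian (U, \<phi>) (V, \<psi>) x l j\<close> is the derivative of \<open>\<psi>\<^sub>l\<close> with respect to \<open>\<phi>\<^sub>j\<close> at \<open>x\<close>.\<close>

definition jacobian :: "'m chart \<Rightarrow> 'm chart \<Rightarrow> 'm \<Rightarrow> nat \<Rightarrow> nat \<Rightarrow> complex" where
  "jacobian = (\<lambda>(U, \<phi>) (V, \<psi>) x l j.
     deriv (\<lambda>w. \<psi> (inv_into U \<phi> ((\<phi> x)(j := w))) l) (\<phi> x j))"

definition hermitian_manifold :: "'m::{t2_space, second_countable_topology} herm_manifold \<Rightarrow> bool" where
  "hermitian_manifold M \<longleftrightarrow>
     complex_atlas (mdim M) (atlas M) \<and>
     (\<forall>(U, \<phi>)\<in>atlas M.
        (\<forall>j<mdim M. \<forall>k<mdim M.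
           smooth_on (mdim M) (\<phi> ` U) (\<lambda>z. met M (U, \<phi>) (inv_into U \<phi> z) j k)) \<and>
        (\<forall>x\<in>U. \<forall>j<mdim M. \<forall>k<mdim M. met M (U, \<phi>) x k j = cnj (met M (U, \<phi>) x j k)) \<and>
        (\<forall>x\<in>U. \<forall>\<xi>::nat \<Rightarrow> complex. (\<exists>j<mdim M. \<xi> j \<noteq> 0) \<longrightarrow>
           0 < Re (\<Sum>j<mdim M. \<Sum>k<mdim M. met M (U, \<phi>) x j k * \<xi> j * cnj (\<xi> k)))) \<and>
     (\<forall>c\<in>atlas M. \<forall>c'\<in>atlas M. \<forall>x \<in> fst c \<inter> fst c'. \<forall>j<mdim M. \<forall>k<mdim M.
        met M c x j k = (\<Sum>l<mdim M. \<Sum>m<mdim M.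
          met M c' x l m * jacobian c c' x l j * cnj (jacobian c c' x m k)))"

text \<open>
  The Borel measure of the volume form \<open>\<omega>\<^sup>n / n!\<close>. With the normalization of the coefficients
  above this form is \<open>det (g\<^sub>j\<^sub>k)\<close> times the Lebesgue volume form in every chart, which determines
  the measure uniquely.
\<close>

definition volume_measure :: "'m::{t2_space, second_countable_topology} herm_manifold \<Rightarrow> 'm measure" where
  "volume_measure M = (THE \<mu>. sets \<mu> = sets borel \<and>
     (\<forall>(U, \<phi>)\<in>atlas M. \<forall>B\<in>sets borel. B \<subseteq> U \<longrightarrow>
        emeasure \<mu> B = (\<integral>\<^sup>+z\<in>\<phi> ` B.
          ennreal (Re (Determinant.det (mat (mdim M) (mdim M)
            (\<lambda>(j, k). met M (U, \<phi>) (inv_into U \<phi> z) j k)))) \<partial>cmeasure (mdim M))))"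


section \<open>Holomorphic Hermitian vector bundles\<close>

text \<open>
  The fibers are subspaces of one ambient complex vector space \<open>('v, smul)\<close>; this is no
  restriction, since any family of vector spaces embeds into its direct sum. A pair \<open>(V, e)\<close> in
  \<open>frames\<close> is a holomorphic frame \<open>e x 0, ..., e x (r - 1)\<close> over the open set \<open>V\<close>, and \<open>hmet E x\<close>
  is the Hermitian inner product on \<open>fiber E x\<close>, linear in its first argument.
\<close>

record ('m, 'v) herm_bundle =
  brank :: nat
  smul :: "complex \<Rightarrow> 'v \<Rightarrow> 'v"
  fiber :: "'m \<Rightarrow> 'v set"
  frames :: "('m set \<times> ('m \<Rightarrow> nat \<Rightarrow> 'v)) set"
  hmet :: "'m \<Rightarrow> 'v \<Rightarrow> 'v \<Rightarrow> complex"

definition basis_of :: "('m, 'v::ab_group_add) herm_bundle \<Rightarrow> 'm \<Rightarrow> (nat \<Rightarrow> 'v) \<Rightarrow> bool" where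
  "basis_of E x b \<longleftrightarrow> inj_on b {..<brank E} \<and>
     \<not> module.dependent (smul E) (b ` {..<brank E}) \<and>
     module.span (smul E) (b ` {..<brank E}) = fiber E x"

text \<open>The functionals dual to the basis \<open>b\<close> of a fiber, extended by \<open>0\<close> outside the fiber.\<close>

definition dual_basis ::
  "('m, 'v::ab_group_add) herm_bundle \<Rightarrow> (nat \<Rightarrow> 'v) \<Rightarrow> nat \<Rightarrow> 'v \<Rightarrow> complex" where
  "dual_basis E b i = (\<lambda>v. module.representation (smul E) (b ` {..<brank E}) v (b i))"

definition holomorphic_bundle ::
  "'m::topological_space herm_manifold \<Rightarrow> ('m, 'v::ab_group_add) herm_bundle \<Rightarrow> bool" where
  "holomorphic_bundle M E \<longleftrightarrow>
     vector_space (smul E) \<and> 1 \<le> brank E \<and>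
     (\<Union>(V, e)\<in>frames E. V) = UNIV \<and>
     (\<forall>(V, e)\<in>frames E. open V \<and> (\<forall>x\<in>V. basis_of E x (e x))) \<and>
     (\<forall>(V, e)\<in>frames E. \<forall>(V', e')\<in>frames E. \<forall>i<brank E. \<forall>j<brank E.
        holo_fun (mdim M) (atlas M) (V \<inter> V') (\<lambda>x. dual_basis E (e x) i (e' x j)))"

definition hermitian_bundle ::
  "'m::topological_space herm_manifold \<Rightarrow> ('m, 'v::ab_group_add) herm_bundle \<Rightarrow> bool" where
  "hermitian_bundle M E \<longleftrightarrow>
     holomorphic_bundle M E \<and>
     (\<forall>x. \<forall>u\<in>fiber E x. \<forall>v\<in>fiber E x. \<forall>w\<in>fiber E x. \<forall>c.
        hmet E x (u + v) w = hmet E x u w + hmet E x v w \<and>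
        hmet E x (smul E c u) w = c * hmet E x u w \<and>
        hmet E x w u = cnj (hmet E x u w)) \<and>
     (\<forall>x. \<forall>v\<in>fiber E x. v \<noteq> 0 \<longrightarrow> 0 < Re (hmet E x v v)) \<and>
     (\<forall>(V, e)\<in>frames E. \<forall>i<brank E. \<forall>j<brank E.
        smooth_fun (mdim M) (atlas M) V (\<lambda>x. hmet E x (e x i) (e x j)))"

text \<open>
  An arbitrary orthonormal basis of a fiber. None of the Hermitian metrics and measures defined
  from it below depends on the choice.
\<close>

definition onb :: "('m, 'v::ab_group_add) herm_bundle \<Rightarrow> 'm \<Rightarrow> nat \<Rightarrow> 'v" where
  "onb E x = (SOME b. basis_of E x b \<and>
     (\<forall>i<brank E. \<forall>j<brank E. hmet E x (b i) (b j) = (if i = j then 1 else 0)))"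

text \<open>The dual fiber: functionals on the fiber, extended by \<open>0\<close> outside the fiber.\<close>

definition dual_fiber :: "('m, 'v::ab_group_add) herm_bundle \<Rightarrow> 'm \<Rightarrow> ('v \<Rightarrow> complex) set" where
  "dual_fiber E x = {\<phi>. (\<forall>v. v \<notin> fiber E x \<longrightarrow> \<phi> v = 0) \<and>
     (\<forall>v\<in>fiber E x. \<forall>w\<in>fiber E x. \<phi> (v + w) = \<phi> v + \<phi> w) \<and>
     (\<forall>c. \<forall>v\<in>fiber E x. \<phi> (smul E c v) = c * \<phi> v)}"

text \<open>The functional \<open>v\<^sup>* = h(\<cdot>, v)\<close>.\<close>

definition metric_dual ::
  "('m, 'v::ab_group_add) herm_bundle \<Rightarrow> 'm \<Rightarrow> 'v \<Rightarrow> 'v \<Rightarrow> complex" where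
  "metric_dual E x v = (\<lambda>w. if w \<in> fiber E x then hmet E x w v else 0)"

definition dual_norm2 ::
  "('m, 'v::ab_group_add) herm_bundle \<Rightarrow> 'm \<Rightarrow> ('v \<Rightarrow> complex) \<Rightarrow> real" where
  "dual_norm2 E x \<phi> = (\<Sum>i<brank E. (cmod (\<phi> (onb E x i)))\<^sup>2)"


section \<open>Symmetric powers and tautological powers\<close>

text \<open>
  \<open>p\<close>-linear forms on a space \<open>W\<close> of functionals, extended by \<open>0\<close> to all other arguments. For
  \<open>W\<close> the dual of a finite-dimensional space \<open>F\<close> this is \<open>F\<^sup>\<otimes>\<^sup>p\<close>, the value of a tensor at
  \<open>(\<phi>\<^sub>1, ..., \<phi>\<^sub>p)\<close> being its pairing with \<open>\<phi>\<^sub>1 \<otimes> ... \<otimes> \<phi>\<^sub>p\<close>.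
\<close>

type_synonym 'v form = "(nat \<Rightarrow> 'v \<Rightarrow> complex) \<Rightarrow> complex"

definition multilinear_forms :: "nat \<Rightarrow> ('v \<Rightarrow> complex) set \<Rightarrow> 'v form set" where
  "multilinear_forms p W = {T.
     (\<forall>t. t \<notin> {..<p} \<rightarrow>\<^sub>E W \<longrightarrow> T t = 0) \<and>
     (\<forall>t \<in> {..<p} \<rightarrow>\<^sub>E W. \<forall>i<p. \<forall>\<phi>\<in>W. \<forall>\<psi>\<in>W. \<forall>c.
        T (t(i := (\<lambda>v. \<phi> v + \<psi> v))) = T (t(i := \<phi>)) + T (t(i := \<psi>)) \<and>
        T (t(i := (\<lambda>v. c * \<phi> v))) = c * T (t(i := \<phi>)))}"

text \<open>The argument that represents \<open>\<phi>\<^sup>\<otimes>\<^sup>p\<close>.\<close>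

definition diag_tuple :: "nat \<Rightarrow> ('v \<Rightarrow> complex) \<Rightarrow> nat \<Rightarrow> 'v \<Rightarrow> complex" where
  "diag_tuple p \<phi> = (\<lambda>k\<in>{..<p}. \<phi>)"

definition sym_fiber ::
  "('m, 'v::ab_group_add) herm_bundle \<Rightarrow> nat \<Rightarrow> 'm \<Rightarrow> 'v form set" where
  "sym_fiber E p x = {T \<in> multilinear_forms p (dual_fiber E x).
     \<forall>\<sigma>. \<sigma> permutes {..<p} \<longrightarrow> (\<forall>t \<in> {..<p} \<rightarrow>\<^sub>E dual_fiber E x. T (t \<circ> \<sigma>) = T t)}"

text \<open>The metric of \<open>E\<^sup>\<otimes>\<^sup>p\<close>: tensor products of orthonormal basis vectors are orthonormal.\<close>

definition tensor_norm2 ::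
  "('m, 'v::ab_group_add) herm_bundle \<Rightarrow> nat \<Rightarrow> 'm \<Rightarrow> 'v form \<Rightarrow> real" where
  "tensor_norm2 E p x T =
     (\<Sum>I \<in> {..<p} \<rightarrow>\<^sub>E {..<brank E}.
        (cmod (T (\<lambda>k\<in>{..<p}. dual_basis E (onb E x) (I k))))\<^sup>2)"

text \<open>
  Holomorphic sections of \<open>S\<^sup>p(E)\<close>: all components with respect to the holomorphic frames of
  \<open>E\<^sup>\<otimes>\<^sup>p\<close> induced by those of \<open>E\<close> are holomorphic.
\<close>

definition H0_sym ::
  "'m::topological_space herm_manifold \<Rightarrow> ('m, 'v::ab_group_add) herm_bundle \<Rightarrow> nat
     \<Rightarrow> ('m \<Rightarrow> 'v form) set" where
  "H0_sym M E p = {S. (\<forall>x. S x \<in> sym_fiber E p x) \<and>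
     (\<forall>(V, e)\<in>frames E. \<forall>I \<in> {..<p} \<rightarrow>\<^sub>E {..<brank E}.
        holo_fun (mdim M) (atlas M) V (\<lambda>x. S x (\<lambda>k\<in>{..<p}. dual_basis E (e x) (I k))))}"

definition H02_sym ::
  "'m::{t2_space, second_countable_topology} herm_manifold \<Rightarrow> ('m, 'v::ab_group_add) herm_bundle \<Rightarrow> nat
     \<Rightarrow> ('m \<Rightarrow> 'v form) set" where
  "H02_sym M E p = {S \<in> H0_sym M E p.
     (\<integral>\<^sup>+x. ennreal (tensor_norm2 E p x (S x)) \<partial>volume_measure M) < \<infinity>}"

text \<open>
  A point of \<open>P(E\<^sup>*)\<close> is a pair \<open>(x, L)\<close> with \<open>L\<close> a line in the dual fiber at \<open>x\<close>; \<open>L\<close> is also the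
  fiber of the tautological bundle at this point.
\<close>

type_synonym ('m, 'v) proj_point = "'m \<times> ('v \<Rightarrow> complex) set"

definition line :: "('v \<Rightarrow> complex) \<Rightarrow> ('v \<Rightarrow> complex) set" where
  "line \<phi> = range (\<lambda>c v. c * \<phi> v)"

definition proj_fiber ::
  "('m, 'v::ab_group_add) herm_bundle \<Rightarrow> 'm \<Rightarrow> ('v \<Rightarrow> complex) set set" where
  "proj_fiber E x = {line \<phi> |\<phi>. \<phi> \<in> dual_fiber E x \<and> \<phi> \<noteq> (\<lambda>_. 0)}"

definition proj_dual :: "('m, 'v::ab_group_add) herm_bundle \<Rightarrow> ('m, 'v) proj_point set" where
  "proj_dual E = (SIGMA x:UNIV. proj_fiber E x)"

text \<open>
  Over the set \<open>taut_domain E (V, e) j\<close> of lines on which evaluation at \<open>e x j\<close> does not vanish,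
  the tautological bundle has the holomorphic frame \<open>taut_frame\<close>, normalized to be \<open>1\<close> on
  \<open>e x j\<close>; its values on the other \<open>e x k\<close> are the affine coordinates on the fibers of \<open>P(E\<^sup>*)\<close>.
  \<open>skip j\<close> enumerates the indices different from \<open>j\<close>.
\<close>

definition taut_domain ::
  "('m, 'v::ab_group_add) herm_bundle \<Rightarrow> 'm set \<times> ('m \<Rightarrow> nat \<Rightarrow> 'v) \<Rightarrow> nat
     \<Rightarrow> ('m, 'v) proj_point set" where
  "taut_domain E = (\<lambda>(V, e) j. {(x, L) \<in> proj_dual E. x \<in> V \<and> (\<exists>\<phi>\<in>L. \<phi> (e x j) \<noteq> 0)})"

definition taut_frame ::
  "('m \<Rightarrow> nat \<Rightarrow> 'v) \<Rightarrow> nat \<Rightarrow> ('m, 'v) proj_point \<Rightarrow> 'v \<Rightarrow> complex" where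
  "taut_frame e j = (\<lambda>(x, L). THE \<phi>. \<phi> \<in> L \<and> \<phi> (e x j) = 1)"

definition skip :: "nat \<Rightarrow> nat \<Rightarrow> nat" where
  "skip j k = (if k < j then k else Suc k)"

definition proj_atlas ::
  "'m::topological_space herm_manifold \<Rightarrow> ('m, 'v::ab_group_add) herm_bundle
     \<Rightarrow> ('m, 'v) proj_point chart set" where
  "proj_atlas M E =
     {(taut_domain E (V, e) j \<inter> (U \<times> UNIV),
       \<lambda>q. \<lambda>i\<in>{..<mdim M + brank E - 1}.
         if i < mdim M then \<phi> (fst q) i
         else taut_frame e j q (e (fst q) (skip j (i - mdim M))))
      |U \<phi> V e j. (U, \<phi>) \<in> atlas M \<and> (V, e) \<in> frames E \<and> j < brank E}"

text \<open>The fiber of \<open>O(p) = O(1)\<^sup>\<otimes>\<^sup>p\<close> at \<open>(x, L)\<close> consists of the \<open>p\<close>-linear forms on \<open>L\<close>.\<close>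

definition H0_O ::
  "'m::topological_space herm_manifold \<Rightarrow> ('m, 'v::ab_group_add) herm_bundle \<Rightarrow> nat
     \<Rightarrow> (('m, 'v) proj_point \<Rightarrow> 'v form) set" where
  "H0_O M E p = {s.
     (\<forall>q. q \<notin> proj_dual E \<longrightarrow> s q = (\<lambda>_. 0)) \<and>
     (\<forall>q\<in>proj_dual E. s q \<in> multilinear_forms p (snd q)) \<and>
     (\<forall>(V, e)\<in>frames E. \<forall>j<brank E.
        holo_fun (mdim M + brank E - 1) (proj_atlas M E) (taut_domain E (V, e) j)
          (\<lambda>q. s q (diag_tuple p (taut_frame e j q))))}"

text \<open>The induced metric of \<open>O(p)\<close>; the quotient is the same for all nonzero \<open>\<phi> \<in> L\<close>.\<close>

definition O_norm2 ::
  "('m, 'v::ab_group_add) herm_bundle \<Rightarrow> nat \<Rightarrow> ('m, 'v) proj_point \<Rightarrow> 'v form \<Rightarrow> real" where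
  "O_norm2 E p = (\<lambda>(x, L) s. let \<phi> = (SOME \<phi>. \<phi> \<in> L \<and> \<phi> \<noteq> (\<lambda>_. 0)) in
     (cmod (s (diag_tuple p \<phi>)))\<^sup>2 / dual_norm2 E x \<phi> ^ p)"


section \<open>The volume forms on the fibers and on the total space\<close>

text \<open>
  The affine parametrization of \<open>P(E\<^sup>*\<^sub>x)\<close> in which the \<open>j\<close>-th homogeneous coordinate with respect
  to the orthonormal basis dual to \<open>onb E x\<close> is \<open>1\<close> and the others are listed by \<open>u\<close>.
\<close>

definition affine_point ::
  "('m, 'v::ab_group_add) herm_bundle \<Rightarrow> 'm \<Rightarrow> nat \<Rightarrow> cn \<Rightarrow> ('v \<Rightarrow> complex) set" where
  "affine_point E x j u = line (\<lambda>v. dual_basis E (onb E x) j v +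
     (\<Sum>k<brank E - 1. u k * dual_basis E (onb E x) (skip j k) v))"

definition proj_fiber_borel ::
  "('m, 'v::ab_group_add) herm_bundle \<Rightarrow> 'm \<Rightarrow> ('v \<Rightarrow> complex) set measure" where
  "proj_fiber_borel E x = sigma (proj_fiber E x)
     {B. B \<subseteq> proj_fiber E x \<and>
       (\<forall>j<brank E. {u \<in> space (cmeasure (brank E - 1)). affine_point E x j u \<in> B}
          \<in> sets (cmeasure (brank E - 1)))}"

text \<open>
  The Fubini-Study volume of the fiber in the affine coordinates with \<open>j = 0\<close>, whose complement
  is a null set.
\<close>

definition fs_measure ::
  "('m, 'v::ab_group_add) herm_bundle \<Rightarrow> 'm \<Rightarrow> ('v \<Rightarrow> complex) set measure" where
  "fs_measure E x =
     distr
       (density (cmeasure (brank E - 1))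
         (\<lambda>u. ennreal (1 / (pi ^ (brank E - 1) *
           (1 + (\<Sum>k<brank E - 1. (Re (u k))\<^sup>2 + (Im (u k))\<^sup>2)) ^ brank E))))
       (proj_fiber_borel E x) (affine_point E x 0)"

text \<open>
  Integration over \<open>P(E\<^sup>*)\<close> against the volume form \<open>dV\<^sub>M(x) \<and> dV(P(E\<^sup>*\<^sub>x))\<close> of the metric
  \<open>\<omega> + \<omega>(P(E\<^sup>*\<^sub>x))\<close>: integrate over the fibers, then over \<open>M\<close>.
\<close>

definition proj_integral ::
  "'m::{t2_space, second_countable_topology} herm_manifold \<Rightarrow> ('m, 'v::ab_group_add) herm_bundle
     \<Rightarrow> (('m, 'v) proj_point \<Rightarrow> ennreal) \<Rightarrow> ennreal" where
  "proj_integral M E f = (\<integral>\<^sup>+x. (\<integral>\<^sup>+L. f (x, L) \<partial>fs_measure E x) \<partial>volume_measure M)"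

definition H02_O ::
  "'m::{t2_space, second_countable_topology} herm_manifold \<Rightarrow> ('m, 'v::ab_group_add) herm_bundle \<Rightarrow> nat
     \<Rightarrow> (('m, 'v) proj_point \<Rightarrow> 'v form) set" where
  "H02_O M E p = {s \<in> H0_O M E p. proj_integral M E (\<lambda>q. ennreal (O_norm2 E p q (s q))) < \<infinity>}"


section \<open>The Le Potier map\<close>

definition le_potier ::
  "('m, 'v::ab_group_add) herm_bundle \<Rightarrow> nat \<Rightarrow> ('m \<Rightarrow> 'v form) \<Rightarrow> ('m, 'v) proj_point \<Rightarrow> 'v form" where
  "le_potier E p S = (\<lambda>(x, L).
     if (x, L) \<in> proj_dual E
     then (THE s. s \<in> multilinear_forms p L \<and>
       (\<forall>v\<in>fiber E x. v \<noteq> 0 \<and> metric_dual E x v \<in> L \<longrightarrow>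
          s (diag_tuple p (metric_dual E x v)) = S x (diag_tuple p (metric_dual E x v))))
     else (\<lambda>_. 0))"

text \<open>
  Sections are added and scaled pointwise, which agrees with the fiberwise operations because all
  forms are extended by \<open>0\<close>.
\<close>

definition linear_iso ::
  "(('a \<Rightarrow> 'c \<Rightarrow> complex) \<Rightarrow> 'b \<Rightarrow> 'c \<Rightarrow> complex)
     \<Rightarrow> ('a \<Rightarrow> 'c \<Rightarrow> complex) set \<Rightarrow> ('b \<Rightarrow> 'c \<Rightarrow> complex) set \<Rightarrow> bool" where
  "linear_iso f X Y \<longleftrightarrow> bij_betw f X Y \<and>
     (\<forall>S\<in>X. \<forall>T\<in>X. f (\<lambda>x t. S x t + T x t) = (\<lambda>q t. f S q t + f T q t)) \<and>
     (\<forall>c. \<forall>S\<in>X. f (\<lambda>x t. c * S x t) = (\<lambda>q t. c * f S q t))"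

end

theory Submission
  imports Defs "HOL-Complex_Analysis.Cauchy_Integral_Formula"
begin

text \<open>
  The Le Potier section of \<open>S\<close> at a line \<open>L \<subseteq> E\<^sub>x\<^sup>*\<close> is the restriction of the form \<open>S x\<close> to \<open>L\<close>, so
  injectivity is polarization. Conversely, a holomorphic section of \<open>O(p)\<close> is, on each fiber, a
  function on \<open>E\<^sub>x\<^sup>* - 0\<close> that is homogeneous of degree \<open>p\<close>. By homogeneity it grows at most like \<open>|w|\<^sup>p\<close> on
  every coordinate line, so by Liouville's theorem it is a polynomial in each variable, hence a form
  of degree \<open>p\<close>; its polarization depends holomorphically on \<open>x\<close> because the polarization formula only
  uses values at points with constant coordinates in a holomorphic frame.

  The two \<open>L\<^sup>2\<close> norms are compared fiberwise. In orthonormal coordinates the problem does not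
  depend on \<open>x\<close>, so \<open>|S x|\<^sup>2\<close> and the fiber integral of the norm of the section bound each other up to
  constants depending only on \<open>p\<close> and \<open>r\<close>. Such pointwise bounds suffice, and no measurability or
  existence statement about the volume measure of \<open>M\<close> enters.
\<close>

section \<open>Holomorphic functions of several variables\<close>

text \<open>Passing from one variable to several needs no power series. If a function is polynomial
  of degree at most \<open>p\<close> in each variable, interpolation at \<open>p + 1\<close> fixed
  nodes writes its coefficients in one variable as fixed linear combinations of its values, so they
  are again polynomial in the remaining variables. Homogeneity then selects the total degree. The
  growth bound on a coordinate line comes from the same section in another affine chart, where
  infinity is an ordinary point. In the norm comparison the hard direction bounds a tensor by a
  fiber integral. A polarization argument replaces compactness of the unit sphere and yields an
  explicit constant. Two obstacles shape it: the fiber measure lives in the chart where coordinate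
  \<open>0\<close> equals \<open>1\<close>, while sums of dual basis vectors can lie at infinity of
  that chart; and a value at a single point is not bounded by an integral. Polarizing around base
  points \<open>(1, s)\<close> with \<open>s\<close> in a polydisc removes both, since coordinate
  \<open>0\<close> then stays at least \<open>1\<close> and averaging over \<open>s\<close> turns
  values into integrals.\<close>

lemma cnorm_nonneg: "0 \<le> cnorm d z"
  by (simp add: cnorm_def L2_set_nonneg)

lemma cmod_le_cnorm: "i < d \<Longrightarrow> cmod (z i) \<le> cnorm d z"
  unfolding cnorm_def using member_le_L2_set[of "{..<d}" i "\<lambda>i. cmod (z i)"] by simp

lemma cnorm_le_sum: "cnorm d z \<le> (\<Sum>i<d. cmod (z i))"
  unfolding cnorm_def by (rule L2_set_le_sum) simp

lemma cnorm_1: "cnorm (Suc 0) z = cmod (z 0)"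
  by (simp add: cnorm_def L2_set_def)

lemma holo_on_cong:
  assumes "\<And>z. z \<in> W \<Longrightarrow> f z = g z"
  shows "holo_on d W f \<longleftrightarrow> holo_on d W g"
  unfolding holo_on_def using assms by simp

lemma holo_on_eqI: "holo_on d W f \<Longrightarrow> (\<And>z. z \<in> W \<Longrightarrow> g z = f z) \<Longrightarrow> holo_on d W g"
  using holo_on_cong[of W g f] by simp

lemma holo_on_const: "holo_on d W (\<lambda>_. a)"
  unfolding holo_on_def
  by (intro ballI exI[of _ "\<lambda>_. 0"] allI impI exI[of _ 1]) (simp add: cnorm_nonneg)

lemma holo_on_linear: "holo_on d W (\<lambda>z. \<Sum>i<d. c i * z i)"
  unfolding holo_on_def
  by (intro ballI exI[of _ c] allI impI exI[of _ 1])
     (simp add: cnorm_nonneg sum_subtractf algebra_simps)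

lemma holo_on_coord: "i < d \<Longrightarrow> holo_on d W (\<lambda>z. z i)"
  using holo_on_linear[of d W "\<lambda>k. if k = i then 1 else 0"]
  by (simp add: if_distrib[of "\<lambda>x. x * _"] sum.delta' cong: if_cong)

lemma holo_on_lipschitz:
  assumes "holo_on d W f" "a \<in> W"
  obtains K \<delta> where "0 < K" "0 < \<delta>"
    "\<And>z. z \<in> W \<Longrightarrow> cnorm d (\<lambda>i. z i - a i) < \<delta> \<Longrightarrow> cmod (f z - f a) \<le> K * cnorm d (\<lambda>i. z i - a i)"
proof -
  obtain c where c: "\<And>\<epsilon>. \<epsilon> > 0 \<Longrightarrow> \<exists>\<delta>>0. \<forall>z\<in>W. cnorm d (\<lambda>i. z i - a i) < \<delta> \<longrightarrow>
        cmod (f z - f a - (\<Sum>i<d. c i * (z i - a i))) \<le> \<epsilon> * cnorm d (\<lambda>i. z i - a i)"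
    using assms unfolding holo_on_def by blast
  obtain \<delta> where \<delta>: "\<delta> > 0" "\<And>z. z \<in> W \<Longrightarrow> cnorm d (\<lambda>i. z i - a i) < \<delta> \<Longrightarrow>
        cmod (f z - f a - (\<Sum>i<d. c i * (z i - a i))) \<le> 1 * cnorm d (\<lambda>i. z i - a i)"
    using c[of 1] by auto
  show thesis
  proof (rule that[of "1 + (\<Sum>i<d. cmod (c i))" \<delta>])
    show "0 < 1 + (\<Sum>i<d. cmod (c i))" by (smt (verit) sum_nonneg norm_ge_zero)
    show "0 < \<delta>" by fact
    fix z assume z: "z \<in> W" "cnorm d (\<lambda>i. z i - a i) < \<delta>"
    let ?N = "cnorm d (\<lambda>i. z i - a i)"
    have "cmod (f z - f a) \<le> cmod (f z - f a - (\<Sum>i<d. c i * (z i - a i))) + cmod (\<Sum>i<d. c i * (z i - a i))"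
      by (metis diff_add_cancel norm_triangle_ineq)
    moreover have "cmod (\<Sum>i<d. c i * (z i - a i)) \<le> (\<Sum>i<d. cmod (c i) * ?N)"
      by (intro sum_norm_le) (auto simp: norm_mult intro!: mult_left_mono cmod_le_cnorm[where z = "\<lambda>i. z i - a i"])
    ultimately show "cmod (f z - f a) \<le> (1 + (\<Sum>i<d. cmod (c i))) * ?N"
      using \<delta>(2)[OF z] by (simp add: distrib_right sum_distrib_right)
  qed
qed

text \<open>The chain rule. Derivatives are taken relative to the set, so it applies directly on
  images of chart overlaps. Sums, products and quotients are reduced to it and to functions of one
  variable.\<close>

lemma holo_on_compose:
  assumes f: "holo_on n W f" and g: "\<And>i. i < n \<Longrightarrow> holo_on d V (\<lambda>z. g z i)"
    and sub: "\<And>z. z \<in> V \<Longrightarrow> g z \<in> W"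
  shows "holo_on d V (\<lambda>z. f (g z))"
  unfolding holo_on_def
proof
  fix a assume a: "a \<in> V"
  let ?D = "\<lambda>z. cnorm d (\<lambda>i. z i - a i)"
  let ?G = "\<lambda>z. cnorm n (\<lambda>i. g z i - g a i)"
  obtain c where c: "\<And>\<epsilon>. \<epsilon> > 0 \<Longrightarrow> \<exists>\<delta>>0. \<forall>z\<in>W. cnorm n (\<lambda>i. z i - g a i) < \<delta> \<longrightarrow>
        cmod (f z - f (g a) - (\<Sum>i<n. c i * (z i - g a i))) \<le> \<epsilon> * cnorm n (\<lambda>i. z i - g a i)"
    using f sub[OF a] unfolding holo_on_def by blast
  have "\<forall>i<n. \<exists>b. \<forall>\<epsilon>>0. \<exists>\<delta>>0. \<forall>z\<in>V. ?D z < \<delta> \<longrightarrow>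
        cmod (g z i - g a i - (\<Sum>j<d. b j * (z j - a j))) \<le> \<epsilon> * ?D z"
    using g a unfolding holo_on_def by blast
  from choice_iff'[THEN iffD1, OF this] obtain b where "\<forall>i<n. \<forall>\<epsilon>>0. \<exists>\<delta>>0. \<forall>z\<in>V. ?D z < \<delta> \<longrightarrow>
        cmod (g z i - g a i - (\<Sum>j<d. b i j * (z j - a j))) \<le> \<epsilon> * ?D z" ..
  then have b: "\<And>i \<epsilon>. i < n \<Longrightarrow> \<epsilon> > 0 \<Longrightarrow> \<exists>\<delta>>0. \<forall>z\<in>V. ?D z < \<delta> \<longrightarrow>
        cmod (g z i - g a i - (\<Sum>j<d. b i j * (z j - a j))) \<le> \<epsilon> * ?D z"
    by auto
  have "\<forall>i<n. \<exists>K \<delta>. 0 < K \<and> 0 < \<delta> \<and> (\<forall>z\<in>V. ?D z < \<delta> \<longrightarrow> cmod (g z i - g a i) \<le> K * ?D z)"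
  proof (intro allI impI)
    fix i assume "i < n"
    show "\<exists>K \<delta>. 0 < K \<and> 0 < \<delta> \<and> (\<forall>z\<in>V. ?D z < \<delta> \<longrightarrow> cmod (g z i - g a i) \<le> K * ?D z)"
      by (rule holo_on_lipschitz[OF g[OF \<open>i < n\<close>] a]) blast
  qed
  from choice_iff'[THEN iffD1, OF this] obtain K where "\<forall>i<n. \<exists>\<delta>. 0 < K i \<and> 0 < \<delta> \<and> (\<forall>z\<in>V. ?D z < \<delta> \<longrightarrow> cmod (g z i - g a i) \<le> K i * ?D z)" ..
  from choice_iff'[THEN iffD1, OF this] obtain \<delta>0 where "\<forall>i<n. 0 < K i \<and> 0 < \<delta>0 i \<and> (\<forall>z\<in>V. ?D z < \<delta>0 i \<longrightarrow> cmod (g z i - g a i) \<le> K i * ?D z)" ..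
  then have K: "\<And>i. i < n \<Longrightarrow> 0 < K i" "\<And>i. i < n \<Longrightarrow> 0 < \<delta>0 i"
     "\<And>i z. i < n \<Longrightarrow> z \<in> V \<Longrightarrow> ?D z < \<delta>0 i \<Longrightarrow> cmod (g z i - g a i) \<le> K i * ?D z"
    by auto
  \<comment> \<open>\<open>L\<close> is a Lipschitz bound for \<open>g\<close> at \<open>a\<close>,
    and \<open>C\<close> below bounds the derivative of \<open>f\<close>. The error of
    \<open>f\<close> is multiplied by \<open>L\<close>, the errors of the components of
    \<open>g\<close> by \<open>C\<close>, hence the two halves of \<open>\<epsilon>\<close>.\<close>
  define L where "L = 1 + (\<Sum>i<n. K i)"
  have L: "0 < L" unfolding L_def using K(1) by (smt (verit) sum_nonneg lessThan_iff)
  define C where "C = 1 + (\<Sum>i<n. cmod (c i))"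
  have C: "0 < C" unfolding C_def by (smt (verit) sum_nonneg norm_ge_zero)
  show "\<exists>c. \<forall>\<epsilon>>0. \<exists>\<delta>>0. \<forall>z\<in>V. ?D z < \<delta> \<longrightarrow>
      cmod (f (g z) - f (g a) - (\<Sum>j<d. c j * (z j - a j))) \<le> \<epsilon> * ?D z"
  proof (intro exI[of _ "\<lambda>j. \<Sum>i<n. c i * b i j"] allI impI)
    fix \<epsilon> :: real assume \<epsilon>: "0 < \<epsilon>"
    define \<epsilon>1 where "\<epsilon>1 = \<epsilon> / (2 * L)"
    define \<epsilon>2 where "\<epsilon>2 = \<epsilon> / (2 * C)"
    have e1: "0 < \<epsilon>1" and e2: "0 < \<epsilon>2" using \<epsilon> L C by (auto simp: \<epsilon>1_def \<epsilon>2_def)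
    obtain \<delta>1 where d1: "\<delta>1 > 0" "\<And>z. z \<in> W \<Longrightarrow> cnorm n (\<lambda>i. z i - g a i) < \<delta>1 \<Longrightarrow>
        cmod (f z - f (g a) - (\<Sum>i<n. c i * (z i - g a i))) \<le> \<epsilon>1 * cnorm n (\<lambda>i. z i - g a i)"
      using c[OF e1] by blast
    have "\<forall>i<n. \<exists>\<delta>>0. \<forall>z\<in>V. ?D z < \<delta> \<longrightarrow>
        cmod (g z i - g a i - (\<Sum>j<d. b i j * (z j - a j))) \<le> \<epsilon>2 * ?D z"
      using b e2 by blast
    from choice_iff'[THEN iffD1, OF this] obtain \<delta>2 where "\<forall>i<n. \<delta>2 i > 0 \<and> (\<forall>z\<in>V. ?D z < \<delta>2 i \<longrightarrow>
        cmod (g z i - g a i - (\<Sum>j<d. b i j * (z j - a j))) \<le> \<epsilon>2 * ?D z)" ..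
    then have d2: "\<And>i. i < n \<Longrightarrow> \<delta>2 i > 0" "\<And>i z. i < n \<Longrightarrow> z \<in> V \<Longrightarrow> ?D z < \<delta>2 i \<Longrightarrow>
        cmod (g z i - g a i - (\<Sum>j<d. b i j * (z j - a j))) \<le> \<epsilon>2 * ?D z"
      by auto
    define \<delta> where "\<delta> = Min (insert (\<delta>1 / L) (\<delta>0 ` {..<n} \<union> \<delta>2 ` {..<n}))"
    have \<delta>: "0 < \<delta>" unfolding \<delta>_def using d1 d2 K(2) L by (subst Min_gr_iff) auto
    have \<delta>1: "\<delta> \<le> \<delta>1 / L" "\<And>i. i < n \<Longrightarrow> \<delta> \<le> \<delta>0 i" "\<And>i. i < n \<Longrightarrow> \<delta> \<le> \<delta>2 i"
      unfolding \<delta>_def by (auto intro!: Min_le)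
    show "\<exists>\<delta>>0. \<forall>z\<in>V. ?D z < \<delta> \<longrightarrow>
      cmod (f (g z) - f (g a) - (\<Sum>j<d. (\<Sum>i<n. c i * b i j) * (z j - a j))) \<le> \<epsilon> * ?D z"
    proof (intro exI[of _ \<delta>] conjI \<delta> ballI impI)
      fix z assume z: "z \<in> V" "?D z < \<delta>"
      have "?G z \<le> (\<Sum>i<n. cmod (g z i - g a i))" by (rule cnorm_le_sum)
      also have "\<dots> \<le> (\<Sum>i<n. K i * ?D z)"
        using K(3) z \<delta>1(2) by (intro sum_mono) force
      also have "\<dots> \<le> L * ?D z"
        by (simp add: L_def sum_distrib_right cnorm_nonneg distrib_right)
      finally have GL: "?G z \<le> L * ?D z" .
      have "L * ?D z < L * \<delta>" using L z by simp
      also have "\<dots> \<le> \<delta>1" using \<delta>1(1) L by (simp add: field_simps)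
      finally have "?G z < \<delta>1" using GL by simp
      then have A: "cmod (f (g z) - f (g a) - (\<Sum>i<n. c i * (g z i - g a i))) \<le> \<epsilon>1 * ?G z"
        using d1(2) sub z by blast
      also have "\<dots> \<le> \<epsilon>1 * (L * ?D z)" using GL e1 by simp
      also have "\<dots> = \<epsilon> / 2 * ?D z" using L by (simp add: \<epsilon>1_def)
      finally have A: "cmod (f (g z) - f (g a) - (\<Sum>i<n. c i * (g z i - g a i))) \<le> \<epsilon> / 2 * ?D z" .
      have "cmod (\<Sum>i<n. c i * (g z i - g a i - (\<Sum>j<d. b i j * (z j - a j))))
          \<le> (\<Sum>i<n. cmod (c i) * (\<epsilon>2 * ?D z))"
      proof (intro sum_norm_le)
        fix i assume "i \<in> {..<n}"
        then have "cmod (g z i - g a i - (\<Sum>j<d. b i j * (z j - a j))) \<le> \<epsilon>2 * ?D z"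
          using d2(2)[of i z] z \<delta>1(3)[of i] by simp
        then show "cmod (c i * (g z i - g a i - (\<Sum>j<d. b i j * (z j - a j)))) \<le> cmod (c i) * (\<epsilon>2 * ?D z)"
          by (simp add: norm_mult mult_left_mono)
      qed
      also have "\<dots> \<le> C * (\<epsilon>2 * ?D z)"
        using e2 by (simp only: C_def sum_distrib_right[symmetric]) (simp add: cnorm_nonneg mult_right_mono)
      also have "\<dots> = \<epsilon> / 2 * ?D z" using C by (simp add: \<epsilon>2_def)
      finally have B: "cmod (\<Sum>i<n. c i * (g z i - g a i - (\<Sum>j<d. b i j * (z j - a j)))) \<le> \<epsilon> / 2 * ?D z" .
      have "(\<Sum>j<d. (\<Sum>i<n. c i * b i j) * (z j - a j)) = (\<Sum>i<n. c i * (\<Sum>j<d. b i j * (z j - a j)))"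
        by (simp add: sum_distrib_left sum_distrib_right mult.assoc) (rule sum.swap)
      then have "f (g z) - f (g a) - (\<Sum>j<d. (\<Sum>i<n. c i * b i j) * (z j - a j))
         = (f (g z) - f (g a) - (\<Sum>i<n. c i * (g z i - g a i)))
         + (\<Sum>i<n. c i * (g z i - g a i - (\<Sum>j<d. b i j * (z j - a j))))"
        by (simp add: right_diff_distrib sum_subtractf)
      then have "cmod (f (g z) - f (g a) - (\<Sum>j<d. (\<Sum>i<n. c i * b i j) * (z j - a j)))
          \<le> \<epsilon> / 2 * ?D z + \<epsilon> / 2 * ?D z"
        using norm_triangle_mono[OF A B] by (simp only:)
      then show "cmod (f (g z) - f (g a) - (\<Sum>j<d. (\<Sum>i<n. c i * b i j) * (z j - a j))) \<le> \<epsilon> * ?D z"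
        by (simp add: distrib_right[symmetric])
    qed
  qed
qed

text \<open>The bridge from the one-variable library: composed with the chain rule it supplies
  squares and inverses.\<close>

lemma holo_on_fst_1:
  assumes "h holomorphic_on S" "open S"
  shows "holo_on 1 {z. z 0 \<in> S} (\<lambda>z. h (z 0))"
  unfolding holo_on_def
proof
  fix a :: cn assume a: "a \<in> {z. z 0 \<in> S}"
  then have "(h has_field_derivative deriv h (a 0)) (at (a 0))"
    using assms holomorphic_derivI by auto
  then have "(h has_derivative (\<lambda>w. w * deriv h (a 0))) (at (a 0))"
    by (simp add: has_field_derivative_def mult_commute_abs)
  then have *: "\<And>e. e > 0 \<Longrightarrow> \<exists>d>0. \<forall>y. norm (y - a 0) < d \<longrightarrow>
     norm (h y - h (a 0) - (y - a 0) * deriv h (a 0)) \<le> e * norm (y - a 0)"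
    unfolding has_derivative_at_alt by blast
  show "\<exists>c. \<forall>\<epsilon>>0. \<exists>\<delta>>0. \<forall>z\<in>{z. z 0 \<in> S}. cnorm 1 (\<lambda>i. z i - a i) < \<delta> \<longrightarrow>
      cmod (h (z 0) - h (a 0) - (\<Sum>i<1. c i * (z i - a i))) \<le> \<epsilon> * cnorm 1 (\<lambda>i. z i - a i)"
    by (rule exI[of _ "\<lambda>_. deriv h (a 0)"]) (use * in \<open>simp add: cnorm_1 mult.commute, meson\<close>)
qed

lemma holomorphic_on_of_holo_on:
  assumes "holo_on 1 UNIV (\<lambda>z. h (z 0))"
  shows "h holomorphic_on UNIV"
proof -
  have "h field_differentiable (at w)" for w
  proof -
    obtain c :: cn where c: "\<And>\<epsilon>. \<epsilon> > 0 \<Longrightarrow> \<exists>\<delta>>0. \<forall>z::cn. cmod (z 0 - w) < \<delta> \<longrightarrow>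
        cmod (h (z 0) - h w - c 0 * (z 0 - w)) \<le> \<epsilon> * cmod (z 0 - w)"
      using assms[unfolded holo_on_def, rule_format, of "\<lambda>_. w"] by (auto simp: cnorm_1)
    have "(h has_derivative (\<lambda>z. c 0 * z)) (at w)"
      unfolding has_derivative_at_alt
    proof (intro conjI allI impI bounded_linear_mult_right)
      fix e :: real assume "0 < e"
      then obtain \<delta> where d: "\<delta> > 0" "\<And>z::cn. cmod (z 0 - w) < \<delta> \<Longrightarrow>
        cmod (h (z 0) - h w - c 0 * (z 0 - w)) \<le> e * cmod (z 0 - w)" using c by blast
      show "\<exists>d>0. \<forall>y. norm (y - w) < d \<longrightarrow> norm (h y - h w - c 0 * (y - w)) \<le> e * norm (y - w)"
        using d(1) d(2)[of "\<lambda>_. y" for y] by auto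
    qed
    then show ?thesis unfolding field_differentiable_def has_field_derivative_def by blast
  qed
  then show ?thesis by (simp add: holomorphic_on_def)
qed

text \<open>The chain rule for the linear form \<open>z 0 + z 1\<close> in two variables.\<close>

lemma holo_on_add:
  assumes "holo_on d W f" "holo_on d W g"
  shows "holo_on d W (\<lambda>z. f z + g z)"
proof -
  have "holo_on d W (\<lambda>z. if i = 0 then f z else g z)" for i :: nat
    using assms by (cases "i = 0") auto
  from holo_on_compose[OF holo_on_linear[of 2 UNIV "\<lambda>_. 1"], of d W "\<lambda>z i. if i = 0 then f z else g z", OF this]
  show ?thesis by (simp add: numeral_2_eq_2)
qed

lemma holo_on_cmult:
  assumes "holo_on d W f"
  shows "holo_on d W (\<lambda>z. a * f z)"
  using holo_on_compose[OF holo_on_linear[of 1 UNIV "\<lambda>_. a"], of d W "\<lambda>z i. f z"] assms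
  by simp

lemma holo_on_square:
  assumes "holo_on d W f"
  shows "holo_on d W (\<lambda>z. f z ^ 2)"
proof -
  have "(\<lambda>w::complex. w ^ 2) holomorphic_on UNIV" by (intro holomorphic_intros)
  from holo_on_compose[OF holo_on_fst_1[OF this], of d W "\<lambda>z i. f z"] assms show ?thesis by simp
qed

lemma holo_on_inverse:
  assumes "holo_on d W f" "\<And>z. z \<in> W \<Longrightarrow> f z \<noteq> 0"
  shows "holo_on d W (\<lambda>z. inverse (f z))"
proof -
  have "inverse holomorphic_on (- {0::complex})" by (intro holomorphic_intros) auto
  from holo_on_compose[OF holo_on_fst_1[OF this], of d W "\<lambda>z i. f z"] assms show ?thesis by auto
qed

lemma holo_on_mult:
  assumes "holo_on d W f" "holo_on d W g"
  shows "holo_on d W (\<lambda>z. f z * g z)"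
proof -
  \<comment> \<open>Products come from squares:
    \<open>2 f g = (f + g)^2 - f^2 - g^2\<close>.\<close>
  have "holo_on d W (\<lambda>z. 1/2 * ((f z + g z)^2 + ((-1) * (f z ^ 2) + (-1) * (g z ^ 2))))"
    using assms by (intro holo_on_cmult holo_on_add holo_on_square)
  then show ?thesis by (simp add: power2_eq_square algebra_simps)
qed

lemma holo_on_divide:
  assumes "holo_on d W f" "holo_on d W g" "\<And>z. z \<in> W \<Longrightarrow> g z \<noteq> 0"
  shows "holo_on d W (\<lambda>z. f z / g z)"
  unfolding divide_inverse using assms by (intro holo_on_mult holo_on_inverse) auto

lemma holo_on_sum:
  assumes "\<And>i. i \<in> I \<Longrightarrow> holo_on d W (f i)"
  shows "holo_on d W (\<lambda>z. \<Sum>i\<in>I. f i z)"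
  using assms by (induction I rule: infinite_finite_induct) (auto intro: holo_on_const holo_on_add)

lemma holo_on_prod:
  assumes "\<And>i. i \<in> I \<Longrightarrow> holo_on d W (f i)"
  shows "holo_on d W (\<lambda>z. \<Prod>i\<in>I. f i z)"
  using assms by (induction I rule: infinite_finite_induct) (auto intro: holo_on_const holo_on_mult)

section \<open>Multilinear forms and polarization\<close>

lemma sum_PiE_Suc:
  "(\<Sum>I\<in>{..<Suc m} \<rightarrow>\<^sub>E B. g I) = (\<Sum>I\<in>{..<m} \<rightarrow>\<^sub>E B. \<Sum>j\<in>B. g (I(m := j)))"
proof -
  have inj: "inj_on (\<lambda>(y, f). f(m := y)) (B \<times> ({..<m} \<rightarrow>\<^sub>E B))"
    by (rule inj_combinator) simp
  have "{..<Suc m} \<rightarrow>\<^sub>E B = (\<lambda>(y, f). f(m := y)) ` (B \<times> ({..<m} \<rightarrow>\<^sub>E B))"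
    by (simp add: lessThan_Suc PiE_insert_eq)
  then have "(\<Sum>I\<in>{..<Suc m} \<rightarrow>\<^sub>E B. g I) = (\<Sum>(y, f)\<in>B \<times> ({..<m} \<rightarrow>\<^sub>E B). g (f(m := y)))"
    by (simp only: sum.reindex[OF inj]) (simp add: case_prod_unfold)
  then show ?thesis
    by (simp add: sum.cartesian_product[symmetric]) (rule sum.swap)
qed

lemma finite_PiE_lessThan: "finite ({..<m::nat} \<rightarrow>\<^sub>E {..<N::nat})"
  by (intro finite_PiE) auto

text \<open>Dual fibers and the lines inside them both serve as domains of multilinear forms; this
  is the structure they share.\<close>

definition function_space :: "('v \<Rightarrow> complex) set \<Rightarrow> bool" where
  "function_space W \<longleftrightarrow> (\<lambda>_. 0) \<in> W \<and>
     (\<forall>\<phi>\<in>W. \<forall>\<psi>\<in>W. (\<lambda>v. \<phi> v + \<psi> v) \<in> W) \<and> (\<forall>c. \<forall>\<phi>\<in>W. (\<lambda>v. c * \<phi> v) \<in> W)"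

lemma function_space_sum:
  assumes W: "function_space W" and "\<And>i. i \<in> K \<Longrightarrow> \<psi> i \<in> W"
  shows "(\<lambda>v. \<Sum>i\<in>K. c i * \<psi> i v) \<in> W"
  using assms(2)
proof (induction K rule: infinite_finite_induct)
  case (insert x F)
  then show ?case using W unfolding function_space_def by simp
qed (use W in \<open>auto simp: function_space_def\<close>)

lemma function_space_sum1:
  assumes W: "function_space W" and "\<And>i. i \<in> K \<Longrightarrow> \<psi> i \<in> W"
  shows "(\<lambda>v. \<Sum>i\<in>K. \<psi> i v) \<in> W"
  using function_space_sum[OF assms, where c = "\<lambda>_. 1"] by simp

lemma multilinear_add:
  assumes "T \<in> multilinear_forms p W" "t \<in> {..<p} \<rightarrow>\<^sub>E W" "i < p" "\<phi> \<in> W" "\<psi> \<in> W"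
  shows "T (t(i := (\<lambda>v. \<phi> v + \<psi> v))) = T (t(i := \<phi>)) + T (t(i := \<psi>))"
  using assms unfolding multilinear_forms_def by blast

lemma multilinear_scale:
  assumes "T \<in> multilinear_forms p W" "t \<in> {..<p} \<rightarrow>\<^sub>E W" "i < p" "\<phi> \<in> W"
  shows "T (t(i := (\<lambda>v. c * \<phi> v))) = c * T (t(i := \<phi>))"
  using assms unfolding multilinear_forms_def by blast

lemma multilinear_outside:
  "T \<in> multilinear_forms p W \<Longrightarrow> t \<notin> {..<p} \<rightarrow>\<^sub>E W \<Longrightarrow> T t = 0"
  unfolding multilinear_forms_def by blast

lemma multilinear_zero:
  assumes "T \<in> multilinear_forms p W" "t \<in> {..<p} \<rightarrow>\<^sub>E W" "i < p" "function_space W"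
  shows "T (t(i := (\<lambda>_. 0))) = 0"
  using multilinear_scale[OF assms(1-3), of "\<lambda>_. 0" 0] assms(4) by (simp add: function_space_def fun_upd_def)

lemma multilinear_sum:
  assumes T: "T \<in> multilinear_forms p W" and t: "t \<in> {..<p} \<rightarrow>\<^sub>E W" and i: "i < p"
    and W: "function_space W" and "finite K" and "\<And>j. j \<in> K \<Longrightarrow> \<psi> j \<in> W"
  shows "T (t(i := (\<lambda>v. \<Sum>j\<in>K. c j * \<psi> j v))) = (\<Sum>j\<in>K. c j * T (t(i := \<psi> j)))"
  using assms(5,6)
proof (induction K rule: finite_induct)
  case empty
  then show ?case using multilinear_zero[OF T t i W] by (simp only: sum.empty)
next
  case (insert x F)
  have "(\<lambda>v. c x * \<psi> x v) \<in> W" using insert W by (auto simp: function_space_def)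
  moreover have "(\<lambda>v. \<Sum>j\<in>F. c j * \<psi> j v) \<in> W" using insert by (intro function_space_sum W) auto
  ultimately show ?case
    using insert.hyps insert.IH[OF insert.prems] insert.prems multilinear_scale[OF T t i, of "\<psi> x" "c x"]
    by (simp only: sum.insert[OF insert.hyps] multilinear_add[OF T t i] insertI1 insertI2)
qed

text \<open>Induction on the number \<open>m\<close> of expanded slots. Keeping \<open>t\<close>
  general allows the linear combination of slot \<open>m\<close> to be parked in \<open>t\<close>
  while the earlier slots are expanded.\<close>

lemma multilinear_expand_aux:
  assumes T: "T \<in> multilinear_forms p W" and W: "function_space W"
    and \<psi>: "\<And>j::nat. j < N \<Longrightarrow> \<psi> j \<in> W" and m: "m \<le> p" and t: "\<And>k. k < p \<Longrightarrow> t k \<in> W"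
  shows "T (\<lambda>k\<in>{..<p}. if k < m then (\<lambda>v. \<Sum>j<N. c k j * \<psi> j v) else t k) =
    (\<Sum>I\<in>{..<m} \<rightarrow>\<^sub>E {..<N}. (\<Prod>k<m. c k (I k)) * T (\<lambda>k\<in>{..<p}. if k < m then \<psi> (I k) else t k))"
  using m t
proof (induction m arbitrary: t)
  case 0
  then show ?case by simp
next
  case (Suc m)
  let ?l = "\<lambda>k v. \<Sum>j<N. c k j * \<psi> j v"
  have l: "?l k \<in> W" for k by (intro function_space_sum W \<psi>) simp
  have "T (\<lambda>k\<in>{..<p}. if k < Suc m then ?l k else t k)
      = T (\<lambda>k\<in>{..<p}. if k < m then ?l k else (t(m := ?l m)) k)"
    by (rule arg_cong[of _ _ T], rule ext) (simp add: less_Suc_eq)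
  also have "\<dots> = (\<Sum>I\<in>{..<m} \<rightarrow>\<^sub>E {..<N}. (\<Prod>k<m. c k (I k)) *
      T (\<lambda>k\<in>{..<p}. if k < m then \<psi> (I k) else (t(m := ?l m)) k))"
    using Suc.prems l by (intro Suc.IH) auto
  also have "\<dots> = (\<Sum>I\<in>{..<m} \<rightarrow>\<^sub>E {..<N}. \<Sum>j<N. (\<Prod>k<m. c k (I k)) * (c m j *
      T (\<lambda>k\<in>{..<p}. if k < m then \<psi> (I k) else (t(m := \<psi> j)) k)))"
  proof (rule sum.cong[OF refl])
    fix I assume I: "I \<in> {..<m} \<rightarrow>\<^sub>E {..<N}"
    let ?s = "\<lambda>k\<in>{..<p}. if k < m then \<psi> (I k) else t k"
    have upd: "(\<lambda>k\<in>{..<p}. if k < m then \<psi> (I k) else (t(m := x)) k) = ?s(m := x)" for x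
      using Suc.prems(1) by (intro ext) auto
    have s: "?s \<in> {..<p} \<rightarrow>\<^sub>E W" using Suc.prems \<psi> PiE_mem[OF I] by auto
    show "(\<Prod>k<m. c k (I k)) * T (\<lambda>k\<in>{..<p}. if k < m then \<psi> (I k) else (t(m := ?l m)) k) =
      (\<Sum>j<N. (\<Prod>k<m. c k (I k)) * (c m j *
      T (\<lambda>k\<in>{..<p}. if k < m then \<psi> (I k) else (t(m := \<psi> j)) k)))"
      unfolding upd using multilinear_sum[OF T s _ W finite_lessThan, of m N \<psi> "c m"] Suc.prems(1) \<psi>
      by (simp add: sum_distrib_left)
  qed
  also have "\<dots> = (\<Sum>I\<in>{..<Suc m} \<rightarrow>\<^sub>E {..<N}. (\<Prod>k<Suc m. c k (I k)) *
      T (\<lambda>k\<in>{..<p}. if k < Suc m then \<psi> (I k) else t k))"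
    unfolding sum_PiE_Suc
  proof (intro sum.cong refl)
    fix I j assume "I \<in> {..<m} \<rightarrow>\<^sub>E {..<N}" "j \<in> {..<N}"
    have "(\<lambda>k\<in>{..<p}. if k < m then \<psi> (I k) else (t(m := \<psi> j)) k)
       = (\<lambda>k\<in>{..<p}. if k < Suc m then \<psi> ((I(m := j)) k) else t k)"
      by (rule ext) (simp add: less_Suc_eq)
    then show "(\<Prod>k<m. c k (I k)) * (c m j * T (\<lambda>k\<in>{..<p}. if k < m then \<psi> (I k) else (t(m := \<psi> j)) k))
      = (\<Prod>k<Suc m. c k ((I(m := j)) k)) * T (\<lambda>k\<in>{..<p}. if k < Suc m then \<psi> ((I(m := j)) k) else t k)"
      by (simp add: mult.assoc)
  qed
  finally show ?case .
qed

lemma multilinear_expand: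
  assumes T: "T \<in> multilinear_forms p W" and W: "function_space W" and \<psi>: "\<And>j::nat. j < N \<Longrightarrow> \<psi> j \<in> W"
  shows "T (\<lambda>k\<in>{..<p}. \<lambda>v. \<Sum>j<N. c k j * \<psi> j v) =
    (\<Sum>I\<in>{..<p} \<rightarrow>\<^sub>E {..<N}. (\<Prod>k<p. c k (I k)) * T (\<lambda>k\<in>{..<p}. \<psi> (I k)))"
proof -
  have *: "(\<lambda>k\<in>{..<p}. if k < p then f k else (\<lambda>_. 0)) = (\<lambda>k\<in>{..<p}. f k)" for f :: "nat \<Rightarrow> 'a \<Rightarrow> complex"
    by (rule ext) simp
  show ?thesis
    using multilinear_expand_aux[OF T W \<psi> order_refl, where t = "\<lambda>_ _. 0" and c = c] W
    by (simp add: * function_space_def)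
qed

lemma multilinear_expand_diag:
  assumes T: "T \<in> multilinear_forms p W" and W: "function_space W" and \<psi>: "\<And>j::nat. j < N \<Longrightarrow> \<psi> j \<in> W"
  shows "T (diag_tuple p (\<lambda>v. \<Sum>j<N. c j * \<psi> j v)) =
    (\<Sum>I\<in>{..<p} \<rightarrow>\<^sub>E {..<N}. (\<Prod>k<p. c (I k)) * T (\<lambda>k\<in>{..<p}. \<psi> (I k)))"
  unfolding diag_tuple_def by (rule multilinear_expand[OF assms])

lemma multilinear_scale_all:
  assumes T: "T \<in> multilinear_forms p W" and W: "function_space W" and \<psi>: "\<psi> \<in> W"
  shows "T (\<lambda>k\<in>{..<p}. \<lambda>v. c k * \<psi> v) = (\<Prod>k<p. c k) * T (diag_tuple p \<psi>)"
proof -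
  have "{..<p} \<rightarrow>\<^sub>E {..<Suc 0} = {\<lambda>k\<in>{..<p}. 0}"
    by (auto simp: lessThan_Suc PiE_singleton intro!: ext)
  then show ?thesis
    using multilinear_expand[OF T W, where N = "Suc 0" and \<psi> = "\<lambda>_. \<psi>" and c = "\<lambda>k _. c k"] \<psi> by (simp add: diag_tuple_def)
qed

lemma multilinear_diag_scale:
  assumes T: "T \<in> multilinear_forms p W" and W: "function_space W" and \<psi>: "\<psi> \<in> W"
  shows "T (diag_tuple p (\<lambda>v. c * \<psi> v)) = c ^ p * T (diag_tuple p \<psi>)"
  using multilinear_scale_all[OF assms, where c = "\<lambda>_. c"] by (simp add: diag_tuple_def)

lemma multilinear_diag_zero:
  assumes T: "T \<in> multilinear_forms p W" and W: "function_space W" and "0 < p"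
  shows "T (diag_tuple p (\<lambda>_. 0)) = 0"
  using multilinear_diag_scale[OF T W, where \<psi> = "\<lambda>_. 0" and c = 0] assms by (auto simp: function_space_def zero_power)

text \<open>Inclusion-exclusion: expand the product over \<open>i\<close> in \<open>P\<close> of
  \<open>1 + x i\<close>, where \<open>x i\<close> is \<open>0\<close> on \<open>B\<close> and
  \<open>-1\<close> off \<open>B\<close>. The product is the right side, its expansion over subsets
  \<open>A\<close> the left side.\<close>

lemma sum_Pow_alternating:
  assumes "finite P"
  shows "(\<Sum>A\<in>Pow P. (-1) ^ card (P - A) * (if B \<inter> P \<subseteq> A then 1 else 0)) =
    (if P \<subseteq> B then 1 else (0::complex))"
proof -
  have "(\<Prod>i\<in>P. 1 + (if i \<in> B then 0 else (-1::complex)))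
      = (\<Sum>A\<in>Pow P. (\<Prod>i\<in>A. 1) * (\<Prod>i\<in>P - A. if i \<in> B then 0 else (-1::complex)))"
    by (rule prod_add[OF assms])
  also have "\<dots> = (\<Sum>A\<in>Pow P. (-1) ^ card (P - A) * (if B \<inter> P \<subseteq> A then 1 else 0))"
  proof (rule sum.cong[OF refl])
    fix A assume A: "A \<in> Pow P"
    show "(\<Prod>i\<in>A. 1) * (\<Prod>i\<in>P - A. if i \<in> B then 0 else (-1::complex)) =
      (-1) ^ card (P - A) * (if B \<inter> P \<subseteq> A then 1 else 0)"
    proof (cases "B \<inter> P \<subseteq> A")
      case True
      then have "(\<Prod>i\<in>P - A. if i \<in> B then 0 else (-1::complex)) = (\<Prod>i\<in>P - A. -1)"
        by (intro prod.cong) auto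
      then show ?thesis using True by simp
    next
      case False
      then obtain i where "i \<in> P - A" "i \<in> B" by blast
      then have "(\<Prod>i\<in>P - A. if i \<in> B then 0 else (-1::complex)) = 0"
        using assms by (intro prod_zero) auto
      then show ?thesis using False by simp
    qed
  qed
  also have "(\<Prod>i\<in>P. 1 + (if i \<in> B then 0 else (-1::complex))) = (if P \<subseteq> B then 1 else 0)"
  proof (cases "P \<subseteq> B")
    case True
    then show ?thesis by (simp add: subset_iff)
  next
    case False
    then show ?thesis using assms by (auto intro!: prod_zero)
  qed
  finally show ?thesis by simp
qed

text \<open>The letter \<open>p\<close> stands for the base point in polarization. A tuple of length
  \<open>p\<close> that meets all smaller letters has no slot left for it and is a
  permutation.\<close>

lemma sum_surjections:
  fixes g :: "(nat \<Rightarrow> nat) \<Rightarrow> complex"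
  shows "(\<Sum>I\<in>{I \<in> {..<p} \<rightarrow>\<^sub>E {..<Suc p}. {..<p} \<subseteq> I ` {..<p}}. g I)
     = (\<Sum>\<sigma> | \<sigma> permutes {..<p}. g (restrict \<sigma> {..<p}))"
proof (rule sum.reindex_bij_witness[where i = "\<lambda>\<sigma>. restrict \<sigma> {..<p}" and
    j = "\<lambda>I k. if k < p then I k else k"])
  fix I assume "I \<in> {I \<in> {..<p} \<rightarrow>\<^sub>E {..<Suc p}. {..<p} \<subseteq> I ` {..<p}}"
  then have I: "I \<in> {..<p} \<rightarrow>\<^sub>E {..<Suc p}" "{..<p} \<subseteq> I ` {..<p}" by auto
  show eq: "restrict (\<lambda>k. if k < p then I k else k) {..<p} = I"
    using I(1) by (intro ext) (auto simp: PiE_def extensional_def restrict_def)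
  then show "g (restrict (\<lambda>k. if k < p then I k else k) {..<p}) = g I" by simp
  have im: "I ` {..<p} = {..<p}"
    using card_seteq[OF _ I(2)] card_image_le[of "{..<p}" I] by simp
  moreover have "inj_on I {..<p}"
    using eq_card_imp_inj_on[of "{..<p}" I] im by simp
  ultimately have "bij_betw I {..<p} {..<p}" by (simp add: bij_betw_def)
  then have "bij_betw (\<lambda>k. if k < p then I k else k) {..<p} {..<p}"
    by (subst bij_betw_cong[of _ _ I]) auto
  then show "(\<lambda>k. if k < p then I k else k) \<in> {\<sigma>. \<sigma> permutes {..<p}}"
    by (auto intro!: bij_imp_permutes split: if_splits)
next
  fix \<sigma> assume s: "\<sigma> \<in> {\<sigma>. \<sigma> permutes {..<p}}"
  then have "\<sigma> permutes {..<p}" by simp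
  then have "\<sigma> k = k" if "\<not> k < p" for k using that by (simp add: permutes_def)
  then show "(\<lambda>k. if k < p then restrict \<sigma> {..<p} k else k) = \<sigma>" by (intro ext) simp
  have im: "\<sigma> ` {..<p} = {..<p}" using s permutes_image by blast
  then have "\<sigma> k < Suc p" if "k < p" for k
    using permutes_in_image[OF \<open>\<sigma> permutes {..<p}\<close>, of k] that by simp
  moreover have "restrict \<sigma> {..<p} ` {..<p} = {..<p}" using im by simp
  ultimately show "restrict \<sigma> {..<p} \<in> {I \<in> {..<p} \<rightarrow>\<^sub>E {..<Suc p}. {..<p} \<subseteq> I ` {..<p}}"
    by (simp add: restrict_PiE_iff)
qed

text \<open>The condition of \<open>sym_fiber\<close>, freed from the bundle so that it makes sense
  over any space of functionals.\<close>

definition symmetric_form :: "nat \<Rightarrow> ('v \<Rightarrow> complex) set \<Rightarrow> 'v form \<Rightarrow> bool" where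
  "symmetric_form p W T \<longleftrightarrow> T \<in> multilinear_forms p W \<and>
     (\<forall>\<sigma>. \<sigma> permutes {..<p} \<longrightarrow> (\<forall>t \<in> {..<p} \<rightarrow>\<^sub>E W. T (t \<circ> \<sigma>) = T t))"

text \<open>The base point \<open>z\<close> is free; it drops out because the alternating sum is a \<open>p\<close>-th difference.\<close>

lemma polarization:
  assumes T: "symmetric_form p W T" and W: "function_space W"
    and t: "t \<in> {..<p} \<rightarrow>\<^sub>E W" and z: "z \<in> W"
  shows "(\<Sum>A\<in>Pow {..<p}. (-1) ^ card ({..<p} - A) * T (diag_tuple p (\<lambda>v. z v + (\<Sum>i\<in>A. t i v))))
    = fact p * T t"
proof -
  let ?P = "{..<p}"
  \<comment> \<open>The base point gets the extra index \<open>p\<close>, and its coefficient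
    \<open>c A p\<close> is \<open>1\<close> for every \<open>A\<close>.\<close>
  define \<psi> where "\<psi> = (\<lambda>i. if i < p then t i else z)"
  define c :: "nat set \<Rightarrow> nat \<Rightarrow> complex" where "c A i = (if i \<in> A \<union> {p} then 1 else 0)" for A i
  have T': "T \<in> multilinear_forms p W" using T by (simp add: symmetric_form_def)
  have \<psi>: "\<psi> i \<in> W" for i using t z by (auto simp: \<psi>_def)
  have "T (diag_tuple p (\<lambda>v. z v + (\<Sum>i\<in>A. t i v))) =
     (\<Sum>I\<in>?P \<rightarrow>\<^sub>E {..<Suc p}. (if I ` ?P \<inter> ?P \<subseteq> A then 1 else 0) * T (\<lambda>k\<in>?P. \<psi> (I k)))"
    if A: "A \<in> Pow ?P" for A
  proof -
    have "z v + (\<Sum>i\<in>A. t i v) = (\<Sum>i<Suc p. c A i * \<psi> i v)" for v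
    proof -
      have "(\<Sum>i<p. c A i * \<psi> i v) = (\<Sum>i\<in>A. t i v)"
        using A by (intro sum.mono_neutral_cong_right) (auto simp: c_def \<psi>_def)
      then show ?thesis using A by (simp add: c_def \<psi>_def)
    qed
    then have "T (diag_tuple p (\<lambda>v. z v + (\<Sum>i\<in>A. t i v))) =
        (\<Sum>I\<in>?P \<rightarrow>\<^sub>E {..<Suc p}. (\<Prod>k<p. c A (I k)) * T (\<lambda>k\<in>?P. \<psi> (I k)))"
      by (simp only:) (rule multilinear_expand_diag[OF T' W \<psi>])
    also have "\<dots> = (\<Sum>I\<in>?P \<rightarrow>\<^sub>E {..<Suc p}. (if I ` ?P \<inter> ?P \<subseteq> A then 1 else 0) * T (\<lambda>k\<in>?P. \<psi> (I k)))"
    proof (rule sum.cong[OF refl])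
      fix I assume I: "I \<in> ?P \<rightarrow>\<^sub>E {..<Suc p}"
      have "(\<Prod>k<p. c A (I k)) = (if I ` ?P \<inter> ?P \<subseteq> A then 1 else 0)"
      proof (cases "I ` ?P \<inter> ?P \<subseteq> A")
        case True
        have "c A (I k) = 1" if "k < p" for k
        proof -
          have "I k < Suc p" using I that by auto
          then have "I k \<in> A \<union> {p}" using True that by (auto simp: less_Suc_eq)
          then show ?thesis by (simp add: c_def)
        qed
        then show ?thesis using True by simp
      next
        case False
        then obtain k where "k < p" "I k < p" "I k \<notin> A" by auto
        then have "\<exists>k\<in>?P. c A (I k) = 0" by (auto simp: c_def)
        then have "(\<Prod>k<p. c A (I k)) = 0" by (intro prod_zero) auto
        then show ?thesis using False by simp
      qed
      then show "(\<Prod>k<p. c A (I k)) * T (\<lambda>k\<in>?P. \<psi> (I k)) =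
        (if I ` ?P \<inter> ?P \<subseteq> A then 1 else 0) * T (\<lambda>k\<in>?P. \<psi> (I k))" by simp
    qed
    finally show ?thesis .
  qed
  then have "(\<Sum>A\<in>Pow ?P. (-1) ^ card (?P - A) * T (diag_tuple p (\<lambda>v. z v + (\<Sum>i\<in>A. t i v))))
    = (\<Sum>A\<in>Pow ?P. \<Sum>I\<in>?P \<rightarrow>\<^sub>E {..<Suc p}. ((-1) ^ card (?P - A) * (if I ` ?P \<inter> ?P \<subseteq> A then 1 else 0)) * T (\<lambda>k\<in>?P. \<psi> (I k)))"
    by (simp only: sum_distrib_left mult.assoc cong: sum.cong)
  \<comment> \<open>After exchanging the sums, the alternating sum over \<open>A\<close> removes
    every tuple that misses an index below \<open>p\<close>, in particular all those that use the
    base point.\<close>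
  also have "\<dots> = (\<Sum>I\<in>?P \<rightarrow>\<^sub>E {..<Suc p}. (if ?P \<subseteq> I ` ?P then 1 else 0) * T (\<lambda>k\<in>?P. \<psi> (I k)))"
    by (subst sum.swap) (simp only: sum_distrib_right[symmetric] sum_Pow_alternating[OF finite_lessThan])
  also have "\<dots> = (\<Sum>I\<in>{I \<in> ?P \<rightarrow>\<^sub>E {..<Suc p}. ?P \<subseteq> I ` ?P}. T (\<lambda>k\<in>?P. \<psi> (I k)))"
    by (rule sum.mono_neutral_cong_right) (auto simp: finite_PiE_lessThan)
  also have "\<dots> = (\<Sum>\<sigma> | \<sigma> permutes ?P. T (\<lambda>k\<in>?P. \<psi> (restrict \<sigma> ?P k)))"
    by (rule sum_surjections)
  also have "\<dots> = (\<Sum>\<sigma> | \<sigma> permutes ?P. T t)"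
  proof (rule sum.cong[OF refl])
    fix \<sigma> assume "\<sigma> \<in> {\<sigma>. \<sigma> permutes ?P}"
    then have s: "\<sigma> permutes ?P" by simp
    have "(\<lambda>k\<in>?P. \<psi> (restrict \<sigma> ?P k)) = t \<circ> \<sigma>"
    proof
      fix k
      show "(\<lambda>k\<in>?P. \<psi> (restrict \<sigma> ?P k)) k = (t \<circ> \<sigma>) k"
      proof (cases "k < p")
        case True
        then have "\<sigma> k < p" using permutes_in_image[OF s, of k] by simp
        then show ?thesis using True by (simp add: \<psi>_def)
      next
        case False
        then have "\<sigma> k = k" using s by (simp add: permutes_def)
        then show ?thesis using False t by (auto simp: PiE_def extensional_def)
      qed
    qed
    then show "T (\<lambda>k\<in>?P. \<psi> (restrict \<sigma> ?P k)) = T t"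
      using T t s by (simp add: symmetric_form_def)
  qed
  also have "\<dots> = fact p * T t"
    using card_permutations[of ?P p] by simp
  finally show ?thesis .
qed

text \<open>Polarization at base point \<open>0\<close> expresses every value through diagonal
  values.\<close>

lemma symmetric_form_eqI:
  assumes S: "symmetric_form p W S" and T: "symmetric_form p W T" and W: "function_space W"
    and eq: "\<And>\<phi>. \<phi> \<in> W \<Longrightarrow> S (diag_tuple p \<phi>) = T (diag_tuple p \<phi>)"
  shows "S = T"
proof
  fix t
  show "S t = T t"
  proof (cases "t \<in> {..<p} \<rightarrow>\<^sub>E W")
    case True
    have "(\<lambda>v. 0 + (\<Sum>i\<in>A. t i v)) \<in> W" if "A \<in> Pow {..<p}" for A
      using True that by (simp, intro function_space_sum1 W) auto
    then have "(\<Sum>A\<in>Pow {..<p}. (-1) ^ card ({..<p} - A) * S (diag_tuple p (\<lambda>v. 0 + (\<Sum>i\<in>A. t i v))))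
      = (\<Sum>A\<in>Pow {..<p}. (-1) ^ card ({..<p} - A) * T (diag_tuple p (\<lambda>v. 0 + (\<Sum>i\<in>A. t i v))))"
      by (intro sum.cong refl arg_cong2[of _ _ _ _ times] eq)
    then have "(fact p :: complex) * S t = fact p * T t"
      using polarization[OF S W True] polarization[OF T W True] W
      by (simp only: function_space_def)
    then show ?thesis by simp
  next
    case False
    then show ?thesis using S T multilinear_outside by (metis symmetric_form_def)
  qed
qed

text \<open>Average over all permutations of the slots; a diagonal tuple is fixed by each of them,
  so its value survives.\<close>

lemma multilinear_symmetrize:
  assumes T: "T \<in> multilinear_forms p W"
  obtains S where "symmetric_form p W S" "\<And>\<phi>. \<phi> \<in> W \<Longrightarrow> S (diag_tuple p \<phi>) = T (diag_tuple p \<phi>)"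
proof -
  let ?\<Sigma> = "{\<sigma>. \<sigma> permutes {..<p}}"
  define S where "S t = (\<Sum>\<sigma>\<in>?\<Sigma>. T (t \<circ> \<sigma>)) / fact p" for t
  have PiE: "t \<circ> \<sigma> \<in> {..<p} \<rightarrow>\<^sub>E W \<longleftrightarrow> t \<in> {..<p} \<rightarrow>\<^sub>E W" if s: "\<sigma> permutes {..<p}" for t \<sigma>
  proof -
    have *: "t \<circ> \<sigma> \<in> {..<p} \<rightarrow>\<^sub>E W" if "t \<in> {..<p} \<rightarrow>\<^sub>E W" "\<sigma> permutes {..<p}" for t \<sigma>
      using that permutes_in_image[OF that(2)]
      by (auto simp: PiE_def extensional_def Pi_def permutes_def)
    show ?thesis
      using *[OF _ s] *[OF _ permutes_inv[OF s], of "t \<circ> \<sigma>"]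
      by (auto simp: comp_assoc permutes_inv_o[OF s])
  qed
  have upd: "t(i := x) \<circ> \<sigma> = (t \<circ> \<sigma>)(inv_into UNIV \<sigma> i := x)" if "\<sigma> permutes {..<p}" for t i x \<sigma>
    using permutes_inverses[OF that] by (auto simp: fun_eq_iff)
  have inv: "inv_into UNIV \<sigma> i < p" if "\<sigma> permutes {..<p}" "i < p" for \<sigma> i
    using permutes_in_image[OF permutes_inv[OF that(1)], of i] that(2) by simp
  have "S \<in> multilinear_forms p W"
    unfolding multilinear_forms_def
  proof (intro CollectI conjI allI impI ballI)
    fix t assume "t \<notin> {..<p} \<rightarrow>\<^sub>E W"
    then show "S t = 0" using PiE multilinear_outside[OF T] by (simp add: S_def)
  next
    fix t i \<phi> \<psi> assume *: "t \<in> {..<p} \<rightarrow>\<^sub>E W" "i < p" "\<phi> \<in> W" "\<psi> \<in> W"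
    have "(\<Sum>\<sigma>\<in>?\<Sigma>. T (t(i := \<lambda>v. \<phi> v + \<psi> v) \<circ> \<sigma>)) = (\<Sum>\<sigma>\<in>?\<Sigma>. T (t(i := \<phi>) \<circ> \<sigma>) + T (t(i := \<psi>) \<circ> \<sigma>))"
      by (intro sum.cong refl) (simp add: upd multilinear_add[OF T] PiE * inv)
    then show "S (t(i := \<lambda>v. \<phi> v + \<psi> v)) = S (t(i := \<phi>)) + S (t(i := \<psi>))"
      by (simp add: S_def sum.distrib add_divide_distrib)
  next
    fix t i \<phi> \<psi> c assume *: "t \<in> {..<p} \<rightarrow>\<^sub>E W" "i < p" "\<phi> \<in> W" "\<psi> \<in> W"
    have "(\<Sum>\<sigma>\<in>?\<Sigma>. T (t(i := \<lambda>v. c * \<phi> v) \<circ> \<sigma>)) = (\<Sum>\<sigma>\<in>?\<Sigma>. c * T (t(i := \<phi>) \<circ> \<sigma>))"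
      by (intro sum.cong refl) (simp add: upd multilinear_scale[OF T] PiE * inv)
    then show "S (t(i := \<lambda>v. c * \<phi> v)) = c * S (t(i := \<phi>))"
      by (simp add: S_def sum_distrib_left)
  qed
  moreover have "S (t \<circ> \<tau>) = S t" if tau: "\<tau> permutes {..<p}" for t \<tau>
  proof -
    have "(\<Sum>\<sigma>\<in>?\<Sigma>. T (t \<circ> \<tau> \<circ> \<sigma>)) = (\<Sum>\<sigma>\<in>?\<Sigma>. T (t \<circ> \<sigma>))"
      by (rule sum.reindex_bij_witness[where i = "\<lambda>\<sigma>. inv_into UNIV \<tau> \<circ> \<sigma>" and j = "\<lambda>\<sigma>. \<tau> \<circ> \<sigma>"])
        (use tau permutes_inv_o[OF tau] permutes_inv[OF tau] in
          \<open>auto simp: comp_assoc[symmetric] intro: permutes_compose\<close>)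
    then show ?thesis by (simp add: S_def)
  qed
  moreover have "S (diag_tuple p \<phi>) = T (diag_tuple p \<phi>)" for \<phi>
  proof -
    have "diag_tuple p \<phi> \<circ> \<sigma> = diag_tuple p \<phi>" if "\<sigma> permutes {..<p}" for \<sigma>
      using permutes_in_image[OF that] by (auto simp: diag_tuple_def fun_eq_iff restrict_def)
    then show ?thesis using card_permutations[of "{..<p}" p] by (simp add: S_def)
  qed
  ultimately show thesis by (intro that[of S]) (auto simp: symmetric_form_def)
qed

section \<open>Linear algebra of the fibers\<close>

text \<open>The linear and metric axioms at one point, without holomorphy. The norm estimates are
  proved in this context with constants defined outside it, which makes them uniform in
  \<open>x\<close>.\<close>

locale herm_fiber =
  fixes E :: "('m, 'v::ab_group_add) herm_bundle" and x :: 'm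
  assumes vector_space_smul: "vector_space (smul E)"
    and basis_exists: "\<exists>b. basis_of E x b"
    and hmet_add: "\<And>u v w. u \<in> fiber E x \<Longrightarrow> v \<in> fiber E x \<Longrightarrow> w \<in> fiber E x \<Longrightarrow>
      hmet E x (u + v) w = hmet E x u w + hmet E x v w"
    and hmet_scale: "\<And>u w c. u \<in> fiber E x \<Longrightarrow> w \<in> fiber E x \<Longrightarrow>
      hmet E x (smul E c u) w = c * hmet E x u w"
    and hmet_sym: "\<And>u w. u \<in> fiber E x \<Longrightarrow> w \<in> fiber E x \<Longrightarrow> hmet E x w u = cnj (hmet E x u w)"
    and hmet_pos: "\<And>v. v \<in> fiber E x \<Longrightarrow> v \<noteq> 0 \<Longrightarrow> 0 < Re (hmet E x v v)"
begin

sublocale V: vector_space "smul E" by (rule vector_space_smul)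

abbreviation "F \<equiv> fiber E x"
abbreviation "D \<equiv> dual_fiber E x"
abbreviation "r \<equiv> brank E"

lemma basis_inj: "basis_of E x b \<Longrightarrow> inj_on b {..<r}"
  and basis_indep: "basis_of E x b \<Longrightarrow> \<not> V.dependent (b ` {..<r})"
  and basis_span: "basis_of E x b \<Longrightarrow> V.span (b ` {..<r}) = F"
  by (simp_all add: basis_of_def)

lemma subspace_fiber: "V.subspace F"
  using basis_exists basis_span V.subspace_span by metis

lemma fiber_zero: "0 \<in> F"
  and fiber_add: "u \<in> F \<Longrightarrow> v \<in> F \<Longrightarrow> u + v \<in> F"
  and fiber_scale: "u \<in> F \<Longrightarrow> smul E c u \<in> F"
  and fiber_diff: "u \<in> F \<Longrightarrow> v \<in> F \<Longrightarrow> u - v \<in> F"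
  and fiber_sum: "(\<And>i. i \<in> I \<Longrightarrow> g i \<in> F) \<Longrightarrow> (\<Sum>i\<in>I. g i) \<in> F"
  by (rule V.subspace_0[OF subspace_fiber] V.subspace_add[OF subspace_fiber]
      V.subspace_scale[OF subspace_fiber] V.subspace_diff[OF subspace_fiber]
      V.subspace_sum[OF subspace_fiber]; assumption)+

lemma basis_in_fiber: "basis_of E x b \<Longrightarrow> i < r \<Longrightarrow> b i \<in> F"
  using basis_span[of b] V.span_base[of "b i" "b ` {..<r}"] by auto

lemma dual_basis_basis:
  assumes b: "basis_of E x b" and "i < r" "k < r"
  shows "dual_basis E b i (b k) = (if i = k then 1 else 0)"
  using V.representation_basis[OF basis_indep[OF b], of "b k"] assms inj_onD[OF basis_inj[OF b], of i k]
  by (auto simp: dual_basis_def)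

lemma dual_basis_in:
  assumes b: "basis_of E x b"
  shows "dual_basis E b i \<in> D"
  \<comment> \<open>\<open>representation\<close> is \<open>0\<close> off the span by definition,
    which agrees with the extension by \<open>0\<close> demanded of dual functionals.\<close>
  unfolding dual_fiber_def
  using V.representation_add[OF basis_indep[OF b]] V.representation_scale[OF basis_indep[OF b]]
  by (auto simp: dual_basis_def basis_span[OF b] V.representation_def)

lemma fiber_expand:
  assumes b: "basis_of E x b" and v: "v \<in> F"
  shows "(\<Sum>i<r. smul E (dual_basis E b i v) (b i)) = v"
  using V.sum_representation_eq[OF basis_indep[OF b] _ _ order_refl, of v] v
  by (simp add: dual_basis_def basis_span[OF b] sum.reindex[OF basis_inj[OF b]])

lemma function_space_dual: "function_space D"
  unfolding function_space_def dual_fiber_def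
  by (auto simp: algebra_simps)

lemma dual_outside: "\<phi> \<in> D \<Longrightarrow> v \<notin> F \<Longrightarrow> \<phi> v = 0"
  and dual_add: "\<phi> \<in> D \<Longrightarrow> u \<in> F \<Longrightarrow> v \<in> F \<Longrightarrow> \<phi> (u + v) = \<phi> u + \<phi> v"
  and dual_scale: "\<phi> \<in> D \<Longrightarrow> v \<in> F \<Longrightarrow> \<phi> (smul E c v) = c * \<phi> v"
  unfolding dual_fiber_def by blast+

lemma dual_zero: "\<phi> \<in> D \<Longrightarrow> \<phi> 0 = 0"
  using dual_scale[of \<phi> 0 0] fiber_zero by simp

lemma dual_sum:
  assumes \<phi>: "\<phi> \<in> D" and "\<And>i. i \<in> I \<Longrightarrow> g i \<in> F"
  shows "\<phi> (\<Sum>i\<in>I. smul E (c i) (g i)) = (\<Sum>i\<in>I. c i * \<phi> (g i))"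
  using assms(2)
proof (induction I rule: infinite_finite_induct)
  case (insert y I)
  then have "\<phi> (smul E (c y) (g y) + (\<Sum>i\<in>I. smul E (c i) (g i))) = c y * \<phi> (g y) + (\<Sum>i\<in>I. c i * \<phi> (g i))"
    using dual_add[OF \<phi>, of "smul E (c y) (g y)" "\<Sum>i\<in>I. smul E (c i) (g i)"] dual_scale[OF \<phi>, of "g y"]
    by (simp add: fiber_scale fiber_sum)
  then show ?case using insert by simp
qed (simp_all add: dual_zero[OF \<phi>])

lemma dual_expand:
  assumes b: "basis_of E x b" and \<phi>: "\<phi> \<in> D"
  shows "(\<lambda>v. \<Sum>i<r. \<phi> (b i) * dual_basis E b i v) = \<phi>"
proof
  fix v
  show "(\<Sum>i<r. \<phi> (b i) * dual_basis E b i v) = \<phi> v"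
  proof (cases "v \<in> F")
    case True
    have "\<phi> v = \<phi> (\<Sum>i<r. smul E (dual_basis E b i v) (b i))" by (simp add: fiber_expand[OF b True])
    also have "\<dots> = (\<Sum>i<r. dual_basis E b i v * \<phi> (b i))"
      by (rule dual_sum[OF \<phi>]) (simp add: basis_in_fiber[OF b])
    finally show ?thesis by (simp add: mult.commute)
  next
    case False
    then show ?thesis using dual_outside[OF \<phi>] dual_outside[OF dual_basis_in[OF b]] by simp
  qed
qed

text \<open>Linear coordinates on the dual fiber. Only the entries of \<open>c\<close> below the
  rank matter, so \<open>c\<close> may be any member of \<open>cn\<close>.\<close>

definition lin :: "(nat \<Rightarrow> 'v) \<Rightarrow> cn \<Rightarrow> 'v \<Rightarrow> complex" where
  "lin b c = (\<lambda>v. \<Sum>i<r. c i * dual_basis E b i v)"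

lemma lin_in: "basis_of E x b \<Longrightarrow> lin b c \<in> D"
  unfolding lin_def by (intro function_space_sum function_space_dual dual_basis_in)

lemma lin_basis:
  assumes "basis_of E x b" "k < r"
  shows "lin b c (b k) = c k"
proof -
  have "lin b c (b k) = (\<Sum>i<r. if i = k then c i else 0)"
    unfolding lin_def by (rule sum.cong) (simp_all add: dual_basis_basis[OF assms(1) _ assms(2)])
  then show ?thesis using assms(2) by simp
qed

lemma lin_expand: "basis_of E x b \<Longrightarrow> \<phi> \<in> D \<Longrightarrow> lin b (\<lambda>i. \<phi> (b i)) = \<phi>"
  unfolding lin_def by (rule dual_expand)

lemma lin_cong: "(\<And>i. i < r \<Longrightarrow> c i = d i) \<Longrightarrow> lin b c = lin b d"
  by (simp add: lin_def)

lemma lin_scale: "lin b (\<lambda>i. a * c i) = (\<lambda>v. a * lin b c v)"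
  by (simp add: lin_def sum_distrib_left mult.assoc)

lemma lin_zero: "lin b (\<lambda>_. 0) = (\<lambda>_. 0)"
  by (simp add: lin_def)

lemma lin_eq_0_iff: "basis_of E x b \<Longrightarrow> lin b c = (\<lambda>_. 0) \<longleftrightarrow> (\<forall>i<r. c i = 0)"
  by (metis lin_basis lin_cong[of c "\<lambda>_. 0"] lin_zero)

lemma dual_eqI:
  assumes "basis_of E x b" "\<phi> \<in> D" "\<psi> \<in> D" "\<And>i. i < r \<Longrightarrow> \<phi> (b i) = \<psi> (b i)"
  shows "\<phi> = \<psi>"
proof -
  have "lin b (\<lambda>i. \<phi> (b i)) = lin b (\<lambda>i. \<psi> (b i))" by (rule lin_cong) (rule assms(4))
  then show ?thesis by (simp only: lin_expand[OF assms(1,2)] lin_expand[OF assms(1,3)])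
qed

lemma hmet_functional: "w \<in> F \<Longrightarrow> metric_dual E x w \<in> D"
  unfolding dual_fiber_def metric_dual_def
  by (auto simp: hmet_add hmet_scale fiber_add fiber_scale)

lemma hmet_sum:
  assumes w: "w \<in> F" and g: "\<And>i. i \<in> I \<Longrightarrow> g i \<in> F"
  shows "hmet E x (\<Sum>i\<in>I. smul E (c i) (g i)) w = (\<Sum>i\<in>I. c i * hmet E x (g i) w)"
proof -
  have "metric_dual E x w (\<Sum>i\<in>I. smul E (c i) (g i)) = (\<Sum>i\<in>I. c i * metric_dual E x w (g i))"
    by (rule dual_sum[OF hmet_functional[OF w] g])
  then show ?thesis using g by (simp add: metric_dual_def fiber_sum fiber_scale)
qed

text \<open>Both span conditions are carried along: the first keeps \<open>c\<close> in the fiber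
  and, by independence of \<open>e\<close>, makes the remainder \<open>w\<close> nonzero; the second
  makes the final system span the fiber.\<close>

lemma gram_schmidt:
  assumes e: "basis_of E x e"
  shows "k \<le> r \<Longrightarrow> \<exists>c. (\<forall>i<k. c i \<in> V.span (e ` {..<k})) \<and> (\<forall>i<k. e i \<in> V.span (c ` {..<k})) \<and>
    (\<forall>i<k. \<forall>j<k. hmet E x (c i) (c j) = (if i = j then 1 else 0))"
proof (induction k)
  case 0
  then show ?case by simp
next
  case (Suc k)
  from Suc.IH[OF Suc_leD[OF Suc.prems]] obtain c where "(\<forall>i<k. c i \<in> V.span (e ` {..<k})) \<and> (\<forall>i<k. e i \<in> V.span (c ` {..<k})) \<and>
    (\<forall>i<k. \<forall>j<k. hmet E x (c i) (c j) = (if i = j then 1 else 0))"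
    ..
  note c = this[THEN conjunct1, rule_format] this[THEN conjunct2, THEN conjunct1, rule_format]
    this[THEN conjunct2, THEN conjunct2, rule_format]
  have spanF: "V.span (e ` {..<k}) \<subseteq> F"
  proof (intro V.span_minimal subspace_fiber image_subsetI)
    show "e i \<in> F" if "i \<in> {..<k}" for i using basis_in_fiber[OF e, of i] Suc.prems that by simp
  qed
  have cF: "c i \<in> F" if "i < k" for i using c(1) spanF that by blast
  have eF: "e k \<in> F" using Suc.prems basis_in_fiber[OF e] by simp
  define u where "u = (\<Sum>i<k. smul E (hmet E x (e k) (c i)) (c i))"
  define w where "w = e k - u"
  have uF: "u \<in> F" unfolding u_def by (intro fiber_sum fiber_scale cF) simp
  have wF: "w \<in> F" unfolding w_def by (intro fiber_diff eF uF)
  have u_span: "u \<in> V.span (c ` {..<k})"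
    unfolding u_def by (intro V.span_sum V.span_scale V.span_base) auto
  have u_span': "u \<in> V.span (e ` {..<k})"
    unfolding u_def using c(1) by (intro V.span_sum V.span_scale) auto
  have "w \<noteq> 0"
  proof
    assume "w = 0"
    then have "e k \<in> V.span (e ` {..<k})" using u_span' by (simp add: w_def)
    moreover have "e ` {..<k} \<subseteq> e ` {..<r} - {e k}"
      using inj_onD[OF basis_inj[OF e]] Suc.prems by fastforce
    ultimately have "e k \<in> V.span (e ` {..<r} - {e k})" using V.span_mono by blast
    moreover have "e k \<in> e ` {..<r}" using Suc.prems by auto
    ultimately show False using basis_indep[OF e] unfolding V.dependent_def by blast
  qed
  then have pos: "0 < Re (hmet E x w w)" using hmet_pos wF by blast
  have im: "Im (hmet E x w w) = 0" using arg_cong[OF hmet_sym[OF wF wF], of Im] by simp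
  define s where "s = sqrt (Re (hmet E x w w))"
  have s: "s > 0" "of_real s * of_real s = hmet E x w w"
    using pos im by (auto simp: s_def complex_eq_iff)
  define d where "d = smul E (of_real (1 / s)) w"
  have dF: "d \<in> F" unfolding d_def by (intro fiber_scale wF)
  have w_eq: "w = smul E (of_real s) d" using s(1) by (simp add: d_def)
  have huc: "hmet E x u (c j) = hmet E x (e k) (c j)" if "j < k" for j
  proof -
    have "hmet E x u (c j) = (\<Sum>i<k. hmet E x (e k) (c i) * hmet E x (c i) (c j))"
      unfolding u_def using that cF by (intro hmet_sum) auto
    also have "\<dots> = (\<Sum>i<k. if i = j then hmet E x (e k) (c i) else 0)"
      using that c(3) by (intro sum.cong) auto
    finally show ?thesis using that by simp
  qed
  have hwc: "hmet E x w (c j) = 0" if "j < k" for j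
  proof -
    have "hmet E x (w + u) (c j) = hmet E x w (c j) + hmet E x u (c j)"
      using hmet_add wF uF cF that by blast
    then show ?thesis using huc[OF that] by (simp add: w_def)
  qed
  have hdc: "hmet E x d (c j) = 0" if "j < k" for j
    using hwc[OF that] hmet_scale[OF wF cF[OF that]] by (simp add: d_def)
  have hcd: "hmet E x (c j) d = 0" if "j < k" for j
    using hdc[OF that] hmet_sym[OF dF cF[OF that]] by simp
  have hdd: "hmet E x d d = 1"
  proof -
    have dw: "hmet E x d w = of_real (1 / s) * (of_real s * of_real s)"
      unfolding d_def s(2) by (rule hmet_scale[OF wF wF])
    have "hmet E x d w = of_real s" unfolding dw using s(1) by simp
    then have wd: "hmet E x w d = of_real s" using hmet_sym[OF dF wF] by simp
    have "hmet E x d d = of_real (1 / s) * hmet E x w d"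
      using hmet_scale[OF wF dF, of "of_real (1 / s)"] unfolding d_def[symmetric] .
    then show ?thesis unfolding wd using s(1) by simp
  qed
  let ?c = "c(k := d)"
  have img: "?c ` {..<Suc k} = insert d (c ` {..<k})" by (auto simp: lessThan_Suc)
  have imge: "e ` {..<Suc k} = insert (e k) (e ` {..<k})" by (auto simp: lessThan_Suc)
  have 1: "?c i \<in> V.span (e ` {..<Suc k})" if "i < Suc k" for i
  proof (cases "i = k")
    case True
    have "w \<in> V.span (insert (e k) (e ` {..<k}))"
      unfolding w_def
    proof (rule V.span_diff)
      show "u \<in> V.span (insert (e k) (e ` {..<k}))"
        using u_span' V.span_mono[of "e ` {..<k}" "insert (e k) (e ` {..<k})"] by blast
    qed (simp add: V.span_base)
    then show ?thesis using True unfolding imge d_def by (simp add: V.span_scale)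
  next
    case False
    then show ?thesis using c(1)[of i] that V.span_mono[of "e ` {..<k}" "insert (e k) (e ` {..<k})"] unfolding imge by auto
  qed
  have 2: "e i \<in> V.span (?c ` {..<Suc k})" if "i < Suc k" for i
  proof (cases "i = k")
    case True
    have "w + u \<in> V.span (insert d (c ` {..<k}))"
    proof (rule V.span_add)
      show "u \<in> V.span (insert d (c ` {..<k}))"
        using u_span V.span_mono[of "c ` {..<k}" "insert d (c ` {..<k})"] by blast
      show "w \<in> V.span (insert d (c ` {..<k}))"
        unfolding w_eq by (intro V.span_scale V.span_base insertI1)
    qed
    then show ?thesis using True unfolding img by (simp add: w_def)
  next
    case False
    then show ?thesis using c(2)[of i] that V.span_mono[of "c ` {..<k}" "insert d (c ` {..<k})"] unfolding img by auto
  qed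
  have 3: "hmet E x (?c i) (?c j) = (if i = j then 1 else 0)" if "i < Suc k" "j < Suc k" for i j
    using that c(3)[of i j] hcd[of i] hdc[of j] hdd by (auto simp: less_Suc_eq)
  show ?case using 1 2 3 by blast
qed

text \<open>The choice in \<open>onb\<close> is not vacuous. Independence of the Gram-Schmidt system
  follows by pairing a vanishing combination with one of its vectors.\<close>

lemma onb:
  shows onb_basis: "basis_of E x (onb E x)"
    and onb_orthonormal: "i < r \<Longrightarrow> j < r \<Longrightarrow> hmet E x (onb E x i) (onb E x j) = (if i = j then 1 else 0)"
proof -
  obtain e where e: "basis_of E x e" using basis_exists by blast
  obtain c where c: "\<And>i. i < r \<Longrightarrow> c i \<in> V.span (e ` {..<r})" "\<And>i. i < r \<Longrightarrow> e i \<in> V.span (c ` {..<r})"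
    "\<And>i j. i < r \<Longrightarrow> j < r \<Longrightarrow> hmet E x (c i) (c j) = (if i = j then 1 else 0)"
    using gram_schmidt[OF e order_refl] by blast
  have cF: "c i \<in> F" if "i < r" for i using c(1)[OF that] basis_span[OF e] by simp
  have inj: "inj_on c {..<r}"
    using c(3) by (intro inj_onI) (metis lessThan_iff one_neq_zero)
  have span: "V.span (c ` {..<r}) = F"
  proof
    show "V.span (c ` {..<r}) \<subseteq> F" using cF by (intro V.span_minimal subspace_fiber) auto
    show "F \<subseteq> V.span (c ` {..<r})"
      unfolding basis_span[OF e, symmetric] using c(2) by (intro V.span_minimal V.subspace_span) auto
  qed
  have indep: "\<not> V.dependent (c ` {..<r})"
  proof
    assume "V.dependent (c ` {..<r})"
    then obtain u v where u: "v \<in> c ` {..<r}" "u v \<noteq> 0" "(\<Sum>v\<in>c ` {..<r}. smul E (u v) v) = 0"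
      using V.dependent_finite[of "c ` {..<r}"] by auto
    then obtain j where j: "j < r" "v = c j" by auto
    have "(\<Sum>i<r. smul E (u (c i)) (c i)) = 0" using u(3) by (simp add: sum.reindex[OF inj])
    then have "0 = hmet E x (\<Sum>i<r. smul E (u (c i)) (c i)) (c j)"
      using hmet_scale[OF fiber_zero cF[OF j(1)], of 0] by simp
    also have "\<dots> = (\<Sum>i<r. u (c i) * hmet E x (c i) (c j))"
      using j cF by (intro hmet_sum) auto
    also have "\<dots> = (\<Sum>i<r. if i = j then u (c i) else 0)"
      using j c(3) by (intro sum.cong) auto
    finally show False using j u by simp
  qed
  have "\<exists>b. basis_of E x b \<and> (\<forall>i<r. \<forall>j<r. hmet E x (b i) (b j) = (if i = j then 1 else 0))"
    using inj span indep c(3) by (auto simp: basis_of_def intro!: exI[of _ c])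
  from someI_ex[OF this] show "basis_of E x (onb E x)"
    "i < r \<Longrightarrow> j < r \<Longrightarrow> hmet E x (onb E x i) (onb E x j) = (if i = j then 1 else 0)"
    unfolding onb_def by blast+
qed

text \<open>\<open>le_potier\<close> is specified only on functionals of the form
  \<open>metric_dual E x v\<close>; this shows that they exhaust the dual fiber, so the
  specification determines a form.\<close>

lemma riesz:
  assumes \<phi>: "\<phi> \<in> D"
  obtains v where "v \<in> F" "metric_dual E x v = \<phi>"
proof -
  let ?b = "onb E x"
  \<comment> \<open>The coordinates are conjugated because \<open>v\<close> sits in the antilinear
    second argument of \<open>hmet\<close>.\<close>
  define v where "v = (\<Sum>i<r. smul E (cnj (\<phi> (?b i))) (?b i))"
  have bF: "?b i \<in> F" if "i < r" for i using basis_in_fiber[OF onb_basis that] .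
  have v: "v \<in> F" unfolding v_def by (intro fiber_sum fiber_scale bF) simp
  have "metric_dual E x v (?b j) = \<phi> (?b j)" if j: "j < r" for j
  proof -
    have "hmet E x v (?b j) = (\<Sum>i<r. cnj (\<phi> (?b i)) * hmet E x (?b i) (?b j))"
      unfolding v_def using j bF by (intro hmet_sum) auto
    also have "\<dots> = (\<Sum>i<r. if i = j then cnj (\<phi> (?b i)) else 0)"
      using j onb_orthonormal by (intro sum.cong) auto
    finally show ?thesis using j hmet_sym[OF v bF[OF j]] by (simp add: metric_dual_def bF)
  qed
  then have "metric_dual E x v = \<phi>"
    by (intro dual_eqI[OF onb_basis hmet_functional[OF v] \<phi>])
  then show thesis using that v by blast
qed

lemma metric_dual_zero: "metric_dual E x 0 = (\<lambda>_. 0)"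
proof
  fix w
  show "metric_dual E x 0 w = 0"
    using hmet_sym[OF fiber_zero, of w] hmet_scale[OF fiber_zero, of w 0] by (auto simp: metric_dual_def)
qed

end

section \<open>Lines of functionals and restriction of forms to them\<close>

lemma function_space_line: "function_space (line \<phi>)"
  unfolding function_space_def line_def
proof (intro conjI ballI allI)
  show "(\<lambda>_. 0) \<in> range (\<lambda>c v. c * \<phi> v)" by (rule range_eqI[of _ _ 0]) simp
  show "(\<lambda>v. \<alpha> v + \<beta> v) \<in> range (\<lambda>c v. c * \<phi> v)" if ab: "\<alpha> \<in> range (\<lambda>c v. c * \<phi> v)" "\<beta> \<in> range (\<lambda>c v. c * \<phi> v)" for \<alpha> \<beta>
  proof -
    obtain a b where "\<alpha> = (\<lambda>v. a * \<phi> v)" "\<beta> = (\<lambda>v. b * \<phi> v)" using ab by blast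
    then show ?thesis by (intro range_eqI[of _ _ "a + b"]) (simp add: distrib_right)
  qed
  show "(\<lambda>v. c * \<alpha> v) \<in> range (\<lambda>c v. c * \<phi> v)" if a: "\<alpha> \<in> range (\<lambda>c v. c * \<phi> v)" for c \<alpha>
  proof -
    obtain a where "\<alpha> = (\<lambda>v. a * \<phi> v)" using a by blast
    then show ?thesis by (intro range_eqI[of _ _ "c * a"]) (simp add: mult.assoc)
  qed
qed

lemma mem_line: "\<phi> \<in> line \<phi>"
  unfolding line_def by (rule range_eqI[of _ _ 1]) simp

lemma line_scale:
  assumes "c \<noteq> 0"
  shows "line (\<lambda>v. c * \<phi> v) = line \<phi>"
proof -
  have "range (\<lambda>a v. a * (c * \<phi> v)) = (\<lambda>a v. a * \<phi> v) ` range (\<lambda>a. a * c)"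
    by (auto simp: image_image mult.assoc)
  also have "range (\<lambda>a. a * c) = UNIV" using assms by (auto intro!: range_eqI[of _ _ "_ / c"])
  finally show ?thesis by (simp add: line_def)
qed

lemma line_eqI: "\<psi> \<in> line \<phi> \<Longrightarrow> \<psi> \<noteq> (\<lambda>_. 0) \<Longrightarrow> line \<psi> = line \<phi>"
proof -
  assume "\<psi> \<in> line \<phi>" "\<psi> \<noteq> (\<lambda>_. 0)"
  then obtain c where c: "\<psi> = (\<lambda>v. c * \<phi> v)" unfolding line_def by blast
  with \<open>\<psi> \<noteq> (\<lambda>_. 0)\<close> have "c \<noteq> 0" by auto
  then show ?thesis unfolding c by (rule line_scale)
qed

text \<open>Every argument is a tuple of multiples of \<open>\<phi>\<close>, so multilinearity pulls
  out the scalars and leaves one diagonal value.\<close>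

lemma multilinear_line_eqI:
  assumes s: "s \<in> multilinear_forms p (line \<phi>)" and s': "s' \<in> multilinear_forms p (line \<phi>)"
    and eq: "s (diag_tuple p \<phi>) = s' (diag_tuple p \<phi>)"
  shows "s = s'"
proof
  fix t
  show "s t = s' t"
  proof (cases "t \<in> {..<p} \<rightarrow>\<^sub>E line \<phi>")
    case True
    then have "\<forall>k\<in>{..<p}. \<exists>c. t k = (\<lambda>v. c * \<phi> v)" by (auto simp: line_def Pi_iff PiE_iff image_iff)
    then obtain c where c: "\<forall>k\<in>{..<p}. t k = (\<lambda>v. c k * \<phi> v)" by metis
    have "t = (\<lambda>k\<in>{..<p}. \<lambda>v. c k * \<phi> v)"
      using c True by (intro ext) (auto simp: PiE_def extensional_def)
    then show ?thesis
      using multilinear_scale_all[OF s function_space_line mem_line] multilinear_scale_all[OF s' function_space_line mem_line] eq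
      by simp
  next
    case False
    then show ?thesis using multilinear_outside s s' by metis
  qed
qed

text \<open>Cutting off to \<open>0\<close> outside \<open>L\<close> makes the restriction a literal
  member of \<open>multilinear_forms p L\<close>, so that it can be compared with sections by
  equality.\<close>

definition restrict_form :: "nat \<Rightarrow> ('v \<Rightarrow> complex) set \<Rightarrow> 'v form \<Rightarrow> 'v form" where
  "restrict_form p L T = (\<lambda>t. if t \<in> {..<p} \<rightarrow>\<^sub>E L then T t else 0)"

lemma restrict_form_in:
  assumes T: "T \<in> multilinear_forms p W" and L: "function_space L" "L \<subseteq> W"
  shows "restrict_form p L T \<in> multilinear_forms p L"
  unfolding multilinear_forms_def
proof (intro CollectI conjI allI impI ballI)
  fix t i \<phi> \<psi> c assume *: "t \<in> {..<p} \<rightarrow>\<^sub>E L" "i < p" "\<phi> \<in> L" "\<psi> \<in> L"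
  have t: "t \<in> {..<p} \<rightarrow>\<^sub>E W" using *(1) L(2) PiE_mono[of "{..<p}" "\<lambda>_. L" "\<lambda>_. W"] by blast
  have upd: "t(i := \<alpha>) \<in> {..<p} \<rightarrow>\<^sub>E L" if "\<alpha> \<in> L" for \<alpha>
    using that * by (auto simp: PiE_def extensional_def Pi_iff)
  have in_L: "(\<lambda>v. \<phi> v + \<psi> v) \<in> L" "(\<lambda>v. c * \<phi> v) \<in> L" using L(1) * by (auto simp: function_space_def)
  show "restrict_form p L T (t(i := \<lambda>v. \<phi> v + \<psi> v)) = restrict_form p L T (t(i := \<phi>)) + restrict_form p L T (t(i := \<psi>))"
    using multilinear_add[OF T t *(2), of \<phi> \<psi>] * L(2) by (simp only: restrict_form_def upd in_L if_True) blast
  show "restrict_form p L T (t(i := \<lambda>v. c * \<phi> v)) = c * restrict_form p L T (t(i := \<phi>))"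
    using multilinear_scale[OF T t *(2), of \<phi> c] * L(2) by (simp only: restrict_form_def upd in_L if_True) blast
qed (simp add: restrict_form_def)

lemma restrict_form_diag: "\<phi> \<in> L \<Longrightarrow> restrict_form p L T (diag_tuple p \<phi>) = T (diag_tuple p \<phi>)"
  by (simp add: restrict_form_def diag_tuple_def)

context herm_fiber begin

lemma proj_fiberE:
  assumes "L \<in> proj_fiber E x"
  obtains \<phi> where "L = line \<phi>" "\<phi> \<in> D" "\<phi> \<noteq> (\<lambda>_. 0)"
  using assms unfolding proj_fiber_def by blast

lemma line_subset: "\<phi> \<in> D \<Longrightarrow> line \<phi> \<subseteq> D"
  using function_space_dual unfolding function_space_def line_def by blast

text \<open>Resolves the definite description: the restriction satisfies it, and one nonzero
  functional on the line, reached through \<open>riesz\<close>, already determines a form on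
  \<open>L\<close>.\<close>

lemma le_potier_eq:
  assumes S: "S x \<in> multilinear_forms p D" and L: "L \<in> proj_fiber E x"
  shows "le_potier E p S (x, L) = restrict_form p L (S x)"
proof -
  obtain \<phi> where \<phi>: "L = line \<phi>" "\<phi> \<in> D" "\<phi> \<noteq> (\<lambda>_. 0)" using proj_fiberE[OF L] .
  have in_mf: "restrict_form p L (S x) \<in> multilinear_forms p L"
    using S \<phi> line_subset by (intro restrict_form_in[where W = D]) (auto simp: function_space_line)
  obtain v where v: "v \<in> F" "metric_dual E x v = \<phi>" using riesz[OF \<phi>(2)] .
  then have v0: "v \<noteq> 0" using \<phi>(3) metric_dual_zero by auto
  have "(THE s. s \<in> multilinear_forms p L \<and> (\<forall>v\<in>F. v \<noteq> 0 \<and> metric_dual E x v \<in> L \<longrightarrow>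
          s (diag_tuple p (metric_dual E x v)) = S x (diag_tuple p (metric_dual E x v)))) = restrict_form p L (S x)"
  proof (rule the_equality)
    fix s assume s: "s \<in> multilinear_forms p L \<and> (\<forall>v\<in>F. v \<noteq> 0 \<and> metric_dual E x v \<in> L \<longrightarrow>
          s (diag_tuple p (metric_dual E x v)) = S x (diag_tuple p (metric_dual E x v)))"
    then have "s (diag_tuple p \<phi>) = S x (diag_tuple p \<phi>)"
      using v v0 mem_line[of \<phi>] \<phi>(1) by blast
    then show "s = restrict_form p L (S x)"
      using s in_mf \<phi>(1) by (intro multilinear_line_eqI[of _ p \<phi>]) (auto simp: restrict_form_diag mem_line)
  qed (use in_mf in \<open>auto simp: restrict_form_diag\<close>)
  then show ?thesis using L by (simp add: le_potier_def proj_dual_def)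
qed

lemma dual_norm2_scale: "dual_norm2 E x (\<lambda>v. c * \<phi> v) = (cmod c)\<^sup>2 * dual_norm2 E x \<phi>"
  by (simp add: dual_norm2_def norm_mult power_mult_distrib sum_distrib_left)

text \<open>Numerator and denominator both scale by \<open>cmod c ^ (2 * p)\<close>, so the
  representative chosen in \<open>O_norm2\<close> is immaterial.\<close>

lemma O_norm2_line:
  assumes \<phi>: "\<phi> \<in> D" "\<phi> \<noteq> (\<lambda>_. 0)" and s: "s \<in> multilinear_forms p (line \<phi>)"
  shows "O_norm2 E p (x, line \<phi>) s = (cmod (s (diag_tuple p \<phi>)))\<^sup>2 / dual_norm2 E x \<phi> ^ p"
proof -
  define \<psi> where "\<psi> = (SOME \<psi>. \<psi> \<in> line \<phi> \<and> \<psi> \<noteq> (\<lambda>_. 0))"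
  have "\<psi> \<in> line \<phi> \<and> \<psi> \<noteq> (\<lambda>_. 0)"
    unfolding \<psi>_def by (rule someI[of _ \<phi>]) (simp add: mem_line \<phi>)
  then obtain c where c: "\<psi> = (\<lambda>v. c * \<phi> v)" "\<psi> \<noteq> (\<lambda>_. 0)" unfolding line_def by blast
  then have c0: "c \<noteq> 0" by auto
  have "O_norm2 E p (x, line \<phi>) s = (cmod (s (diag_tuple p \<psi>)))\<^sup>2 / dual_norm2 E x \<psi> ^ p"
    by (simp add: O_norm2_def Let_def \<psi>_def)
  also have "\<dots> = (cmod (s (diag_tuple p \<phi>)))\<^sup>2 / dual_norm2 E x \<phi> ^ p"
    unfolding c(1) multilinear_diag_scale[OF s function_space_line mem_line] dual_norm2_scale
    using c0 by (simp add: norm_mult norm_power power_mult_distrib power_mult[symmetric] mult.commute)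
  finally show ?thesis .
qed

lemma taut_frame_eq:
  assumes "\<phi> (e x j) \<noteq> 0"
  shows "taut_frame e j (x, line \<phi>) = (\<lambda>v. \<phi> v / \<phi> (e x j))"
proof -
  have "(THE \<psi>. \<psi> \<in> line \<phi> \<and> \<psi> (e x j) = 1) = (\<lambda>v. inverse (\<phi> (e x j)) * \<phi> v)"
  proof (rule the_equality)
    show "(\<lambda>v. inverse (\<phi> (e x j)) * \<phi> v) \<in> line \<phi> \<and> inverse (\<phi> (e x j)) * \<phi> (e x j) = 1"
      using assms by (auto simp: line_def)
    fix \<psi> assume "\<psi> \<in> line \<phi> \<and> \<psi> (e x j) = 1"
    then obtain c where "\<psi> = (\<lambda>v. c * \<phi> v)" "c * \<phi> (e x j) = 1" by (auto simp: line_def)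
    then show "\<psi> = (\<lambda>v. inverse (\<phi> (e x j)) * \<phi> v)" using assms by (simp add: field_simps fun_eq_iff)
  qed
  then show ?thesis by (simp add: taut_frame_def field_simps)
qed

lemma sym_fiber_iff: "T \<in> sym_fiber E p x \<longleftrightarrow> symmetric_form p D T"
  by (simp add: sym_fiber_def symmetric_form_def)

end

section \<open>Homogeneous functions that are polynomial in each variable\<close>

text \<open>The weights \<open>a\<close> do not depend on \<open>P\<close>. Hence the coefficients
  of a family of polynomials inherit from its values every property stable under linear
  combinations.\<close>

lemma lagrange_coefficients:
  obtains a :: "nat \<Rightarrow> nat \<Rightarrow> complex"
  where "\<And>P k. degree P \<le> p \<Longrightarrow> coeff P k = (\<Sum>i\<le>p. a k i * poly P (of_nat i))"
proof -
  define l :: "nat \<Rightarrow> complex poly" where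
    "l i = Polynomial.smult (inverse (\<Prod>j\<in>{..p} - {i}. of_nat i - of_nat j)) (\<Prod>j\<in>{..p} - {i}. [:- of_nat j, 1:])" for i
  have deg: "degree (l i) \<le> p" if "i \<le> p" for i
  proof -
    have "degree (\<Prod>j\<in>{..p} - {i}. [:- of_nat j, 1 :: complex:]) \<le> (\<Sum>j\<in>{..p} - {i}. degree [:- of_nat j, 1 :: complex:])"
      using degree_prod_sum_le[of "{..p} - {i}" "\<lambda>j. [:- of_nat j, 1 :: complex:]"] by (simp add: o_def)
    also have "\<dots> = p" using that by simp
    finally show ?thesis using degree_smult_le order_trans unfolding l_def by blast
  qed
  have val: "poly (l i) (of_nat m) = (if i = m then 1 else 0)" if "i \<le> p" "m \<le> p" for i m
  proof (cases "i = m")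
    case True
    have "(\<Prod>j\<in>{..p} - {i}. of_nat i - of_nat j :: complex) \<noteq> 0" by simp
    then show ?thesis using True by (simp add: l_def poly_prod)
  next
    case False
    then show ?thesis using that by (auto simp: l_def poly_prod intro!: prod_zero)
  qed
  show thesis
  proof (rule that[of "\<lambda>k i. coeff (l i) k"])
    fix P :: "complex poly" and k assume P: "degree P \<le> p"
    define Q where "Q = (\<Sum>i\<le>p. Polynomial.smult (poly P (of_nat i)) (l i))"
    have "degree Q \<le> p"
      unfolding Q_def using deg by (intro degree_sum_le) (auto intro: order_trans[OF degree_smult_le])
    moreover have "card (of_nat ` {..p} :: complex set) = Suc p"
      by (subst card_image) (auto intro: inj_onI)
    moreover have "poly P y = poly Q y" if y: "y \<in> of_nat ` {..p}" for y
    proof -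
      obtain m where m: "y = of_nat m" "m \<le> p" using y by auto
      have "poly Q y = (\<Sum>i\<le>p. if i = m then poly P (of_nat i) else 0)"
        unfolding Q_def poly_sum m(1) using val m(2) by (intro sum.cong) auto
      then show ?thesis using m by simp
    qed
    ultimately have "P = Q"
      using P by (intro poly_eqI_degree[of "of_nat ` {..p}"]) auto
    then have "coeff P k = coeff Q k" by simp
    then show "coeff P k = (\<Sum>i\<le>p. coeff (l i) k * poly P (of_nat i))"
      unfolding Q_def by (simp add: coeff_sum mult.commute)
  qed
qed

text \<open>Homogeneous polynomials of degree \<open>d\<close> in \<open>r\<close> variables.
  Coefficients are indexed by tuples rather than by multi-indices; this is redundant, but it is the
  shape in which a \<open>d\<close>-linear form expands.\<close>

definition form_polynomial :: "nat \<Rightarrow> nat \<Rightarrow> (cn \<Rightarrow> complex) \<Rightarrow> bool" where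
  "form_polynomial r d F \<longleftrightarrow> (\<exists>a. \<forall>z. F z = (\<Sum>J\<in>{..<d} \<rightarrow>\<^sub>E {..<r}. a J * (\<Prod>k<d. z (J k))))"

lemma form_polynomial_zero: "form_polynomial r d (\<lambda>_. 0)"
  unfolding form_polynomial_def by (rule exI[of _ "\<lambda>_. 0"]) simp

lemma form_polynomial_add:
  assumes "form_polynomial r d F" "form_polynomial r d G"
  shows "form_polynomial r d (\<lambda>z. F z + G z)"
proof -
  obtain a b where "\<forall>z. F z = (\<Sum>J\<in>{..<d} \<rightarrow>\<^sub>E {..<r}. a J * (\<Prod>k<d. z (J k)))"
    "\<forall>z. G z = (\<Sum>J\<in>{..<d} \<rightarrow>\<^sub>E {..<r}. b J * (\<Prod>k<d. z (J k)))"
    using assms unfolding form_polynomial_def by blast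
  then show ?thesis unfolding form_polynomial_def
    by (intro exI[of _ "\<lambda>J. a J + b J"]) (simp add: distrib_right sum.distrib)
qed

lemma form_polynomial_sum:
  "(\<And>i. i \<in> I \<Longrightarrow> form_polynomial r d (F i)) \<Longrightarrow> form_polynomial r d (\<lambda>z. \<Sum>i\<in>I. F i z)"
  by (induction I rule: infinite_finite_induct) (auto intro: form_polynomial_zero form_polynomial_add)

lemma form_polynomial_mult:
  assumes i: "i < r" and "form_polynomial r d F"
  shows "form_polynomial r (Suc d) (\<lambda>z. z i * F z)"
proof -
  obtain a where a: "\<And>z. F z = (\<Sum>J\<in>{..<d} \<rightarrow>\<^sub>E {..<r}. a J * (\<Prod>k<d. z (J k)))"
    using assms unfolding form_polynomial_def by blast
  show ?thesis unfolding form_polynomial_def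
  \<comment> \<open>The new factor is recorded as the last entry of the tuple, so all coefficients
    sit on tuples ending in \<open>i\<close>.\<close>
  proof (intro exI[of _ "\<lambda>J. if J d = i then a (restrict J {..<d}) else 0"] allI)
    fix z :: cn
    have "(\<Sum>J\<in>{..<Suc d} \<rightarrow>\<^sub>E {..<r}. (if J d = i then a (restrict J {..<d}) else 0) * (\<Prod>k<Suc d. z (J k)))
      = (\<Sum>J\<in>{..<d} \<rightarrow>\<^sub>E {..<r}. \<Sum>j<r. if j = i then a J * (\<Prod>k<d. z (J k)) * z i else 0)"
      unfolding sum_PiE_Suc
    proof (intro sum.cong refl)
      fix J j assume J: "J \<in> {..<d} \<rightarrow>\<^sub>E {..<r}"
      then have "restrict (J(d := j)) {..<d} = J"
        by (intro ext) (auto simp: PiE_def extensional_def restrict_def)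
      then show "(if (J(d := j)) d = i then a (restrict (J(d := j)) {..<d}) else 0) * (\<Prod>k<Suc d. z ((J(d := j)) k)) =
         (if j = i then a J * (\<Prod>k<d. z (J k)) * z i else 0)" by simp
    qed
    also have "\<dots> = z i * F z" using i by (simp add: a sum_distrib_left mult.commute mult.left_commute)
    finally show "z i * F z = (\<Sum>J\<in>{..<Suc d} \<rightarrow>\<^sub>E {..<r}. (if J d = i then a (restrict J {..<d}) else 0) * (\<Prod>k<Suc d. z (J k)))" ..
  qed
qed

lemma form_polynomial_power_mult:
  assumes "i < r" "form_polynomial r d F"
  shows "form_polynomial r (k + d) (\<lambda>z. z i ^ k * F z)"
  by (induction k) (use assms form_polynomial_mult[OF assms(1)] in \<open>auto simp: mult.assoc\<close>)

lemma form_polynomial_Suc: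
  assumes "form_polynomial r d F"
  shows "form_polynomial (Suc r) d F"
proof -
  obtain a where a: "\<And>z. F z = (\<Sum>J\<in>{..<d} \<rightarrow>\<^sub>E {..<r}. a J * (\<Prod>k<d. z (J k)))"
    using assms unfolding form_polynomial_def by blast
  show ?thesis unfolding form_polynomial_def
  proof (intro exI[of _ "\<lambda>J. if J \<in> {..<d} \<rightarrow>\<^sub>E {..<r} then a J else 0"] allI)
    fix z :: cn
    have sub: "{..<d} \<rightarrow>\<^sub>E {..<r} \<subseteq> {..<d} \<rightarrow>\<^sub>E {..<Suc r}" by (intro PiE_mono) auto
    show "F z = (\<Sum>J\<in>{..<d} \<rightarrow>\<^sub>E {..<Suc r}. (if J \<in> {..<d} \<rightarrow>\<^sub>E {..<r} then a J else 0) * (\<Prod>k<d. z (J k)))"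
      unfolding a by (rule sum.mono_neutral_cong_left[OF finite_PiE_lessThan sub]) auto
  qed
qed

text \<open>
  The weight \<open>l - k\<close> is split into two exponents because it can be negative during the induction
  on the number of variables; in that case the function vanishes.
\<close>

lemma homogeneous_form_polynomial:
  assumes "\<And>z z'. (\<And>i. i < m \<Longrightarrow> z i = z' i) \<Longrightarrow> F z = F z'"
    and "\<And>z i. i < m \<Longrightarrow> \<exists>P. degree P \<le> p \<and> (\<forall>w. F (z(i := w)) = poly P w)"
    and "\<And>t z. t \<noteq> 0 \<Longrightarrow> t ^ k * F (\<lambda>i. t * z i) = t ^ l * F z"
  shows "(k \<le> l \<longrightarrow> form_polynomial m (l - k) F) \<and> (l < k \<longrightarrow> F = (\<lambda>_. 0))"
  using assms
proof (induction m arbitrary: F k l)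
  case 0
  define c where "c = F (\<lambda>_. 0)"
  have F: "F = (\<lambda>_. c)" using 0(1)[of _ "\<lambda>_. 0"] by (auto simp: c_def)
  show ?case
  proof (cases "k = l")
    case True
    have "form_polynomial 0 0 (\<lambda>_. c)"
      unfolding form_polynomial_def by (rule exI[of _ "\<lambda>_. c"]) simp
    then show ?thesis using True F by simp
  next
    case False
    \<comment> \<open>A nonzero constant has weight zero; scaling by \<open>2\<close> detects this
      because the powers of \<open>2\<close> are distinct.\<close>
    have "(2 ^ k :: complex) * c = 2 ^ l * c" using 0(3)[of 2 "\<lambda>_. 0"] F by simp
    moreover have "(2 ^ k :: complex) \<noteq> 2 ^ l"
      using False by (metis of_nat_eq_iff of_nat_numeral of_nat_power one_less_numeral_iff power_inject_exp semiring_norm(76))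
    ultimately have "F = (\<lambda>_. 0)" using F by simp
    then show ?thesis by (simp add: form_polynomial_zero)
  qed
next
  case (Suc m)
  obtain a :: "nat \<Rightarrow> nat \<Rightarrow> complex"
    where a: "\<And>P k. degree P \<le> p \<Longrightarrow> coeff P k = (\<Sum>i\<le>p. a k i * poly P (of_nat i))"
    using lagrange_coefficients[of p] by blast
  \<comment> \<open>\<open>G j\<close> is the coefficient of the \<open>j\<close>-th power of the
    last variable. Written through interpolation values, it remains polynomial in the other
    variables.\<close>
  define G where "G j z = (\<Sum>i\<le>p. a j i * F (z(m := of_nat i)))" for j z
  have "\<exists>P. degree P \<le> p \<and> (\<forall>w. F (z(m := w)) = poly P w)" for z using Suc.prems(2) by blast
  then obtain P where P: "\<And>z. degree (P z) \<le> p" "\<And>z w. F (z(m := w)) = poly (P z) w" by metis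
  have G: "G j z = coeff (P z) j" for j z unfolding G_def using a[OF P(1)] by (simp add: P(2))
  have F: "F z = (\<Sum>j\<le>p. z m ^ j * G j z)" for z
  proof -
    have "F z = F (z(m := z m))" by simp
    also have "\<dots> = (\<Sum>j\<le>degree (P z). coeff (P z) j * z m ^ j)" by (simp only: P(2) poly_altdef)
    also have "\<dots> = (\<Sum>j\<le>p. coeff (P z) j * z m ^ j)"
      using P(1) by (intro sum.mono_neutral_left) (auto simp: coeff_eq_0)
    finally show ?thesis by (simp add: G mult.commute)
  qed
  have IH: "(k + j \<le> l \<longrightarrow> form_polynomial m (l - (k + j)) (G j)) \<and> (l < k + j \<longrightarrow> G j = (\<lambda>_. 0))" for j
  proof (rule Suc.IH)
    fix z z' :: cn assume z: "\<And>i. i < m \<Longrightarrow> z i = z' i"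
    have "F (z(m := w)) = F (z'(m := w))" for w
      by (rule Suc.prems(1)) (auto simp: z less_Suc_eq)
    then show "G j z = G j z'" by (simp add: G_def)
  next
    fix z :: cn and i assume i: "i < m"
    have "\<exists>Q. degree Q \<le> p \<and> (\<forall>w. F ((z(m := of_nat i'))(i := w)) = poly Q w)" for i'
      by (rule Suc.prems(2)) (use i in simp)
    then obtain Q where Q: "\<And>i'. degree (Q i') \<le> p" "\<And>i' w. F ((z(m := of_nat i'))(i := w)) = poly (Q i') w"
      by metis
    have "degree (\<Sum>i'\<le>p. Polynomial.smult (a j i') (Q i')) \<le> p"
      using Q(1) by (intro degree_sum_le) (auto intro: order_trans[OF degree_smult_le])
    moreover have "G j (z(i := w)) = poly (\<Sum>i'\<le>p. Polynomial.smult (a j i') (Q i')) w" for w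
      unfolding G_def poly_sum using i by (simp add: Q(2)[symmetric] fun_upd_twist)
    ultimately show "\<exists>Q. degree Q \<le> p \<and> (\<forall>w. G j (z(i := w)) = poly Q w)" by blast
  next
    fix t :: complex and z :: cn assume t: "t \<noteq> 0"
    have "t ^ k * poly (P (\<lambda>i. t * z i)) (t * w) = t ^ l * poly (P z) w" for w
    proof -
      have "(\<lambda>i. t * z i)(m := t * w) = (\<lambda>i. t * (z(m := w)) i)" by auto
      then show ?thesis using Suc.prems(3)[OF t, of "z(m := w)"] by (simp only: P(2)[symmetric])
    qed
    \<comment> \<open>The scaling law holds for all \<open>w\<close>, so it is an identity of
      polynomials in \<open>w\<close>. Its \<open>j\<close>-th coefficient is the scaling law of
      \<open>G j\<close>, with \<open>k\<close> raised by \<open>j\<close>.\<close>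
    then have "poly (Polynomial.smult (t ^ k) (pcompose (P (\<lambda>i. t * z i)) [:0, t:])) = poly (Polynomial.smult (t ^ l) (P z))"
      by (simp add: fun_eq_iff poly_pcompose mult.commute)
    then have "Polynomial.smult (t ^ k) (pcompose (P (\<lambda>i. t * z i)) [:0, t:]) = Polynomial.smult (t ^ l) (P z)"
      using poly_eq_poly_eq_iff by blast
    from arg_cong[OF this, of "\<lambda>q. coeff q j"]
    show "t ^ (k + j) * G j (\<lambda>i. t * z i) = t ^ l * G j z"
      by (simp add: G coeff_pcompose_linear power_add mult.assoc)
  qed
  show ?case
  proof (intro conjI impI)
    assume kl: "k \<le> l"
    have "form_polynomial (Suc m) (l - k) (\<lambda>z. z m ^ j * G j z)" for j
    proof (cases "k + j \<le> l")
      case True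
      then have "form_polynomial (Suc m) (j + (l - (k + j))) (\<lambda>z. z m ^ j * G j z)"
        using IH[of j] by (intro form_polynomial_power_mult form_polynomial_Suc) auto
      then show ?thesis using True by (simp add: diff_diff_eq)
    next
      case False
      then show ?thesis using IH[of j] by (simp add: form_polynomial_zero)
    qed
    then have "form_polynomial (Suc m) (l - k) (\<lambda>z. \<Sum>j\<le>p. z m ^ j * G j z)"
      by (rule form_polynomial_sum)
    moreover have "(\<lambda>z. \<Sum>j\<le>p. z m ^ j * G j z) = F" using F by (simp add: fun_eq_iff)
    ultimately show "form_polynomial (Suc m) (l - k) F" by simp
  next
    assume "l < k"
    then have "G j = (\<lambda>_. 0)" for j using IH[of j] by simp
    then show "F = (\<lambda>_. 0)" using F by (simp add: fun_eq_iff)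
  qed
qed

text \<open>\<open>h\<close> and \<open>g\<close> are one section of \<open>O(p)\<close> on the
  projective line in its two affine coordinates. Boundedness of \<open>g\<close> near
  \<open>0\<close> is the growth of \<open>h\<close> at infinity.\<close>

lemma entire_polynomial:
  assumes h: "h holomorphic_on UNIV" and g: "g holomorphic_on UNIV"
    and hg: "\<And>w. w \<noteq> 0 \<Longrightarrow> h w = w ^ p * g (1 / w)"
  shows "\<exists>P. degree P \<le> p \<and> (\<forall>w. h w = poly P w)"
proof -
  have "bounded (g ` cball 0 1)"
    using g by (intro compact_imp_bounded compact_continuous_image compact_cball)
      (auto intro: continuous_on_subset holomorphic_on_imp_continuous_on)
  then obtain B where "\<forall>w\<in>cball 0 1. norm (g w) \<le> B" by (auto simp: bounded_iff)
  then have B: "norm (g w) \<le> B" if "norm w \<le> 1" for w using that by simp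
  have growth: "norm (h w) \<le> B * norm w ^ p" if "1 \<le> norm w" for w
  proof -
    have "w \<noteq> 0" "norm (1 / w) \<le> 1" using that by (auto simp: norm_divide divide_simps)
    then show ?thesis using hg[of w] B[of "1 / w"]
      by (simp add: norm_mult norm_power mult.commute mult_right_mono)
  qed
  define c where "c k = (deriv ^^ k) h 0 / fact k" for k
  have "h w = poly (\<Sum>k\<le>p. monom (c k) k) w" for w
    using Liouville_polynomial[OF h growth, where \<xi> = w] by (simp add: poly_sum poly_monom c_def)
  moreover have "degree (\<Sum>k\<le>p. monom (c k) k) \<le> p"
    by (intro degree_sum_le) (auto intro: order_trans[OF degree_monom_le])
  ultimately show ?thesis by blast
qed

section \<open>Fubini-Study integrals\<close>

text \<open>The integral of an arbitrary \<open>f\<close> is a supremum over simple functions, and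
  dividing a simple function below \<open>C * f\<close> by \<open>C\<close> gives one below
  \<open>f\<close>. In this form fiber integrals can be inserted directly as functions on
  \<open>M\<close>.\<close>

lemma nn_integral_cmult_le:
  assumes "0 \<le> C"
  shows "(\<integral>\<^sup>+x. ennreal C * f x \<partial>M) \<le> ennreal C * (\<integral>\<^sup>+x. f x \<partial>M)"
proof (cases "C = 0")
  case False
  then have C: "0 < C" using assms by simp
  show ?thesis
    unfolding nn_integral_def[of M "\<lambda>x. ennreal C * f x"]
  proof (rule SUP_least)
    fix s assume "s \<in> {g. simple_function M g \<and> g \<le> (\<lambda>x. ennreal C * f x)}"
    then have s: "simple_function M s" "\<And>x. s x \<le> ennreal C * f x" by (auto simp: le_fun_def)
    have inv: "ennreal C * (ennreal (1 / C) * y) = y" for y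
      using C by (simp add: mult.assoc[symmetric] ennreal_mult'[symmetric])
    have inv': "ennreal (1 / C) * (ennreal C * y) = y" for y
      using C by (simp add: mult.assoc[symmetric] ennreal_mult'[symmetric])
    have meas: "s \<in> borel_measurable M" using s(1) by (rule borel_measurable_simple_function)
    have "integral\<^sup>S M s = (\<integral>\<^sup>+x. ennreal C * (ennreal (1 / C) * s x) \<partial>M)"
      using nn_integral_eq_simple_integral[OF s(1)] by (simp add: inv)
    also have "\<dots> = ennreal C * (\<integral>\<^sup>+x. ennreal (1 / C) * s x \<partial>M)"
      using meas by (intro nn_integral_cmult) auto
    also have "\<dots> \<le> ennreal C * (\<integral>\<^sup>+x. f x \<partial>M)"
    proof (intro mult_left_mono nn_integral_mono)
      fix x
      have "ennreal (1 / C) * s x \<le> ennreal (1 / C) * (ennreal C * f x)"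
        by (intro mult_left_mono s(2)) simp
      then show "ennreal (1 / C) * s x \<le> f x" by (simp add: inv')
    qed simp
    finally show "integral\<^sup>S M s \<le> ennreal C * (\<integral>\<^sup>+x. f x \<partial>M)" .
  qed
qed simp

lemma nn_integral_dominated_finite:
  assumes "0 \<le> C" "\<And>x. g x \<le> ennreal C * f x" "(\<integral>\<^sup>+x. f x \<partial>M) < \<infinity>"
  shows "(\<integral>\<^sup>+x. g x \<partial>M) < \<infinity>"
proof -
  have "(\<integral>\<^sup>+x. g x \<partial>M) \<le> (\<integral>\<^sup>+x. ennreal C * f x \<partial>M)" by (intro nn_integral_mono assms)
  also have "\<dots> \<le> ennreal C * (\<integral>\<^sup>+x. f x \<partial>M)" by (rule nn_integral_cmult_le[OF assms(1)])
  also have "\<dots> < \<infinity>" using assms(3) by (simp add: ennreal_mult_less_top)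
  finally show ?thesis .
qed

interpretation lb: product_sigma_finite "\<lambda>_::nat. lborel :: complex measure"
  by standard

lemma space_cmeasure: "space (cmeasure d) = {..<d} \<rightarrow>\<^sub>E UNIV"
  by (simp add: cmeasure_def space_PiM)

lemma measurable_cmeasure_component: "i < d \<Longrightarrow> (\<lambda>u. u i) \<in> borel_measurable (cmeasure d)"
  using measurable_component_singleton[of i "{..<d}" "\<lambda>_. lborel"] by (simp add: cmeasure_def)

lemma emeasure_lborel_affine:
  fixes A :: "complex set"
  assumes c: "0 < c" and A: "A \<in> sets borel"
  shows "emeasure lborel {u. (u + v) / of_real c \<in> A} = ennreal (c\<^sup>2) * emeasure lborel A"
proof -
  have [measurable]: "(\<lambda>u. v / of_real c + (1 / c) *\<^sub>R u) \<in> borel_measurable borel" by measurable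
  have set: "(\<lambda>u. v / of_real c + (1 / c) *\<^sub>R u) -` A = {u. (u + v) / of_real c \<in> A}"
    using c by (auto simp: scaleR_conv_of_real field_simps)
  have "emeasure lborel A = emeasure (density (distr lborel borel (\<lambda>u. v / of_real c + (1 / c) *\<^sub>R u)) (\<lambda>_. \<bar>1 / c\<bar> ^ DIM(complex))) A"
    using lborel_affine[of "1 / c" "v / of_real c"] c by simp
  also have "\<dots> = ennreal ((1 / c)\<^sup>2) * emeasure lborel {u. (u + v) / of_real c \<in> A}"
    using A c by (simp add: emeasure_density_const emeasure_distr set)
  finally have eq: "emeasure lborel A = ennreal ((1 / c)\<^sup>2) * emeasure lborel {u. (u + v) / of_real c \<in> A}" .
  show ?thesis
    unfolding eq using c by (simp add: mult.assoc[symmetric] ennreal_mult'[symmetric] power_divide)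
qed

text \<open>The change of variables for translation followed by a positive dilation. Each complex
  coordinate contributes \<open>c^2\<close>, its real dimension being two.\<close>

lemma nn_integral_cmeasure_affine:
  assumes c: "0 < c" and f: "f \<in> borel_measurable (cmeasure d)"
  shows "(\<lambda>u. f (\<lambda>i\<in>{..<d}. (u i + v i) / of_real c)) \<in> borel_measurable (cmeasure d)"
    and "(\<integral>\<^sup>+u. f (\<lambda>i\<in>{..<d}. (u i + v i) / of_real c) \<partial>cmeasure d) =
      ennreal (c ^ (2 * d)) * (\<integral>\<^sup>+u. f u \<partial>cmeasure d)"
proof -
  let ?P = "cmeasure d"
  let ?T = "\<lambda>u. \<lambda>i\<in>{..<d}. (u i + v i) / of_real c"
  have T: "?T \<in> measurable ?P ?P"
    unfolding cmeasure_def
  proof (rule measurable_restrict)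
    fix i assume "i \<in> {..<d}"
    then have [measurable]: "(\<lambda>u. u i) \<in> borel_measurable (Pi\<^sub>M {..<d} (\<lambda>_. lborel))"
      using measurable_cmeasure_component[of i d] by (simp add: cmeasure_def)
    show "(\<lambda>u. (u i + v i) / of_real c) \<in> measurable (Pi\<^sub>M {..<d} (\<lambda>_. lborel)) lborel"
      by simp
  qed
  show "(\<lambda>u. f (?T u)) \<in> borel_measurable ?P" using measurable_compose[OF T f] .
  \<comment> \<open>A product measure is determined by its values on boxes, which reduces the claim
    to the one-dimensional substitution in each coordinate.\<close>
  have "density (distr ?P ?P ?T) (\<lambda>_. ennreal ((1 / c) ^ (2 * d))) = Pi\<^sub>M {..<d} (\<lambda>_. lborel)"
  proof (rule lb.PiM_eqI)
    fix A :: "nat \<Rightarrow> complex set" assume A: "\<And>i. i \<in> {..<d} \<Longrightarrow> A i \<in> sets lborel"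
    have A': "Pi\<^sub>E {..<d} A \<in> sets ?P" unfolding cmeasure_def using A by (intro sets_PiM_I_finite) auto
    have set: "?T -` Pi\<^sub>E {..<d} A \<inter> space ?P = (\<Pi>\<^sub>E i\<in>{..<d}. {u. (u + v i) / of_real c \<in> A i})"
      by (auto simp: space_cmeasure PiE_def Pi_iff)
    have B: "{u. (u + v i) / of_real c \<in> A i} \<in> sets lborel" if "i \<in> {..<d}" for i
    proof -
      have "(\<lambda>u. (u + v i) / of_real c) \<in> borel_measurable borel" by measurable
      from measurable_sets[OF this, of "A i"] show ?thesis using A[OF that] by (simp add: vimage_def)
    qed
    have "emeasure (density (distr ?P ?P ?T) (\<lambda>_. ennreal ((1 / c) ^ (2 * d)))) (Pi\<^sub>E {..<d} A)
      = ennreal ((1 / c) ^ (2 * d)) * emeasure ?P (\<Pi>\<^sub>E i\<in>{..<d}. {u. (u + v i) / of_real c \<in> A i})"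
      using A' by (simp add: emeasure_density_const emeasure_distr T set)
    also have "emeasure ?P (\<Pi>\<^sub>E i\<in>{..<d}. {u. (u + v i) / of_real c \<in> A i})
      = (\<Prod>i<d. emeasure lborel {u. (u + v i) / of_real c \<in> A i})"
      unfolding cmeasure_def using B by (intro lb.emeasure_PiM) auto
    also have "\<dots> = (\<Prod>i<d. ennreal (c\<^sup>2) * emeasure lborel (A i))"
      using A by (intro prod.cong refl emeasure_lborel_affine c) auto
    also have "\<dots> = ennreal (c ^ (2 * d)) * (\<Prod>i<d. emeasure lborel (A i))"
      by (simp add: prod.distrib ennreal_power power_mult)
    also have "ennreal ((1 / c) ^ (2 * d)) * (ennreal (c ^ (2 * d)) * (\<Prod>i<d. emeasure lborel (A i)))
      = (\<Prod>i<d. emeasure lborel (A i))"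
      using c by (simp add: mult.assoc[symmetric] ennreal_mult'[symmetric] power_divide)
    finally show "emeasure (density (distr ?P ?P ?T) (\<lambda>_. ennreal ((1 / c) ^ (2 * d)))) (Pi\<^sub>E {..<d} A)
      = (\<Prod>i\<in>{..<d}. emeasure lborel (A i))" .
  qed (simp_all add: cmeasure_def)
  then have "(\<integral>\<^sup>+u. f u \<partial>?P) = (\<integral>\<^sup>+u. f u \<partial>density (distr ?P ?P ?T) (\<lambda>_. ennreal ((1 / c) ^ (2 * d))))"
    by (simp add: cmeasure_def)
  also have "\<dots> = ennreal ((1 / c) ^ (2 * d)) * (\<integral>\<^sup>+u. f u \<partial>distr ?P ?P ?T)"
    using f by (simp add: nn_integral_density nn_integral_cmult)
  also have "(\<integral>\<^sup>+u. f u \<partial>distr ?P ?P ?T) = (\<integral>\<^sup>+u. f (?T u) \<partial>?P)"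
    using f by (intro nn_integral_distr[OF T]) simp
  finally have "(\<integral>\<^sup>+u. f u \<partial>?P) = ennreal ((1 / c) ^ (2 * d)) * (\<integral>\<^sup>+u. f (?T u) \<partial>?P)" .
  then show "(\<integral>\<^sup>+u. f (?T u) \<partial>?P) = ennreal (c ^ (2 * d)) * (\<integral>\<^sup>+u. f u \<partial>?P)"
    using c by (simp add: mult.assoc[symmetric] ennreal_mult'[symmetric] power_divide)
qed

lemma emeasure_polydisc:
  assumes "0 \<le> R"
  shows "(\<Pi>\<^sub>E i\<in>{..<d}. ball 0 R) \<in> sets (cmeasure d)"
    and "emeasure (cmeasure d) (\<Pi>\<^sub>E i\<in>{..<d}. ball 0 R) = ennreal ((unit_ball_vol 2 * R\<^sup>2) ^ d)"
proof -
  show "(\<Pi>\<^sub>E i\<in>{..<d}. ball 0 R) \<in> sets (cmeasure d)"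
    unfolding cmeasure_def by (intro sets_PiM_I_finite) auto
  have "emeasure (cmeasure d) (\<Pi>\<^sub>E i\<in>{..<d}. ball 0 R) = (\<Prod>i<d. emeasure lborel (ball (0::complex) R))"
    unfolding cmeasure_def by (intro lb.emeasure_PiM) auto
  also have "\<dots> = ennreal ((unit_ball_vol 2 * R\<^sup>2) ^ d)"
    using assms by (simp add: emeasure_ball ennreal_power)
  finally show "emeasure (cmeasure d) (\<Pi>\<^sub>E i\<in>{..<d}. ball 0 R) = ennreal ((unit_ball_vol 2 * R\<^sup>2) ^ d)" .
qed

text \<open>The density of \<open>fs_measure\<close> for \<open>d = r - 1\<close>, so its exponent
  \<open>r\<close> becomes \<open>Suc d\<close>.\<close>

definition fs_density :: "nat \<Rightarrow> cn \<Rightarrow> real" where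
  "fs_density d u = 1 / (pi ^ d * (1 + (\<Sum>k<d. (cmod (u k))\<^sup>2)) ^ Suc d)"

lemma fs_density_nonneg: "0 \<le> fs_density d u"
  by (simp add: fs_density_def sum_nonneg)

lemma measurable_fs_density: "fs_density d \<in> borel_measurable (cmeasure d)"
proof -
  have "(\<lambda>u. cmod (u k)) \<in> borel_measurable (cmeasure d)" if "k \<in> {..<d}" for k
    using that measurable_compose[OF measurable_cmeasure_component borel_measurable_norm] by simp
  then show ?thesis unfolding fs_density_def[abs_def] by (intro borel_measurable_divide borel_measurable_times
      borel_measurable_power borel_measurable_add borel_measurable_sum) auto
qed

text \<open>Dyadic polydiscs: on the \<open>k\<close>-th shell the density is of order \<open>4\<^bsup>-k(d+1)\<^esup>\<close>, the volume of order \<open>4\<^bsup>kd\<^esup>\<close>.\<close>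

lemma fs_density_finite: "(\<integral>\<^sup>+u. ennreal (fs_density d u) \<partial>cmeasure d) < \<infinity>"
proof -
  define B :: "nat \<Rightarrow> cn set" where "B k = (\<Pi>\<^sub>E i\<in>{..<d}. ball 0 (2 ^ k))" for k
  \<comment> \<open>The factor \<open>4 ^ Suc d\<close> pays for \<open>4 ^ k \<le> 4 * ?N\<close>,
    valid for the least \<open>k\<close> with \<open>u\<close> in \<open>B k\<close>: some
    coordinate then has modulus at least half of \<open>2 ^ k\<close>, unless \<open>k\<close> is
    \<open>0\<close>.\<close>
  define a :: "nat \<Rightarrow> real" where "a k = 4 ^ Suc d / (4 ^ k) ^ Suc d" for k
  have a0: "0 \<le> a k" for k by (simp add: a_def)
  have B: "B k \<in> sets (cmeasure d)" "emeasure (cmeasure d) (B k) = ennreal ((unit_ball_vol 2 * 4 ^ k) ^ d)" for k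
    using emeasure_polydisc[of "2 ^ k" d] by (simp_all add: B_def power_mult[symmetric] mult.commute[of k 2] power_mult)
  have pi1: "1 \<le> pi ^ d" using pi_gt3 by (intro one_le_power) simp
  have bound: "ennreal (fs_density d u) \<le> (\<Sum>k. ennreal (a k) * indicator (B k) u)" if u: "u \<in> space (cmeasure d)" for u
  proof -
    let ?N = "1 + (\<Sum>k<d. (cmod (u k))\<^sup>2)"
    have N1: "1 \<le> ?N" by (simp add: sum_nonneg)
    obtain k where "(\<Sum>i<d. cmod (u i)) < 2 ^ k" using real_arch_pow[of 2] by auto
    moreover have "cmod (u i) \<le> (\<Sum>i<d. cmod (u i))" if "i < d" for i
      using that by (intro member_le_sum) auto
    ultimately have "\<exists>k. u \<in> B k"
      using u by (intro exI[of _ k]) (force simp: B_def space_cmeasure PiE_iff)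
    define k where "k = (LEAST k. u \<in> B k)"
    have k: "u \<in> B k" "\<And>l. l < k \<Longrightarrow> u \<notin> B l"
      using LeastI_ex[OF \<open>\<exists>k. u \<in> B k\<close>] not_less_Least by (auto simp: k_def)
    have "4 ^ k \<le> 4 * ?N"
    proof (cases k)
      case 0
      then show ?thesis using N1 by simp
    next
      case (Suc l)
      then have "u \<notin> B l" using k(2) by simp
      then obtain i where i: "i < d" "2 ^ l \<le> cmod (u i)"
        using u by (auto simp: B_def space_cmeasure PiE_iff not_less)
      have "(4::real) ^ l = (2 ^ l)\<^sup>2" by (simp add: power_mult[symmetric] mult.commute[of l 2] power_mult)
      also have "\<dots> \<le> (cmod (u i))\<^sup>2" using i(2) by (intro power_mono) auto
      also have "\<dots> \<le> (\<Sum>k<d. (cmod (u k))\<^sup>2)" using i(1) by (intro member_le_sum) auto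
      finally show ?thesis using Suc by simp
    qed
    then have "(4 ^ k) ^ Suc d \<le> (4 * ?N) ^ Suc d" by (intro power_mono) auto
    then have "(4 ^ k) ^ Suc d \<le> 4 ^ Suc d * ?N ^ Suc d" by (simp only: power_mult_distrib)
    then have "1 / ?N ^ Suc d \<le> a k"
      unfolding a_def using N1 by (subst frac_le_eq) (auto simp: divide_simps simp del: power_Suc)
    moreover have "fs_density d u \<le> 1 / ?N ^ Suc d"
      unfolding fs_density_def using pi1 N1
      by (intro divide_left_mono mult_pos_pos) (auto simp del: power_Suc)
    ultimately have "fs_density d u \<le> a k" by simp
    then have "ennreal (fs_density d u) \<le> ennreal (a k) * indicator (B k) u"
      using k(1) by (simp add: ennreal_leI)
    also have "\<dots> \<le> (\<Sum>l. ennreal (a l) * indicator (B l) u)"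
    proof -
      define f where "f l = ennreal (a l) * indicator (B l) u" for l
      have "sum f {k} \<le> suminf f" by (rule sum_le_suminf) auto
      then have "f k \<le> suminf f" by simp
      then show ?thesis unfolding f_def .
    qed
    finally show ?thesis .
  qed
  have "(\<integral>\<^sup>+u. ennreal (fs_density d u) \<partial>cmeasure d) \<le> (\<integral>\<^sup>+u. (\<Sum>k. ennreal (a k) * indicator (B k) u) \<partial>cmeasure d)"
    by (rule nn_integral_mono) (rule bound)
  also have "\<dots> = (\<Sum>k. \<integral>\<^sup>+u. ennreal (a k) * indicator (B k) u \<partial>cmeasure d)"
    using B(1) by (intro nn_integral_suminf) auto
  also have "\<dots> = (\<Sum>k. ennreal (a k * (unit_ball_vol 2 * 4 ^ k) ^ d))"
    using B a0 by (simp add: nn_integral_cmult_indicator ennreal_mult')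
  also have "(\<lambda>k. a k * (unit_ball_vol 2 * 4 ^ k) ^ d) = (\<lambda>k. (4 ^ Suc d * unit_ball_vol 2 ^ d) * (1 / 4) ^ k)"
    by (rule ext) (simp add: a_def power_mult_distrib power_divide field_simps)
  also have "(\<Sum>k. ennreal ((4 ^ Suc d * unit_ball_vol 2 ^ d) * (1 / 4) ^ k)) < \<infinity>"
    unfolding infinity_ennreal_def less_top[symmetric]
    by (intro ennreal_suminf_neq_top summable_mult summable_geometric) (auto intro: mult_nonneg_nonneg)
  finally show ?thesis .
qed

lemma bij_betw_skip: "j < r \<Longrightarrow> bij_betw (skip j) {..<r - 1} ({..<r} - {j})"
  by (rule bij_betw_byWitness[where f' = "\<lambda>i. if i < j then i else i - 1"]) (auto simp: skip_def)

lemma sum_skip: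
  assumes "j < r"
  shows "(\<Sum>i<r. g i) = g j + (\<Sum>k<r - 1. g (skip j k))"
  using assms sum.remove[of "{..<r}" j g] sum.reindex_bij_betw[OF bij_betw_skip[OF assms], of g]
  by (simp only: finite_lessThan lessThan_iff)

text \<open>Homogeneous coordinates of an affine point; the index shift undoes
  \<open>skip j\<close>.\<close>

definition affine_coords :: "nat \<Rightarrow> cn \<Rightarrow> cn" where
  "affine_coords j u i = (if i = j then 1 else u (if i < j then i else i - 1))"

lemma affine_coords_skip: "affine_coords j u (skip j k) = u k"
  and affine_coords_self: "affine_coords j u j = 1"
  by (auto simp: affine_coords_def skip_def)

lemma sum_cmod_affine_coords:
  "j < r \<Longrightarrow> (\<Sum>i<r. (cmod (affine_coords j u i))\<^sup>2) = 1 + (\<Sum>k<r - 1. (cmod (u k))\<^sup>2)"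
  by (simp add: sum_skip affine_coords_skip affine_coords_self)

lemma measurable_affine_coords:
  "i < r \<Longrightarrow> j < r \<Longrightarrow> (\<lambda>u. affine_coords j u i) \<in> borel_measurable (cmeasure (r - 1))"
  unfolding affine_coords_def
  by (cases "i = j"; cases "i < j") (auto intro!: measurable_cmeasure_component)

context herm_fiber begin

lemma affine_point_eq: "j < r \<Longrightarrow> affine_point E x j u = line (lin (onb E x) (affine_coords j u))"
  by (simp add: affine_point_def lin_def sum_skip affine_coords_skip affine_coords_self)

lemma lin_affine_nonzero: "j < r \<Longrightarrow> lin (onb E x) (affine_coords j u) \<noteq> (\<lambda>_. 0)"
  using lin_eq_0_iff[OF onb_basis, of "affine_coords j u"] affine_coords_self[of j u] by force

lemma affine_point_in: "j < r \<Longrightarrow> affine_point E x j u \<in> proj_fiber E x"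
  unfolding affine_point_eq proj_fiber_def using lin_in[OF onb_basis] lin_affine_nonzero by blast

lemma dual_norm2_lin: "dual_norm2 E x (lin (onb E x) c) = (\<Sum>i<r. (cmod (c i))\<^sup>2)"
  by (simp add: dual_norm2_def lin_basis[OF onb_basis])

text \<open>The integral uses the parametrization with index \<open>0\<close> only, but the
  sigma-algebra on the fiber is tested in all of them, hence the assumption for every
  \<open>j\<close>.\<close>

lemma nn_integral_fs_measure:
  assumes r: "1 \<le> r"
    and h: "\<And>j. j < r \<Longrightarrow> (\<lambda>u. h (affine_point E x j u)) \<in> borel_measurable (cmeasure (r - 1))"
  shows "(\<integral>\<^sup>+L. h L \<partial>fs_measure E x) =
    (\<integral>\<^sup>+u. ennreal (fs_density (r - 1) u) * h (affine_point E x 0 u) \<partial>cmeasure (r - 1))"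
proof -
  let ?P = "cmeasure (r - 1)"
  let ?A = "{B. B \<subseteq> proj_fiber E x \<and> (\<forall>j<r. {u \<in> space ?P. affine_point E x j u \<in> B} \<in> sets ?P)}"
  have sub: "?A \<subseteq> Pow (proj_fiber E x)" by blast
  have dens: "1 / (pi ^ (r - 1) * (1 + (\<Sum>k<r - 1. (Re (u k))\<^sup>2 + (Im (u k))\<^sup>2)) ^ r) = fs_density (r - 1) u" for u
    using r by (simp add: fs_density_def cmod_power2)
  have m0: "affine_point E x 0 \<in> measurable (density ?P (\<lambda>u. ennreal (fs_density (r - 1) u))) (proj_fiber_borel E x)"
    unfolding proj_fiber_borel_def
  proof (rule measurable_measure_of[OF sub])
    show "affine_point E x 0 \<in> space (density ?P (\<lambda>u. ennreal (fs_density (r - 1) u))) \<rightarrow> proj_fiber E x"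
      using r affine_point_in[of 0] by simp
    show "affine_point E x 0 -` B \<inter> space (density ?P (\<lambda>u. ennreal (fs_density (r - 1) u))) \<in>
        sets (density ?P (\<lambda>u. ennreal (fs_density (r - 1) u)))" if "B \<in> ?A" for B
    proof -
      have "{u \<in> space ?P. affine_point E x 0 u \<in> B} \<in> sets ?P" using that r by auto
      moreover have "affine_point E x 0 -` B \<inter> space ?P = {u \<in> space ?P. affine_point E x 0 u \<in> B}" by auto
      ultimately show ?thesis by simp
    qed
  qed
  have h_meas: "h \<in> borel_measurable (proj_fiber_borel E x)"
  proof (rule measurableI)
    fix S :: "ennreal set" assume S: "S \<in> sets borel"
    \<comment> \<open>The preimage is one of the sets generating \<open>proj_fiber_borel\<close>, so
      no closure operation of the sigma-algebra is involved.\<close>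
    have "h -` S \<inter> proj_fiber E x \<in> ?A"
    proof (intro CollectI conjI allI impI)
      fix j assume j: "j < r"
      have "{u \<in> space ?P. affine_point E x j u \<in> h -` S \<inter> proj_fiber E x} = (\<lambda>u. h (affine_point E x j u)) -` S \<inter> space ?P"
        using affine_point_in[OF j] by auto
      then show "{u \<in> space ?P. affine_point E x j u \<in> h -` S \<inter> proj_fiber E x} \<in> sets ?P"
        using measurable_sets[OF h[OF j] S] by simp
    qed simp
    then show "h -` S \<inter> space (proj_fiber_borel E x) \<in> sets (proj_fiber_borel E x)"
      unfolding proj_fiber_borel_def space_measure_of[OF sub] using in_measure_of[OF sub] by blast
  qed simp
  have "(\<integral>\<^sup>+L. h L \<partial>fs_measure E x) =
      (\<integral>\<^sup>+u. h (affine_point E x 0 u) \<partial>density ?P (\<lambda>u. ennreal (fs_density (r - 1) u)))"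
    unfolding fs_measure_def dens by (rule nn_integral_distr[OF m0]) (simp add: h_meas)
  also have "\<dots> = (\<integral>\<^sup>+u. ennreal (fs_density (r - 1) u) * h (affine_point E x 0 u) \<partial>?P)"
    using measurable_fs_density h[of 0] r by (intro nn_integral_density) auto
  finally show ?thesis .
qed

end

section \<open>Comparison of the norms on a fiber\<close>

definition fs_mass :: "nat \<Rightarrow> real" where
  "fs_mass d = enn2real (\<integral>\<^sup>+u. ennreal (fs_density d u) \<partial>cmeasure d)"

lemma ennreal_fs_mass: "ennreal (fs_mass d) = (\<integral>\<^sup>+u. ennreal (fs_density d u) \<partial>cmeasure d)"
  unfolding fs_mass_def using fs_density_finite[of d] by simp

text \<open>The first factor bounds the square of what is lost when a polarization point is rescaled
  to affine form. The second bounds the reciprocal of the integration weight at an affine point with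
  coordinates of modulus at most \<open>1 + p\<close>; the exponent is \<open>Suc d\<close> from the
  density plus \<open>p\<close> from the metric of \<open>O(p)\<close>.\<close>

definition lower_const :: "nat \<Rightarrow> nat \<Rightarrow> real" where
  "lower_const p d = (1 + real p) ^ (2 * p) * (pi ^ d * (1 + real d * (1 + real p)\<^sup>2) ^ (Suc d + p))"

lemma lower_const_nonneg: "0 \<le> lower_const p d"
  by (simp add: lower_const_def)

context herm_fiber begin

lemma diag_lin:
  assumes "T \<in> multilinear_forms p D" "basis_of E x b"
  shows "T (diag_tuple p (lin b c)) =
    (\<Sum>I\<in>{..<p} \<rightarrow>\<^sub>E {..<r}. (\<Prod>k<p. c (I k)) * T (\<lambda>k\<in>{..<p}. dual_basis E b (I k)))"
  unfolding lin_def
  by (rule multilinear_expand_diag[OF assms(1) function_space_dual]) (rule dual_basis_in[OF assms(2)])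

text \<open>Cauchy-Schwarz over index tuples; the squared coordinate products sum to the
  \<open>p\<close>-th power of the squared norm. After division by that power, the norm of the
  restricted form at every line is at most that of \<open>T\<close>.\<close>

lemma diag_bound:
  assumes T: "T \<in> multilinear_forms p D"
  shows "(cmod (T (diag_tuple p (lin (onb E x) c))))\<^sup>2 \<le> tensor_norm2 E p x T * (\<Sum>i<r. (cmod (c i))\<^sup>2) ^ p"
proof -
  let ?S = "{..<p} \<rightarrow>\<^sub>E {..<r}"
  let ?T = "\<lambda>I. cmod (T (\<lambda>k\<in>{..<p}. dual_basis E (onb E x) (I k)))"
  let ?c = "\<lambda>I. \<Prod>k<p. cmod (c (I k))"
  have "cmod (T (diag_tuple p (lin (onb E x) c))) \<le> (\<Sum>I\<in>?S. ?T I * ?c I)"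
    unfolding diag_lin[OF T onb_basis]
    by (rule order_trans[OF norm_sum]) (simp add: norm_mult prod_norm mult.commute)
  then have "(cmod (T (diag_tuple p (lin (onb E x) c))))\<^sup>2 \<le> (\<Sum>I\<in>?S. ?T I * ?c I)\<^sup>2"
    by (intro power_mono) auto
  also have "\<dots> \<le> (\<Sum>I\<in>?S. (?T I)\<^sup>2) * (\<Sum>I\<in>?S. (?c I)\<^sup>2)"
    by (rule Cauchy_Schwarz_ineq_sum)
  also have "(\<Sum>I\<in>?S. (?c I)\<^sup>2) = (\<Sum>I\<in>?S. \<Prod>k<p. (cmod (c (I k)))\<^sup>2)"
    by (simp add: prod_power_distrib)
  also have "\<dots> = (\<Prod>k<p. \<Sum>i<r. (cmod (c i))\<^sup>2)"
    by (rule prod_sum_PiE[symmetric]) auto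
  also have "\<dots> = (\<Sum>i<r. (cmod (c i))\<^sup>2) ^ p" by simp
  finally show ?thesis unfolding tensor_norm2_def .
qed

lemma O_norm2_affine:
  assumes T: "T \<in> multilinear_forms p D" and j: "j < r"
  shows "O_norm2 E p (x, affine_point E x j u) (restrict_form p (affine_point E x j u) T) =
    (cmod (T (diag_tuple p (lin (onb E x) (affine_coords j u)))))\<^sup>2 / (1 + (\<Sum>k<r - 1. (cmod (u k))\<^sup>2)) ^ p"
proof -
  let ?\<phi> = "lin (onb E x) (affine_coords j u)"
  have \<phi>: "?\<phi> \<in> D" "?\<phi> \<noteq> (\<lambda>_. 0)" using lin_in[OF onb_basis] lin_affine_nonzero[OF j] by auto
  have "restrict_form p (line ?\<phi>) T \<in> multilinear_forms p (line ?\<phi>)"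
    by (rule restrict_form_in[OF T function_space_line line_subset[OF \<phi>(1)]])
  from O_norm2_line[OF \<phi> this] show ?thesis
    unfolding affine_point_eq[OF j]
    by (simp add: restrict_form_diag mem_line dual_norm2_lin sum_cmod_affine_coords[OF j])
qed

lemma measurable_diag_affine:
  assumes T: "T \<in> multilinear_forms p D" and j: "j < r"
  shows "(\<lambda>u. T (diag_tuple p (lin (onb E x) (affine_coords j u)))) \<in> borel_measurable (cmeasure (r - 1))"
  unfolding diag_lin[OF T onb_basis]
proof (intro borel_measurable_sum borel_measurable_times borel_measurable_prod borel_measurable_const)
  fix I k assume "I \<in> {..<p} \<rightarrow>\<^sub>E {..<r}" "k \<in> {..<p}"
  then show "(\<lambda>u. affine_coords j u (I k)) \<in> borel_measurable (cmeasure (r - 1))"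
    using PiE_mem by (intro measurable_affine_coords j) fastforce
qed

lemma measurable_O_norm2_affine:
  assumes T: "T \<in> multilinear_forms p D" and j: "j < r"
  shows "(\<lambda>u. O_norm2 E p (x, affine_point E x j u) (restrict_form p (affine_point E x j u) T))
    \<in> borel_measurable (cmeasure (r - 1))"
proof -
  have coord: "(\<lambda>u. cmod (u k)) \<in> borel_measurable (cmeasure (r - 1))" if "k \<in> {..<r - 1}" for k
    using that measurable_compose[OF measurable_cmeasure_component borel_measurable_norm] by simp
  have val: "(\<lambda>u. cmod (T (diag_tuple p (lin (onb E x) (affine_coords j u))))) \<in> borel_measurable (cmeasure (r - 1))"
    using measurable_compose[OF measurable_diag_affine[OF T j] borel_measurable_norm] .
  show ?thesis unfolding O_norm2_affine[OF T j]
    by (intro borel_measurable_divide borel_measurable_power borel_measurable_add borel_measurable_sum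
        borel_measurable_const coord val)
qed

lemma nn_integral_O_norm2:
  assumes T: "T \<in> multilinear_forms p D" and r: "1 \<le> r"
  shows "(\<integral>\<^sup>+L. ennreal (O_norm2 E p (x, L) (restrict_form p L T)) \<partial>fs_measure E x) =
    (\<integral>\<^sup>+u. ennreal (fs_density (r - 1) u *
      ((cmod (T (diag_tuple p (lin (onb E x) (affine_coords 0 u)))))\<^sup>2 / (1 + (\<Sum>k<r - 1. (cmod (u k))\<^sup>2)) ^ p))
      \<partial>cmeasure (r - 1))"
proof -
  have "(\<integral>\<^sup>+L. ennreal (O_norm2 E p (x, L) (restrict_form p L T)) \<partial>fs_measure E x) =
    (\<integral>\<^sup>+u. ennreal (fs_density (r - 1) u) * ennreal (O_norm2 E p (x, affine_point E x 0 u)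
      (restrict_form p (affine_point E x 0 u) T)) \<partial>cmeasure (r - 1))"
    using measurable_O_norm2_affine[OF T] by (intro nn_integral_fs_measure[OF r]) simp
  moreover have "0 < r" using r by simp
  ultimately show ?thesis
    by (simp only: O_norm2_affine[OF T \<open>0 < r\<close>] ennreal_mult'[OF fs_density_nonneg])
qed

lemma nn_integral_O_norm2_le:
  assumes T: "T \<in> multilinear_forms p D" and r: "1 \<le> r"
  shows "(\<integral>\<^sup>+L. ennreal (O_norm2 E p (x, L) (restrict_form p L T)) \<partial>fs_measure E x)
    \<le> ennreal (fs_mass (r - 1)) * ennreal (tensor_norm2 E p x T)"
proof -
  let ?d = "r - 1"
  have "fs_density ?d u *
      ((cmod (T (diag_tuple p (lin (onb E x) (affine_coords 0 u)))))\<^sup>2 / (1 + (\<Sum>k<?d. (cmod (u k))\<^sup>2)) ^ p)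
      \<le> fs_density ?d u * tensor_norm2 E p x T" for u
  proof (intro mult_left_mono fs_density_nonneg)
    have "0 < 1 + (\<Sum>k<?d. (cmod (u k))\<^sup>2)" by (smt (verit) sum_nonneg zero_le_power2)
    then show "(cmod (T (diag_tuple p (lin (onb E x) (affine_coords 0 u)))))\<^sup>2 / (1 + (\<Sum>k<?d. (cmod (u k))\<^sup>2)) ^ p
      \<le> tensor_norm2 E p x T"
      using diag_bound[OF T, of "affine_coords 0 u"] r
      by (simp add: divide_le_eq sum_cmod_affine_coords)
  qed
  then have "(\<integral>\<^sup>+L. ennreal (O_norm2 E p (x, L) (restrict_form p L T)) \<partial>fs_measure E x)
    \<le> (\<integral>\<^sup>+u. ennreal (fs_density ?d u * tensor_norm2 E p x T) \<partial>cmeasure ?d)"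
    unfolding nn_integral_O_norm2[OF T r] by (intro nn_integral_mono ennreal_leI)
  also have "\<dots> = (\<integral>\<^sup>+u. ennreal (fs_density ?d u) * ennreal (tensor_norm2 E p x T) \<partial>cmeasure ?d)"
    by (simp add: ennreal_mult' fs_density_nonneg)
  also have "\<dots> = ennreal (fs_mass ?d) * ennreal (tensor_norm2 E p x T)"
    unfolding ennreal_fs_mass using measurable_fs_density by (intro nn_integral_multc) auto
  finally show ?thesis .
qed

text \<open>Coordinate \<open>0\<close> of the polarization point is \<open>1 + m\<close>, which
  cannot vanish; dividing by it yields the affine point \<open>u\<close>. Its coordinates are
  bounded in terms of \<open>p\<close>, so the integration weight there is bounded below.\<close>

lemma shifted_diag_bound:
  assumes T: "T \<in> multilinear_forms p D" and r: "1 \<le> r" and I: "I \<in> {..<p} \<rightarrow>\<^sub>E {..<r}"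
    and A: "A \<subseteq> {..<p}" and s: "\<And>k. k < r - 1 \<Longrightarrow> cmod (s k) \<le> 1"
  defines "m \<equiv> card {i \<in> A. I i = 0}" and "n \<equiv> \<lambda>k. of_nat (card {i \<in> A. I i = Suc k})"
  defines "u \<equiv> \<lambda>k\<in>{..<r - 1}. (s k + n k) / of_real (1 + real m)"
  shows "(cmod (T (diag_tuple p (\<lambda>v. lin (onb E x) (affine_coords 0 s) v +
      (\<Sum>i\<in>A. dual_basis E (onb E x) (I i) v)))))\<^sup>2
    \<le> lower_const p (r - 1) * (fs_density (r - 1) u *
      ((cmod (T (diag_tuple p (lin (onb E x) (affine_coords 0 u)))))\<^sup>2 / (1 + (\<Sum>k<r - 1. (cmod (u k))\<^sup>2)) ^ p))"
proof -
  let ?b = "onb E x" and ?d = "r - 1"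
  have finA: "finite A" using A finite_subset by blast
  have cardA: "card {i \<in> A. Q i} \<le> p" for Q
  proof -
    have "card {i \<in> A. Q i} \<le> card {..<p}" using A by (intro card_mono) auto
    then show ?thesis by simp
  qed
  have m: "m \<le> p" unfolding m_def by (rule cardA)
  have m1: "1 + real m \<noteq> 0" by linarith
  \<comment> \<open>Grouping equal indices gives the coordinates of the sum as multiplicities, with
    \<open>m\<close> at index \<open>0\<close> and \<open>n k\<close> at index
    \<open>Suc k\<close>.\<close>
  have "(\<Sum>i\<in>A. dual_basis E ?b (I i) v) = (\<Sum>l<r. of_nat (card {i \<in> A. I i = l}) * dual_basis E ?b l v)" for v
  proof -
    have "(\<Sum>i\<in>A. dual_basis E ?b (I i) v) = (\<Sum>l<r. \<Sum>i\<in>{i \<in> A. I i = l}. dual_basis E ?b (I i) v)"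
      using I A finA by (intro sum.group[symmetric]) (auto simp: PiE_iff)
    also have "\<dots> = (\<Sum>l<r. of_nat (card {i \<in> A. I i = l}) * dual_basis E ?b l v)"
      by (intro sum.cong refl) simp
    finally show ?thesis .
  qed
  then have "(\<lambda>v. lin ?b (affine_coords 0 s) v + (\<Sum>i\<in>A. dual_basis E ?b (I i) v))
    = lin ?b (\<lambda>l. affine_coords 0 s l + of_nat (card {i \<in> A. I i = l}))"
    by (simp add: lin_def distrib_right sum.distrib)
  also have "\<dots> = lin ?b (\<lambda>l. of_real (1 + real m) * affine_coords 0 u l)"
  proof (rule lin_cong)
    fix l assume l: "l < r"
    show "affine_coords 0 s l + of_nat (card {i \<in> A. I i = l}) = of_real (1 + real m) * affine_coords 0 u l"
    proof (cases l)
      case 0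
      then show ?thesis by (simp add: affine_coords_def m_def)
    next
      case (Suc k)
      then have "k < ?d" using l by simp
      moreover have "complex_of_real (1 + real m) \<noteq> 0" using m1 of_real_eq_0_iff by blast
      ultimately show ?thesis using Suc by (simp add: affine_coords_def u_def n_def del: of_real_add)
    qed
  qed
  also have "\<dots> = (\<lambda>v. of_real (1 + real m) * lin ?b (affine_coords 0 u) v)" by (rule lin_scale)
  finally have eq: "T (diag_tuple p (\<lambda>v. lin ?b (affine_coords 0 s) v + (\<Sum>i\<in>A. dual_basis E ?b (I i) v)))
    = of_real (1 + real m) ^ p * T (diag_tuple p (lin ?b (affine_coords 0 u)))"
    using multilinear_diag_scale[OF T function_space_dual lin_in[OF onb_basis], of "of_real (1 + real m)"] by simp
  let ?G = "cmod (T (diag_tuple p (lin ?b (affine_coords 0 u))))"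
  let ?N = "1 + (\<Sum>k<?d. (cmod (u k))\<^sup>2)"
  let ?W = "fs_density ?d u * (?G\<^sup>2 / ?N ^ p)"
  have N: "1 \<le> ?N" by (simp add: sum_nonneg)
  \<comment> \<open>The numerator is at most \<open>1\<close> plus a multiplicity of at most
    \<open>p\<close>; the denominator is at least \<open>1\<close>.\<close>
  have "cmod (u k) \<le> 1 + real p" if k: "k < ?d" for k
  proof -
    have "cmod (s k + n k) \<le> 1 + real p"
      using s[OF k] cardA[of "\<lambda>i. I i = Suc k"] norm_triangle_ineq[of "s k" "n k"] by (simp add: n_def)
    then have "cmod (s k + n k) / (1 + real m) \<le> (1 + real p) / 1" by (intro frac_le) auto
    then show ?thesis using k by (simp add: u_def norm_divide del: of_real_add)
  qed
  then have "(\<Sum>k<?d. (cmod (u k))\<^sup>2) \<le> (\<Sum>k<?d. (1 + real p)\<^sup>2)" by (intro sum_mono power_mono) auto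
  then have NR: "?N \<le> 1 + real ?d * (1 + real p)\<^sup>2" by simp
  have W0: "0 \<le> ?W" using N by (intro mult_nonneg_nonneg fs_density_nonneg divide_nonneg_nonneg) auto
  have "?G\<^sup>2 = ?W * (pi ^ ?d * ?N ^ (Suc ?d + p))"
  proof -
    have "?N ^ p \<noteq> 0" "?N ^ Suc ?d \<noteq> 0" "pi ^ ?d \<noteq> 0" using N by auto
    then show ?thesis unfolding fs_density_def power_add by (simp add: divide_simps del: power_Suc)
  qed
  also have "\<dots> \<le> ?W * (pi ^ ?d * (1 + real ?d * (1 + real p)\<^sup>2) ^ (Suc ?d + p))"
    using NR N W0 by (intro mult_left_mono power_mono) auto
  finally have G: "?G\<^sup>2 \<le> ?W * (pi ^ ?d * (1 + real ?d * (1 + real p)\<^sup>2) ^ (Suc ?d + p))" .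
  have "(cmod (T (diag_tuple p (\<lambda>v. lin ?b (affine_coords 0 s) v + (\<Sum>i\<in>A. dual_basis E ?b (I i) v)))))\<^sup>2
    = (1 + real m) ^ (2 * p) * ?G\<^sup>2"
    unfolding eq by (simp add: norm_mult norm_power power_mult_distrib power_mult[symmetric] mult.commute del: of_real_add)
  also have "\<dots> \<le> (1 + real p) ^ (2 * p) * (?W * (pi ^ ?d * (1 + real ?d * (1 + real p)\<^sup>2) ^ (Suc ?d + p)))"
    using m by (intro mult_mono power_mono G) auto
  also have "\<dots> = lower_const p ?d * ?W" by (simp add: lower_const_def)
  finally show ?thesis .
qed

text \<open>
  Polarization with the base points \<open>(1, s)\<close>, averaged over \<open>s\<close> in the unit polydisc: pointwise
  values of the polynomial are bounded by its weighted square integral.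
\<close>

lemma tensor_component_le_integral:
  assumes T: "symmetric_form p D T" and r: "1 \<le> r" and I: "I \<in> {..<p} \<rightarrow>\<^sub>E {..<r}"
  shows "ennreal (unit_ball_vol 2 ^ (r - 1)) * ennreal ((cmod (T (\<lambda>k\<in>{..<p}. dual_basis E (onb E x) (I k))))\<^sup>2)
    \<le> ennreal (4 ^ p * lower_const p (r - 1) * (1 + real p) ^ (2 * (r - 1))) *
      (\<integral>\<^sup>+L. ennreal (O_norm2 E p (x, L) (restrict_form p L T)) \<partial>fs_measure E x)"
proof -
  let ?b = "onb E x" and ?d = "r - 1"
  let ?P = "Pow {..<p}"
  have T': "T \<in> multilinear_forms p D" using T by (simp add: symmetric_form_def)
  define t where "t = (\<lambda>k\<in>{..<p}. dual_basis E ?b (I k))"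
  define W where "W u = fs_density ?d u * ((cmod (T (diag_tuple p (lin ?b (affine_coords 0 u)))))\<^sup>2 /
    (1 + (\<Sum>k<?d. (cmod (u k))\<^sup>2)) ^ p)" for u
  define m where "m A = card {i \<in> A. I i = 0}" for A
  define n :: "nat set \<Rightarrow> nat \<Rightarrow> complex" where "n A k = of_nat (card {i \<in> A. I i = Suc k})" for A k
  \<comment> \<open>Affine coordinates of the polarization point belonging to \<open>A\<close>. They
    depend on \<open>s\<close> by a translation and a dilation, which is the substitution available
    for the integral.\<close>
  define \<tau> where "\<tau> A s = (\<lambda>k\<in>{..<?d}. (s k + n A k) / of_real (1 + real (m A)))" for A s
  \<comment> \<open>The \<open>2 ^ p\<close> counts the subsets \<open>A\<close> when the square of
    the polarization sum is bounded by the sum of squares. Summing the integrals over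
    \<open>A\<close> later gives another \<open>2 ^ p\<close>, hence the final
    \<open>4 ^ p\<close>.\<close>
  define C where "C = 2 ^ p * lower_const p ?d"
  have C: "0 \<le> C" by (simp add: C_def lower_const_nonneg)
  have W0: "0 \<le> W u" for u unfolding W_def
    by (intro mult_nonneg_nonneg fs_density_nonneg divide_nonneg_nonneg zero_le_power add_nonneg_nonneg sum_nonneg) auto
  have W_meas: "(\<lambda>u. ennreal (W u)) \<in> borel_measurable (cmeasure ?d)"
  proof -
    have "0 < r" using r by simp
    show ?thesis unfolding W_def
      by (intro measurable_compose[OF _ measurable_ennreal] borel_measurable_times measurable_fs_density
          measurable_O_norm2_affine[OF T' \<open>0 < r\<close>, unfolded O_norm2_affine[OF T' \<open>0 < r\<close>]])
  qed
  have m: "m A \<le> p" if "A \<in> ?P" for A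
  proof -
    have "m A \<le> card {..<p}" unfolding m_def using that by (intro card_mono) auto
    then show ?thesis by simp
  qed
  have t: "t \<in> {..<p} \<rightarrow>\<^sub>E D" unfolding t_def using dual_basis_in[OF onb_basis] by auto
  have pointwise: "(cmod (T t))\<^sup>2 \<le> C * (\<Sum>A\<in>?P. W (\<tau> A s))" if s: "s \<in> (\<Pi>\<^sub>E i\<in>{..<?d}. ball 0 1)" for s
  proof -
    have s1: "cmod (s k) \<le> 1" if "k < ?d" for k
    proof -
      have "s k \<in> ball 0 1" using s that by (auto simp: PiE_iff)
      then show ?thesis by simp
    qed
    let ?z = "lin ?b (affine_coords 0 s)"
    let ?X = "\<lambda>A. cmod (T (diag_tuple p (\<lambda>v. ?z v + (\<Sum>i\<in>A. t i v))))"
    have X: "(?X A)\<^sup>2 \<le> lower_const p ?d * W (\<tau> A s)" if A: "A \<in> ?P" for A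
    proof -
      have "(\<lambda>v. ?z v + (\<Sum>i\<in>A. t i v)) = (\<lambda>v. ?z v + (\<Sum>i\<in>A. dual_basis E ?b (I i) v))"
        using A by (intro ext arg_cong2[of _ _ _ _ plus] sum.cong refl) (auto simp: t_def)
      then show ?thesis
        using shifted_diag_bound[OF T' r I, of A s] A s1 by (simp add: W_def \<tau>_def n_def m_def)
    qed
    have "fact p * cmod (T t) = cmod (\<Sum>A\<in>?P. (-1) ^ card ({..<p} - A) * T (diag_tuple p (\<lambda>v. ?z v + (\<Sum>i\<in>A. t i v))))"
      unfolding polarization[OF T function_space_dual t lin_in[OF onb_basis]] by (simp add: norm_mult)
    also have "\<dots> \<le> (\<Sum>A\<in>?P. ?X A)"
      by (rule order_trans[OF norm_sum]) (simp add: norm_mult norm_power)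
    finally have "fact p * cmod (T t) \<le> (\<Sum>A\<in>?P. ?X A)" .
    moreover have "cmod (T t) \<le> fact p * cmod (T t)"
      using mult_right_mono[OF fact_ge_1[of p, where 'a = real], of "cmod (T t)"] by simp
    ultimately have "cmod (T t) \<le> (\<Sum>A\<in>?P. ?X A)" by linarith
    then have "(cmod (T t))\<^sup>2 \<le> (\<Sum>A\<in>?P. ?X A)\<^sup>2" by (intro power_mono) auto
    also have "\<dots> \<le> (\<Sum>A\<in>?P. (?X A)\<^sup>2) * card ?P" by (rule sum_squared_le_sum_of_squares)
    also have "\<dots> \<le> (\<Sum>A\<in>?P. lower_const p ?d * W (\<tau> A s)) * card ?P"
      by (intro mult_right_mono sum_mono X) auto
    also have "\<dots> = C * (\<Sum>A\<in>?P. W (\<tau> A s))"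
      by (simp add: C_def card_Pow sum_distrib_left mult.commute mult.left_commute)
    finally show ?thesis .
  qed
  have aff: "(\<lambda>s. ennreal (W (\<tau> A s))) \<in> borel_measurable (cmeasure ?d)"
    "(\<integral>\<^sup>+s. ennreal (W (\<tau> A s)) \<partial>cmeasure ?d) = ennreal ((1 + real (m A)) ^ (2 * ?d)) * (\<integral>\<^sup>+u. ennreal (W u) \<partial>cmeasure ?d)" for A
    unfolding \<tau>_def using nn_integral_cmeasure_affine[OF _ W_meas, of "1 + real (m A)" "n A"] by simp_all
  let ?B = "\<Pi>\<^sub>E i\<in>{..<?d}. ball (0::complex) 1"
  have B: "?B \<in> sets (cmeasure ?d)" "emeasure (cmeasure ?d) ?B = ennreal (unit_ball_vol 2 ^ ?d)"
    using emeasure_polydisc[of 1 ?d] by simp_all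
  have "ennreal (unit_ball_vol 2 ^ ?d) * ennreal ((cmod (T t))\<^sup>2)
      = (\<integral>\<^sup>+s. ennreal ((cmod (T t))\<^sup>2) * indicator ?B s \<partial>cmeasure ?d)"
    using B by (simp add: nn_integral_cmult_indicator mult.commute)
  \<comment> \<open>The pointwise bound holds on the polydisc; enlarging the right side to the whole
    space makes each term the full weighted integral after substitution.\<close>
  also have "\<dots> \<le> (\<integral>\<^sup>+s. ennreal C * (\<Sum>A\<in>?P. ennreal (W (\<tau> A s))) \<partial>cmeasure ?d)"
  proof (rule nn_integral_mono)
    fix s
    show "ennreal ((cmod (T t))\<^sup>2) * indicator ?B s \<le> ennreal C * (\<Sum>A\<in>?P. ennreal (W (\<tau> A s)))"
    proof (cases "s \<in> ?B")
      case True
      then have "ennreal ((cmod (T t))\<^sup>2) \<le> ennreal (C * (\<Sum>A\<in>?P. W (\<tau> A s)))"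
        by (intro ennreal_leI pointwise)
      then show ?thesis using True C W0 by (simp add: ennreal_mult' sum_ennreal)
    qed simp
  qed
  also have "\<dots> = ennreal C * (\<Sum>A\<in>?P. \<integral>\<^sup>+s. ennreal (W (\<tau> A s)) \<partial>cmeasure ?d)"
    using aff(1) by (simp add: nn_integral_cmult nn_integral_sum)
  \<comment> \<open>The Jacobian of the substitution for \<open>A\<close> is bounded uniformly,
    using \<open>m A \<le> p\<close>.\<close>
  also have "\<dots> \<le> ennreal C * (\<Sum>A\<in>?P. ennreal ((1 + real p) ^ (2 * ?d)) * (\<integral>\<^sup>+u. ennreal (W u) \<partial>cmeasure ?d))"
    unfolding aff(2) using m by (intro mult_left_mono sum_mono mult_right_mono ennreal_leI power_mono) auto
  also have "\<dots> = ennreal (C * (2 ^ p * (1 + real p) ^ (2 * ?d))) * (\<integral>\<^sup>+u. ennreal (W u) \<partial>cmeasure ?d)"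
    using C by (simp add: card_Pow ennreal_mult' ennreal_power[symmetric] mult.assoc)
  also have "C * (2 ^ p * (1 + real p) ^ (2 * ?d)) = 4 ^ p * lower_const p ?d * (1 + real p) ^ (2 * ?d)"
    by (simp add: C_def power_mult_distrib[symmetric])
  finally show ?thesis
    unfolding nn_integral_O_norm2[OF T' r] W_def t_def .
qed

end

text \<open>One component costs the constant of the averaged polarization divided by the volume of
  the polydisc; \<open>Suc d ^ p\<close> is the number of components.\<close>

definition norm_const :: "nat \<Rightarrow> nat \<Rightarrow> real" where
  "norm_const p d = real (Suc d ^ p) * (4 ^ p * lower_const p d * (1 + real p) ^ (2 * d) / unit_ball_vol 2 ^ d)"

lemma norm_const_nonneg: "0 \<le> norm_const p d"
  by (auto simp: norm_const_def intro!: mult_nonneg_nonneg divide_nonneg_nonneg lower_const_nonneg)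

lemma (in herm_fiber) tensor_norm2_le:
  assumes T: "symmetric_form p D T" and r: "1 \<le> r"
  shows "ennreal (tensor_norm2 E p x T) \<le> ennreal (norm_const p (r - 1)) *
      (\<integral>\<^sup>+L. ennreal (O_norm2 E p (x, L) (restrict_form p L T)) \<partial>fs_measure E x)"
proof -
  let ?d = "r - 1" and ?S = "{..<p} \<rightarrow>\<^sub>E {..<r}"
  let ?V = "unit_ball_vol 2 ^ ?d :: real"
  let ?K = "4 ^ p * lower_const p ?d * (1 + real p) ^ (2 * ?d)"
  let ?Q = "\<integral>\<^sup>+L. ennreal (O_norm2 E p (x, L) (restrict_form p L T)) \<partial>fs_measure E x"
  have V: "0 < ?V" by simp
  have K: "0 \<le> ?K" using lower_const_nonneg by auto
  have "ennreal ((cmod (T (\<lambda>k\<in>{..<p}. dual_basis E (onb E x) (I k))))\<^sup>2) \<le> ennreal (?K / ?V) * ?Q" if I: "I \<in> ?S" for I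
  proof -
    let ?y = "ennreal ((cmod (T (\<lambda>k\<in>{..<p}. dual_basis E (onb E x) (I k))))\<^sup>2)"
    have "?y = ennreal (1 / ?V) * (ennreal ?V * ?y)"
      by (simp add: mult.assoc[symmetric] ennreal_mult'[symmetric] unit_ball_vol_2)
    also have "\<dots> \<le> ennreal (1 / ?V) * (ennreal ?K * ?Q)"
      by (intro mult_left_mono tensor_component_le_integral[OF T r I]) simp
    also have "\<dots> = ennreal (?K / ?V) * ?Q"
      using V K by (simp add: mult.assoc[symmetric] ennreal_mult'[symmetric])
    finally show ?thesis .
  qed
  then have "(\<Sum>I\<in>?S. ennreal ((cmod (T (\<lambda>k\<in>{..<p}. dual_basis E (onb E x) (I k))))\<^sup>2)) \<le> (\<Sum>I\<in>?S. ennreal (?K / ?V) * ?Q)"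
    by (rule sum_mono)
  also have "\<dots> = of_nat (card ?S) * (ennreal (?K / ?V) * ?Q)" by simp
  also have "card ?S = Suc ?d ^ p" using r by (simp add: card_PiE)
  also have "of_nat (Suc ?d ^ p) * (ennreal (?K / ?V) * ?Q) = ennreal (norm_const p ?d) * ?Q"
    unfolding norm_const_def ennreal_of_nat_eq_real_of_nat ennreal_mult'[OF of_nat_0_le_iff] mult.assoc ..
  finally show ?thesis unfolding tensor_norm2_def by (simp only: sum_ennreal zero_le_power2)
qed

section \<open>The Le Potier isomorphism\<close>

text \<open>Rescaling a functional in \<open>L\<close> that is nonzero at \<open>e x j\<close>
  resolves the definite description in \<open>taut_frame\<close>.\<close>

lemma (in herm_fiber) taut_domain_normalized:
  assumes "(x, L) \<in> taut_domain E (V, e) j"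
  obtains \<tau> where "L = line \<tau>" "\<tau> \<in> D" "\<tau> (e x j) = 1" "taut_frame e j (x, L) = \<tau>"
proof -
  obtain \<phi> where \<phi>: "L \<in> proj_fiber E x" "\<phi> \<in> L" "\<phi> (e x j) \<noteq> 0"
    using assms by (auto simp: taut_domain_def proj_dual_def)
  obtain \<psi> where \<psi>: "L = line \<psi>" "\<psi> \<in> D" using proj_fiberE[OF \<phi>(1)] by metis
  have 0: "\<phi> \<noteq> (\<lambda>_. 0)" using \<phi>(3) by auto
  have L: "L = line \<phi>" using line_eqI[of \<phi> \<psi>] \<phi>(2) \<psi>(1) 0 by simp
  have \<phi>D: "\<phi> \<in> D" using line_subset[OF \<psi>(2)] \<phi>(2) \<psi>(1) by blast
  let ?\<tau> = "\<lambda>v. inverse (\<phi> (e x j)) * \<phi> v"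
  show thesis
  proof (rule that[of ?\<tau>])
    show "L = line ?\<tau>" using L line_scale[of "inverse (\<phi> (e x j))" \<phi>] \<phi>(3) by simp
    show "?\<tau> \<in> D" using function_space_dual \<phi>D by (simp add: function_space_def)
    show "?\<tau> (e x j) = 1" using \<phi>(3) by simp
    show "taut_frame e j (x, L) = ?\<tau>"
      unfolding L using taut_frame_eq[of \<phi> e j] \<phi>(3) by (simp add: field_simps)
  qed
qed

lemma multilinear_forms_add:
  "S \<in> multilinear_forms p W \<Longrightarrow> T \<in> multilinear_forms p W \<Longrightarrow> (\<lambda>t. S t + T t) \<in> multilinear_forms p W"
  unfolding multilinear_forms_def by (auto simp: distrib_left)

lemma multilinear_forms_scale:
  "T \<in> multilinear_forms p W \<Longrightarrow> (\<lambda>t. c * T t) \<in> multilinear_forms p W"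
  unfolding multilinear_forms_def by (auto simp: distrib_left)

locale herm_bundle_over =
  fixes M :: "'m::{t2_space, second_countable_topology} herm_manifold"
    and E :: "('m, 'v::ab_group_add) herm_bundle"
  assumes manifold_ax: "hermitian_manifold M" and bundle_ax: "hermitian_bundle M E"
begin

lemma holomorphic_bundle: "holomorphic_bundle M E"
  using bundle_ax by (simp add: hermitian_bundle_def)

lemma frame_exists: obtains V e where "(V, e) \<in> frames E" "x \<in> V"
proof -
  have "x \<in> (\<Union>(V, e)\<in>frames E. V)" using holomorphic_bundle unfolding holomorphic_bundle_def by simp
  then show thesis using that by auto
qed

lemma frame_basis: "(V, e) \<in> frames E \<Longrightarrow> x \<in> V \<Longrightarrow> basis_of E x (e x)"
  using holomorphic_bundle unfolding holomorphic_bundle_def by blast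

lemma rank_pos: "1 \<le> brank E"
  using holomorphic_bundle unfolding holomorphic_bundle_def by blast

lemma frame_transition:
  assumes "(V, e) \<in> frames E" "(V', e') \<in> frames E" "i < brank E" "j < brank E" "(U, \<phi>) \<in> atlas M"
  shows "holo_on (mdim M) (\<phi> ` (U \<inter> (V \<inter> V'))) (\<lambda>z. dual_basis E (e (inv_into U \<phi> z)) i (e' (inv_into U \<phi> z) j))"
  using holomorphic_bundle assms unfolding holomorphic_bundle_def holo_fun_def by fast

sublocale fib: herm_fiber E x for x
proof (rule herm_fiber.intro)
  show "vector_space (smul E)" using holomorphic_bundle by (simp add: holomorphic_bundle_def)
  obtain V e where "(V, e) \<in> frames E" "x \<in> V" by (rule frame_exists)
  then show "\<exists>b. basis_of E x b" using frame_basis by blast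
qed (use bundle_ax in \<open>(unfold hermitian_bundle_def, blast)+\<close>)

text \<open>\<open>lin\<close> involves only the bundle and the given basis, so one constant serves
  at all points and can be used with a varying base point.\<close>

abbreviation "lin \<equiv> fib.lin"

section \<open>Charts of the base and of the projectivized bundle\<close>

lemma chart_exists: obtains U \<phi> where "(U, \<phi>) \<in> atlas M" "x \<in> U"
proof -
  have "x \<in> (\<Union>(U, \<phi>)\<in>atlas M. U)"
    using manifold_ax unfolding hermitian_manifold_def complex_atlas_def by simp
  then show thesis using that by auto
qed

lemma chart_homeo:
  assumes "(U, \<phi>) \<in> atlas M"
  shows "openin (cspace (mdim M)) (\<phi> ` U)"
    and "homeomorphic_map (top_of_set U) (subtopology (cspace (mdim M)) (\<phi> ` U)) \<phi>"
  using manifold_ax assms unfolding hermitian_manifold_def complex_atlas_def by fast+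

lemma chart_inj: "(U, \<phi>) \<in> atlas M \<Longrightarrow> inj_on \<phi> U"
  using homeomorphic_imp_injective_map[OF chart_homeo(2)] by simp

text \<open>Since chart values are extensional, cutting a coordinate vector of the projectivized
  bundle down to its first \<open>mdim M\<close> entries returns \<open>\<phi> x\<close> itself, not
  merely a function agreeing with it there.\<close>

lemma chart_extensional: "(U, \<phi>) \<in> atlas M \<Longrightarrow> x \<in> U \<Longrightarrow> \<phi> x \<in> extensional {..<mdim M}"
  using openin_subset[OF chart_homeo(1)] by (auto simp: cspace_def PiE_def)

definition proj_dom :: "'m set \<Rightarrow> 'm set \<Rightarrow> ('m \<Rightarrow> nat \<Rightarrow> 'v) \<Rightarrow> nat \<Rightarrow> ('m, 'v) proj_point set" where
  "proj_dom U V e j = taut_domain E (V, e) j \<inter> (U \<times> UNIV)"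

definition proj_chart :: "('m \<Rightarrow> cn) \<Rightarrow> ('m \<Rightarrow> nat \<Rightarrow> 'v) \<Rightarrow> nat \<Rightarrow> ('m, 'v) proj_point \<Rightarrow> cn" where
  "proj_chart \<phi> e j = (\<lambda>q. \<lambda>i\<in>{..<mdim M + brank E - 1}.
     if i < mdim M then \<phi> (fst q) i else taut_frame e j q (e (fst q) (skip j (i - mdim M))))"

lemma proj_atlas_eq:
  "proj_atlas M E = {(proj_dom U V e j, proj_chart \<phi> e j) |U \<phi> V e j.
     (U, \<phi>) \<in> atlas M \<and> (V, e) \<in> frames E \<and> j < brank E}"
  by (simp add: proj_atlas_def proj_dom_def proj_chart_def)

lemma proj_dom_point:
  assumes V: "(V, e) \<in> frames E" and q: "q \<in> proj_dom U V e j"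
  obtains x \<tau> where "q = (x, line \<tau>)" "x \<in> U" "x \<in> V" "\<tau> \<in> dual_fiber E x" "\<tau> (e x j) = 1" "taut_frame e j q = \<tau>"
proof -
  obtain x L where xL: "q = (x, L)" by force
  then have "(x, L) \<in> taut_domain E (V, e) j" "x \<in> U" "x \<in> V" using q by (auto simp: proj_dom_def taut_domain_def)
  then show thesis using fib.taut_domain_normalized[of x L V e j] that xL by metis
qed

lemma proj_chart_base:
  assumes "(U, \<phi>) \<in> atlas M" "x \<in> U"
  shows "restrict (proj_chart \<phi> e j (x, L)) {..<mdim M} = \<phi> x"
proof
  fix i
  show "restrict (proj_chart \<phi> e j (x, L)) {..<mdim M} i = \<phi> x i"
    using chart_extensional[OF assms] rank_pos by (auto simp: proj_chart_def extensional_def)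
qed

lemma proj_chart_fiber:
  "k < brank E - 1 \<Longrightarrow> proj_chart \<phi> e j q (mdim M + k) = taut_frame e j q (e (fst q) (skip j k))"
  using rank_pos by (auto simp: proj_chart_def)

lemma skip_cases:
  assumes "i < r" "j < r" "i \<noteq> j"
  obtains k where "k < r - 1" "i = skip j k"
  using assms bij_betw_skip[OF assms(2)] by (auto simp: bij_betw_def image_iff set_eq_iff)

text \<open>The base coordinates fix the point; the affine coordinates with the normalization at
  \<open>e x j\<close> fix the functional on a basis. This makes \<open>inv_into\<close>, through
  which \<open>holo_fun\<close> is defined, a true inverse of the chart.\<close>

lemma proj_chart_inj:
  assumes U: "(U, \<phi>) \<in> atlas M" and V: "(V, e) \<in> frames E" and j: "j < brank E"
  shows "inj_on (proj_chart \<phi> e j) (proj_dom U V e j)"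
proof (rule inj_onI)
  fix q q' assume q: "q \<in> proj_dom U V e j" and q': "q' \<in> proj_dom U V e j"
    and eq: "proj_chart \<phi> e j q = proj_chart \<phi> e j q'"
  obtain x \<tau> where x: "q = (x, line \<tau>)" "x \<in> U" "x \<in> V" "\<tau> \<in> dual_fiber E x" "\<tau> (e x j) = 1" "taut_frame e j q = \<tau>"
    using proj_dom_point[OF V q] .
  obtain y \<sigma> where y: "q' = (y, line \<sigma>)" "y \<in> U" "y \<in> V" "\<sigma> \<in> dual_fiber E y" "\<sigma> (e y j) = 1" "taut_frame e j q' = \<sigma>"
    using proj_dom_point[OF V q'] .
  have "\<phi> x = \<phi> y"
    using proj_chart_base[OF U x(2), of e j "line \<tau>"] proj_chart_base[OF U y(2), of e j "line \<sigma>"] eq x(1) y(1) by metis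
  then have xy: "x = y" using inj_onD[OF chart_inj[OF U]] x(2) y(2) by blast
  have "\<tau> (e x i) = \<sigma> (e x i)" if i: "i < brank E" for i
  proof (cases "i = j")
    case True
    then show ?thesis using x(5) y(5) xy by simp
  next
    case False
    obtain k where k: "k < brank E - 1" "i = skip j k" using skip_cases[OF i j False] .
    show ?thesis
      using proj_chart_fiber[OF k(1), of \<phi> e j q] proj_chart_fiber[OF k(1), of \<phi> e j q'] eq k(2) x(1,6) y(1,6) xy by simp
  qed
  then have "\<tau> = \<sigma>"
    using x(4) y(4) xy by (intro fib.dual_eqI[OF frame_basis[OF V x(3)]]) auto
  then show "q = q'" using x(1) y(1) xy by simp
qed

text \<open>In a bundle chart a function pulled back from \<open>M\<close> depends only on the first
  \<open>mdim M\<close> coordinates, so the chain rule with a coordinate projection suffices.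
  \<open>Y\<close> allows functions known only over part of \<open>U\<close>, such as transition
  functions.\<close>

lemma holo_on_base:
  assumes U: "(U, \<phi>) \<in> atlas M" and V: "(V, e) \<in> frames E" and j: "j < brank E"
    and X: "X \<subseteq> proj_dom U V e j" "\<And>q. q \<in> X \<Longrightarrow> fst q \<in> Y"
    and f: "holo_on (mdim M) (\<phi> ` (U \<inter> Y)) (\<lambda>z. f (inv_into U \<phi> z))"
  shows "holo_on (mdim M + brank E - 1) (proj_chart \<phi> e j ` X)
    (\<lambda>z. f (fst (inv_into (proj_dom U V e j) (proj_chart \<phi> e j) z)))"
proof -
  let ?\<psi> = "proj_chart \<phi> e j"
  have *: "restrict (?\<psi> q) {..<mdim M} = \<phi> (fst q) \<and> fst q \<in> U" if "q \<in> X" for q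
  proof -
    have "fst q \<in> U" using X(1) that by (auto simp: proj_dom_def)
    then show ?thesis using proj_chart_base[OF U, of "fst q" e j "snd q"] by simp
  qed
  have holo: "holo_on (mdim M + brank E - 1) (?\<psi> ` X) (\<lambda>z. f (inv_into U \<phi> (restrict z {..<mdim M})))"
  proof (rule holo_on_compose[OF f])
    show "holo_on (mdim M + brank E - 1) (?\<psi> ` X) (\<lambda>z. restrict z {..<mdim M} i)" if "i < mdim M" for i
      using that rank_pos by (simp add: holo_on_coord)
    show "restrict z {..<mdim M} \<in> \<phi> ` (U \<inter> Y)" if "z \<in> ?\<psi> ` X" for z
      using that * X(2) by auto
  qed
  have "f (fst (inv_into (proj_dom U V e j) ?\<psi> z)) = f (inv_into U \<phi> (restrict z {..<mdim M}))"
    if z: "z \<in> ?\<psi> ` X" for z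
  proof -
    obtain q where q: "z = ?\<psi> q" "q \<in> X" using z by blast
    have "inv_into (proj_dom U V e j) ?\<psi> z = q"
      unfolding q(1) using q(2) X(1) by (intro inv_into_f_f[OF proj_chart_inj[OF U V j]]) auto
    moreover have "inv_into U \<phi> (restrict z {..<mdim M}) = fst q"
      unfolding q(1) using *[OF q(2)] inv_into_f_f[OF chart_inj[OF U]] by simp
    ultimately show ?thesis by simp
  qed
  then show ?thesis by (rule holo_on_eqI[OF holo])
qed

text \<open>These components are the constant \<open>1\<close> for \<open>i = j\<close> and
  otherwise chart coordinates.\<close>

lemma holo_on_taut_frame:
  assumes U: "(U, \<phi>) \<in> atlas M" and V: "(V, e) \<in> frames E" and j: "j < brank E"
    and X: "X \<subseteq> proj_dom U V e j" and i: "i < brank E"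
  shows "holo_on (mdim M + brank E - 1) (proj_chart \<phi> e j ` X)
    (\<lambda>z. taut_frame e j (inv_into (proj_dom U V e j) (proj_chart \<phi> e j) z)
       (e (fst (inv_into (proj_dom U V e j) (proj_chart \<phi> e j) z)) i))"
proof -
  let ?\<psi> = "proj_chart \<phi> e j"
  let ?inv = "inv_into (proj_dom U V e j) ?\<psi>"
  have inv: "?inv (?\<psi> q) = q" if "q \<in> X" for q
    using that X by (intro inv_into_f_f[OF proj_chart_inj[OF U V j]]) auto
  show ?thesis
  proof (cases "i = j")
    case True
    have "taut_frame e j (?inv z) (e (fst (?inv z)) i) = 1" if z: "z \<in> ?\<psi> ` X" for z
    proof -
      obtain q where q: "z = ?\<psi> q" "q \<in> X" using z by blast
      then have "q \<in> proj_dom U V e j" using X by blast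
      then obtain x \<tau> where "q = (x, line \<tau>)" "\<tau> (e x j) = 1" "taut_frame e j q = \<tau>"
        using proj_dom_point[OF V] by metis
      then show ?thesis using True inv[OF q(2)] by (simp add: q(1))
    qed
    then show ?thesis by (rule holo_on_eqI[OF holo_on_const])
  next
    case False
    obtain k where k: "k < brank E - 1" "i = skip j k" using skip_cases[OF i j False] .
    have eq: "taut_frame e j (?inv z) (e (fst (?inv z)) i) = z (mdim M + k)" if "z \<in> ?\<psi> ` X" for z
      using that inv proj_chart_fiber[OF k(1), of \<phi> e j] k(2) by auto
    have "holo_on (mdim M + brank E - 1) (?\<psi> ` X) (\<lambda>z. z (mdim M + k))"
      using k(1) by (intro holo_on_coord) simp
    then show ?thesis by (rule holo_on_eqI) (rule eq)
  qed
qed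

lemma H0_sym_multilinear: "S \<in> H0_sym M E p \<Longrightarrow> S x \<in> multilinear_forms p (dual_fiber E x)"
  by (simp add: H0_sym_def sym_fiber_def)

section \<open>Holomorphy of the Le Potier section\<close>

text \<open>The chart may come from another frame and index than the trivialization being tested.
  Transition functions express the chart's functional in the tested frame, and the component becomes
  a polynomial in quotients of these coordinates with the components of \<open>S\<close> as
  coefficients.\<close>

lemma le_potier_H0:
  assumes S: "S \<in> H0_sym M E p"
  shows "le_potier E p S \<in> H0_O M E p"
  unfolding H0_O_def
proof (intro CollectI conjI ballI allI impI)
  show "le_potier E p S q = (\<lambda>_. 0)" if "q \<notin> proj_dual E" for q
    using that by (cases q) (simp add: le_potier_def)
  show "le_potier E p S q \<in> multilinear_forms p (snd q)" if qP: "q \<in> proj_dual E" for q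
  proof -
    obtain x L where q: "q = (x, L)" "L \<in> proj_fiber E x" using qP by (auto simp: proj_dual_def)
    obtain \<phi> where "L = line \<phi>" "\<phi> \<in> dual_fiber E x" using fib.proj_fiberE[OF q(2)] by metis
    then show ?thesis
      unfolding q(1) fib.le_potier_eq[where S = S and x = x, OF H0_sym_multilinear[OF S] q(2)] snd_conv
      using restrict_form_in[OF H0_sym_multilinear[OF S]] function_space_line fib.line_subset by metis
  qed
  have "holo_fun (mdim M + brank E - 1) (proj_atlas M E) (taut_domain E (V, e) j)
          (\<lambda>q. le_potier E p S q (diag_tuple p (taut_frame e j q)))"
    if V: "(V, e) \<in> frames E" and j: "j < brank E" for V e j
    unfolding holo_fun_def proj_atlas_eq
  proof clarify
    fix U \<phi> V' e' j'
    assume U: "(U, \<phi>) \<in> atlas M" and V': "(V', e') \<in> frames E" and j': "j' < brank E"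
    let ?Q = "proj_dom U V' e' j'" and ?\<psi> = "proj_chart \<phi> e' j'" and ?N = "mdim M + brank E - 1"
    let ?X = "?Q \<inter> taut_domain E (V, e) j"
    let ?inv = "inv_into ?Q ?\<psi>"
    let ?Z = "?\<psi> ` ?X"
    have XQ: "?X \<subseteq> ?Q" by blast
    have XV: "fst q \<in> V" if "q \<in> ?X" for q using that by (auto simp: taut_domain_def)
    have XVV: "fst q \<in> V' \<inter> V" if "q \<in> ?X" for q using that by (auto simp: proj_dom_def taut_domain_def)
    have inv: "?inv (?\<psi> q) = q" if "q \<in> ?X" for q
      using that by (intro inv_into_f_f[OF proj_chart_inj[OF U V' j']]) auto
    \<comment> \<open>\<open>c k z\<close> is the value at \<open>e k\<close> of the functional
      normalized in the chart frame \<open>e'\<close>. On the domain tested \<open>c j z\<close> is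
      nonzero, and dividing by it renormalizes the functional to
      \<open>taut_frame e j\<close>.\<close>
    define c where "c k z = (\<Sum>m<brank E. taut_frame e' j' (?inv z) (e' (fst (?inv z)) m) *
        dual_basis E (e' (fst (?inv z))) m (e (fst (?inv z)) k))" for k z
    have c_holo: "holo_on ?N ?Z (c k)" if k: "k < brank E" for k
      unfolding c_def
    proof (intro holo_on_sum holo_on_mult)
      fix m assume "m \<in> {..<brank E}"
      then have m: "m < brank E" by simp
      show "holo_on ?N ?Z (\<lambda>z. taut_frame e' j' (?inv z) (e' (fst (?inv z)) m))"
        by (rule holo_on_taut_frame[OF U V' j' XQ m])
      show "holo_on ?N ?Z (\<lambda>z. dual_basis E (e' (fst (?inv z))) m (e (fst (?inv z)) k))"
        by (rule holo_on_base[OF U V' j' XQ XVV, where f = "\<lambda>x. dual_basis E (e' x) m (e x k)"])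
          (assumption, rule frame_transition[OF V' V m k U])
    qed
    have T_holo: "holo_on ?N ?Z (\<lambda>z. S (fst (?inv z)) (\<lambda>k\<in>{..<p}. dual_basis E (e (fst (?inv z))) (I k)))"
      if I: "I \<in> {..<p} \<rightarrow>\<^sub>E {..<brank E}" for I
    proof (rule holo_on_base[OF U V' j' XQ XV, where f = "\<lambda>x. S x (\<lambda>k\<in>{..<p}. dual_basis E (e x) (I k))"])
      show "holo_on (mdim M) (\<phi> ` (U \<inter> V)) (\<lambda>z. S (inv_into U \<phi> z) (\<lambda>k\<in>{..<p}. dual_basis E (e (inv_into U \<phi> z)) (I k)))"
        using S V I U unfolding H0_sym_def holo_fun_def by fast
    qed
    have point: "c j z \<noteq> 0 \<and> le_potier E p S (?inv z) (diag_tuple p (taut_frame e j (?inv z))) =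
        (\<Sum>I\<in>{..<p} \<rightarrow>\<^sub>E {..<brank E}. (\<Prod>k<p. c (I k) z / c j z) *
          S (fst (?inv z)) (\<lambda>k\<in>{..<p}. dual_basis E (e (fst (?inv z))) (I k)))" if z: "z \<in> ?Z" for z
    proof -
      obtain q where q: "z = ?\<psi> q" "q \<in> ?X" using z by blast
      have qQ: "q \<in> ?Q" using q(2) by blast
      obtain x \<tau> where x: "q = (x, line \<tau>)" "x \<in> U" "x \<in> V'" "\<tau> \<in> dual_fiber E x" "\<tau> (e' x j') = 1" "taut_frame e' j' q = \<tau>"
        using proj_dom_point[OF V' qQ] .
      have xV: "x \<in> V" using XV[OF q(2)] x(1) by simp
      have izq: "?inv z = q" unfolding q(1) by (rule inv[OF q(2)])
      have c: "c k z = \<tau> (e x k)" for k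
        using fun_cong[OF fib.dual_expand[OF frame_basis[OF V' x(3)] x(4)], of "e x k"]
        unfolding c_def izq x(1) fst_conv using x(1,6) by simp
      have q_dom: "(x, line \<tau>) \<in> taut_domain E (V, e) j" using q(2) x(1) by simp
      then obtain \<phi>' where "\<phi>' \<in> line \<tau>" "\<phi>' (e x j) \<noteq> 0" by (auto simp: taut_domain_def)
      then have \<tau>j: "\<tau> (e x j) \<noteq> 0" by (auto simp: line_def)
      have frame: "taut_frame e j q = (\<lambda>v. \<tau> v / \<tau> (e x j))"
        unfolding x(1) by (rule fib.taut_frame_eq[where \<phi> = \<tau> and e = e and x = x and j = j, OF \<tau>j])
      let ?\<sigma> = "\<lambda>v. inverse (\<tau> (e x j)) * \<tau> v"
      have \<sigma>: "?\<sigma> \<in> dual_fiber E x" using fib.function_space_dual x(4) by (simp add: function_space_def)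
      have \<sigma>L: "?\<sigma> \<in> line \<tau>" by (auto simp: line_def)
      have L: "line \<tau> \<in> proj_fiber E x" using q_dom by (auto simp: taut_domain_def proj_dual_def)
      have "le_potier E p S q (diag_tuple p (taut_frame e j q)) = S x (diag_tuple p ?\<sigma>)"
      proof -
        have "taut_frame e j q = ?\<sigma>" unfolding frame by (simp add: field_simps)
        then show ?thesis
          using fib.le_potier_eq[where S = S and x = x, OF H0_sym_multilinear[OF S] L]
          by (simp only: x(1) restrict_form_diag[OF \<sigma>L])
      qed
      also have "?\<sigma> = lin (e x) (\<lambda>k. ?\<sigma> (e x k))"
        by (rule fib.lin_expand[OF frame_basis[OF V xV] \<sigma>, symmetric])
      also have "S x (diag_tuple p (lin (e x) (\<lambda>k. ?\<sigma> (e x k)))) =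
          (\<Sum>I\<in>{..<p} \<rightarrow>\<^sub>E {..<brank E}. (\<Prod>k<p. ?\<sigma> (e x (I k))) * S x (\<lambda>k\<in>{..<p}. dual_basis E (e x) (I k)))"
        by (rule fib.diag_lin[OF H0_sym_multilinear[OF S] frame_basis[OF V xV]])
      finally show ?thesis
        unfolding izq c using \<tau>j x(1) by (simp add: divide_inverse mult.commute)
    qed
    have holo: "holo_on ?N ?Z (\<lambda>z. \<Sum>I\<in>{..<p} \<rightarrow>\<^sub>E {..<brank E}. (\<Prod>k<p. c (I k) z / c j z) *
          S (fst (?inv z)) (\<lambda>k\<in>{..<p}. dual_basis E (e (fst (?inv z))) (I k)))"
    proof (intro holo_on_sum holo_on_mult holo_on_prod holo_on_divide T_holo c_holo)
      show "c j z \<noteq> 0" if "z \<in> ?Z" for z using point[OF that] by blast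
    qed (use j in \<open>auto simp: PiE_iff\<close>)
    show "holo_on ?N (?\<psi> ` (?Q \<inter> taut_domain E (V, e) j))
       (\<lambda>z. le_potier E p S (?inv z) (diag_tuple p (taut_frame e j (?inv z))))"
      by (rule holo_on_eqI[OF holo]) (rule conjunct2[OF point])
  qed
  then show "\<And>Ve. Ve \<in> frames E \<Longrightarrow> case Ve of (V, e) \<Rightarrow> \<forall>j<brank E.
        holo_fun (mdim M + brank E - 1) (proj_atlas M E) (taut_domain E (V, e) j)
          (\<lambda>q. le_potier E p S q (diag_tuple p (taut_frame e j q)))" by blast
qed

section \<open>Sections of \<open>O(p)\<close> as homogeneous functions on nonzero
  functionals\<close>

text \<open>Both functionals span the same line, so a single \<open>p\<close>-linear form is
  evaluated at proportional diagonal arguments.\<close>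

lemma diag_scale:
  assumes s: "s \<in> H0_O M E p" and \<tau>: "\<tau> \<in> dual_fiber E x" "\<tau> \<noteq> (\<lambda>_. 0)" and c: "c \<noteq> 0"
  shows "s (x, line (\<lambda>v. c * \<tau> v)) (diag_tuple p (\<lambda>v. c * \<tau> v)) = c ^ p * s (x, line \<tau>) (diag_tuple p \<tau>)"
proof -
  have "(x, line \<tau>) \<in> proj_dual E" using \<tau> by (auto simp: proj_dual_def proj_fiber_def)
  then have "s (x, line \<tau>) \<in> multilinear_forms p (line \<tau>)" using s by (force simp: H0_O_def)
  then show ?thesis unfolding line_scale[OF c] by (rule multilinear_diag_scale[OF _ function_space_line mem_line])
qed

text \<open>In the chart normalized at index \<open>j\<close> the family has affine coordinates
  \<open>C z k / C z j\<close>, and homogeneity restores the factor \<open>C z j ^ p\<close>. It is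
  used with a fixed base point and varying coordinates to obtain entire functions, and with constant
  coordinates and a varying base point to obtain holomorphic components.\<close>

lemma holo_on_section:
  assumes s: "s \<in> H0_O M E p" and U: "(U, \<phi>) \<in> atlas M" and V: "(V, e) \<in> frames E" and j: "j < brank E"
    and G: "\<And>i. i < mdim M \<Longrightarrow> holo_on d X (\<lambda>z. G z i)" "\<And>z. z \<in> X \<Longrightarrow> G z \<in> \<phi> ` (U \<inter> V)"
    and C: "\<And>i. i < brank E \<Longrightarrow> holo_on d X (\<lambda>z. C z i)" "\<And>z. z \<in> X \<Longrightarrow> C z j \<noteq> 0"
  defines "\<tau> \<equiv> \<lambda>z. lin (e (inv_into U \<phi> (G z))) (C z)"
  shows "holo_on d X (\<lambda>z. s (inv_into U \<phi> (G z), line (\<tau> z)) (diag_tuple p (\<tau> z)))"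
proof -
  let ?Q = "proj_dom U V e j" and ?\<psi> = "proj_chart \<phi> e j" and ?N = "mdim M + brank E - 1"
  let ?inv = "inv_into ?Q ?\<psi>"
  let ?f = "\<lambda>w. s (?inv w) (diag_tuple p (taut_frame e j (?inv w)))"
  define q where "q z = (inv_into U \<phi> (G z), line (\<tau> z))" for z
  have "holo_on ?N (?\<psi> ` (?Q \<inter> taut_domain E (V, e) j)) ?f"
    using s V j U unfolding H0_O_def holo_fun_def proj_atlas_eq by fast
  moreover have "?Q \<inter> taut_domain E (V, e) j = ?Q" by (auto simp: proj_dom_def)
  ultimately have f: "holo_on ?N (?\<psi> ` ?Q) ?f" by simp
  have point: "q z \<in> ?Q \<and> \<phi> (fst (q z)) = G z \<and> taut_frame e j (q z) = (\<lambda>v. \<tau> z v / C z j)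
      \<and> (\<forall>k<brank E. \<tau> z (e (fst (q z)) k) = C z k) \<and> \<tau> z \<in> dual_fiber E (fst (q z)) \<and> \<tau> z \<noteq> (\<lambda>_. 0)" if z: "z \<in> X" for z
  proof -
    obtain x where x: "G z = \<phi> x" "x \<in> U" "x \<in> V" using G(2)[OF z] by auto
    have inv: "inv_into U \<phi> (G z) = x" unfolding x(1) by (rule inv_into_f_f[OF chart_inj[OF U] x(2)])
    have b: "basis_of E x (e x)" by (rule frame_basis[OF V x(3)])
    have \<tau>: "\<tau> z = lin (e x) (C z)" by (simp add: \<tau>_def inv)
    have \<tau>k: "\<tau> z (e x k) = C z k" if "k < brank E" for k
      unfolding \<tau> by (rule fib.lin_basis[OF b that])
    have \<tau>D: "\<tau> z \<in> dual_fiber E x" unfolding \<tau> by (rule fib.lin_in[OF b])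
    have \<tau>0: "\<tau> z \<noteq> (\<lambda>_. 0)" using \<tau>k[OF j] C(2)[OF z] by force
    have "q z \<in> ?Q"
      unfolding q_def inv using \<tau>k[OF j] C(2)[OF z] \<tau>D \<tau>0 x(2,3) mem_line[of "\<tau> z"]
      by (auto simp: proj_dom_def taut_domain_def proj_dual_def proj_fiber_def intro!: bexI[of _ "\<tau> z"])
    moreover have "taut_frame e j (q z) = (\<lambda>v. \<tau> z v / C z j)"
      using fib.taut_frame_eq[of "\<tau> z" e x j] \<tau>k[OF j] C(2)[OF z] by (simp add: q_def inv)
    ultimately show ?thesis unfolding q_def inv using x(1) \<tau>k \<tau>D \<tau>0 by simp
  qed
  have "holo_on d X (\<lambda>z. ?f (?\<psi> (q z)))"
  proof (rule holo_on_compose[OF f])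
    show "?\<psi> (q z) \<in> ?\<psi> ` ?Q" if "z \<in> X" for z using point[OF that] by blast
    show "holo_on d X (\<lambda>z. ?\<psi> (q z) i)" if i: "i < ?N" for i
    proof (cases "i < mdim M")
      case True
      have "?\<psi> (q z) i = G z i" if "z \<in> X" for z using point[OF that] i True by (simp add: proj_chart_def)
      then show ?thesis by (rule holo_on_eqI[OF G(1)[OF True]])
    next
      case False
      define k where "k = i - mdim M"
      have k: "k < brank E - 1" using i False by (simp add: k_def)
      have sk: "skip j k < brank E" using k j by (auto simp: skip_def)
      have eq: "?\<psi> (q z) i = C z (skip j k) / C z j" if "z \<in> X" for z
        using point[OF that] i False sk by (simp add: proj_chart_def k_def)
      have "holo_on d X (\<lambda>z. C z (skip j k) / C z j)"
        using C j sk by (intro holo_on_divide) auto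
      then show ?thesis by (rule holo_on_eqI) (rule eq)
    qed
  qed
  \<comment> \<open>The power of \<open>C z j\<close> is written as a product so that closure under
    finite products applies.\<close>
  then have holo: "holo_on d X (\<lambda>z. (\<Prod>k<p. C z j) * ?f (?\<psi> (q z)))"
    using C(1)[OF j] by (intro holo_on_mult holo_on_prod)
  have "s (inv_into U \<phi> (G z), line (\<tau> z)) (diag_tuple p (\<tau> z)) = (\<Prod>k<p. C z j) * ?f (?\<psi> (q z))" if z: "z \<in> X" for z
  proof -
    have inv: "?inv (?\<psi> (q z)) = q z" using point[OF z] by (intro inv_into_f_f[OF proj_chart_inj[OF U V j]]) simp
    have c: "inverse (C z j) \<noteq> 0" using C(2)[OF z] by simp
    have "?f (?\<psi> (q z)) = s (fst (q z), line (\<lambda>v. inverse (C z j) * \<tau> z v)) (diag_tuple p (\<lambda>v. inverse (C z j) * \<tau> z v))"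
      unfolding inv line_scale[OF c] using point[OF z] by (simp add: q_def field_simps)
    also have "\<dots> = inverse (C z j) ^ p * s (fst (q z), line (\<tau> z)) (diag_tuple p (\<tau> z))"
      using point[OF z] by (intro diag_scale[OF s _ _ c]) auto
    finally show ?thesis using C(2)[OF z] by (simp add: q_def power_inverse)
  qed
  then show ?thesis by (rule holo_on_eqI[OF holo])
qed

text \<open>A coordinate line and its reversal at infinity give the two entire functions required by
  \<open>entire_polynomial\<close>, linked by homogeneity. The value \<open>0\<close> at the origin,
  where there is no line to evaluate at, is the one forced by homogeneity of positive
  degree.\<close>

lemma section_polynomial_form:
  assumes s: "s \<in> H0_O M E p" and p: "1 \<le> p" and U: "(U, \<phi>) \<in> atlas M" and V: "(V, e) \<in> frames E"
    and x: "x \<in> U" "x \<in> V"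
  defines "F \<equiv> \<lambda>z. if \<forall>i<brank E. z i = 0 then 0
    else s (x, line (lin (e x) z)) (diag_tuple p (lin (e x) z))"
  shows "form_polynomial (brank E) p F"
proof -
  let ?r = "brank E"
  have b: "basis_of E x (e x)" by (rule frame_basis[OF V x(2)])
  have inv: "inv_into U \<phi> (\<phi> x) = x" by (rule inv_into_f_f[OF chart_inj[OF U] x(1)])
  have hom: "F (\<lambda>i. t * z i) = t ^ p * F z" if t: "t \<noteq> 0" for t z
  proof (cases "\<forall>i<?r. z i = 0")
    case False
    then have "lin (e x) z \<noteq> (\<lambda>_. 0)" using fib.lin_eq_0_iff[OF b] by blast
    then show ?thesis
      using diag_scale[OF s fib.lin_in[OF b] _ t, of z] t False by (auto simp: F_def fib.lin_scale)
  qed (simp add: F_def)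
  \<comment> \<open>Coordinate \<open>j\<close> is constant and nonzero along this affine line,
    which therefore avoids the origin and stays within one chart.\<close>
  have entire: "(\<lambda>w. F (\<lambda>k. a k + w * c k)) holomorphic_on UNIV" if j: "j < ?r" "a j \<noteq> 0" "c j = 0" for a c j
  proof (rule holomorphic_on_of_holo_on)
    let ?C = "\<lambda>u::cn. \<lambda>k. a k + u 0 * c k"
    have "holo_on 1 UNIV (\<lambda>u. s (inv_into U \<phi> (\<phi> x), line (lin (e (inv_into U \<phi> (\<phi> x))) (?C u)))
        (diag_tuple p (lin (e (inv_into U \<phi> (\<phi> x))) (?C u))))"
    proof (rule holo_on_section[OF s U V j(1), where G = "\<lambda>_. \<phi> x" and C = ?C])
      show "holo_on 1 UNIV (\<lambda>u. a i + u 0 * c i)" for i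
        by (intro holo_on_add holo_on_mult holo_on_const holo_on_coord) simp
    qed (use x j in \<open>auto intro: holo_on_const\<close>)
    moreover have "F (?C u) = s (x, line (lin (e x) (?C u))) (diag_tuple p (lin (e x) (?C u)))" for u
    proof -
      have "?C u j \<noteq> 0" using j by simp
      then have "\<not> (\<forall>i<?r. ?C u i = 0)" using j(1) by blast
      then show ?thesis unfolding F_def by (simp only: if_False)
    qed
    ultimately show "holo_on 1 UNIV (\<lambda>u. F (?C u))" by (simp only: inv)
  qed
  have poly: "\<exists>P. degree P \<le> p \<and> (\<forall>w. F (z(i := w)) = poly P w)" if i: "i < ?r" for z i
  proof (cases "\<exists>j<?r. j \<noteq> i \<and> z j \<noteq> 0")
    case True
    then obtain j where j: "j < ?r" "j \<noteq> i" "z j \<noteq> 0" by blast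
    define a where "a = z(i := 0)"
    define c :: cn where "c k = (if k = i then 1 else 0)" for k
    have upd: "z(i := w) = (\<lambda>k. a k + w * c k)" for w by (auto simp: a_def c_def)
    have h: "(\<lambda>w. F (z(i := w))) holomorphic_on UNIV"
      unfolding upd using j by (intro entire[of j]) (auto simp: a_def c_def)
    \<comment> \<open>On the reversed line direction and base vector are exchanged; now coordinate
      \<open>i\<close> is constantly \<open>1\<close>, so the line again avoids the origin.\<close>
    have g: "(\<lambda>w. F (\<lambda>k. c k + w * a k)) holomorphic_on UNIV"
      using i by (intro entire[of i]) (auto simp: a_def c_def)
    have "F (z(i := w)) = w ^ p * F (\<lambda>k. c k + 1 / w * a k)" if "w \<noteq> 0" for w
    proof -
      have "z(i := w) = (\<lambda>k. w * (c k + 1 / w * a k))" using that by (auto simp: upd field_simps)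
      then show ?thesis using hom[OF that, of "\<lambda>k. c k + 1 / w * a k"] by (simp only:)
    qed
    then show ?thesis by (rule entire_polynomial[OF h g])
  next
    case False
    \<comment> \<open>Here all other coordinates vanish and the line passes through the origin, so
      homogeneity alone yields a monomial. In rank one this is the only case.\<close>
    have eq: "F (z(i := w)) = w ^ p * F (z(i := 1))" for w
    proof (cases "w = 0")
      case True
      then have "\<forall>k<?r. (z(i := w)) k = 0" using False by auto
      then show ?thesis using True p by (simp only: F_def if_True) simp
    next
      case w: False
      have z: "z k = 0" if "k < ?r" "k \<noteq> i" for k using False that by blast
      have "lin (e x) (z(i := w)) = lin (e x) (\<lambda>k. w * (z(i := 1)) k)"
        by (rule fib.lin_cong) (auto simp: z)
      moreover have "(\<forall>k<?r. (z(i := w)) k = 0) \<longleftrightarrow> (\<forall>k<?r. w * (z(i := 1)) k = 0)" using z w by auto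
      ultimately have "F (z(i := w)) = F (\<lambda>k. w * (z(i := 1)) k)" unfolding F_def by (simp only:)
      also have "\<dots> = w ^ p * F (z(i := 1))" by (rule hom[OF w])
      finally show ?thesis .
    qed
    have "F (z(i := w)) = poly (monom (F (z(i := 1))) p) w" for w
      unfolding poly_monom using eq[of w] by (rule trans[OF _ mult.commute])
    then show ?thesis by (intro exI[of _ "monom (F (z(i := 1))) p"] conjI degree_monom_le allI)
  qed
  have dep: "F z = F z'" if "\<And>i. i < ?r \<Longrightarrow> z i = z' i" for z z'
  proof -
    have "lin (e x) z = lin (e x) z'" by (rule fib.lin_cong) (rule that)
    moreover have "(\<forall>i<?r. z i = 0) \<longleftrightarrow> (\<forall>i<?r. z' i = 0)" using that by metis
    ultimately show ?thesis unfolding F_def by (simp only:)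
  qed
  have "(0 \<le> p \<longrightarrow> form_polynomial ?r (p - 0) F) \<and> (p < 0 \<longrightarrow> F = (\<lambda>_. 0))"
  proof (rule homogeneous_form_polynomial)
    show "F z = F z'" if "\<And>i. i < ?r \<Longrightarrow> z i = z' i" for z z' by (rule dep) (rule that)
    show "\<exists>P. degree P \<le> p \<and> (\<forall>w. F (z(i := w)) = poly P w)" if "i < ?r" for z i by (rule poly[OF that])
    show "t ^ 0 * F (\<lambda>i. t * z i) = t ^ p * F z" if "t \<noteq> 0" for t z
      using hom[OF that] by (simp only: power_0 mult_1)
  qed
  then show ?thesis by simp
qed

text \<open>The coefficients of the homogeneous polynomial define a \<open>p\<close>-linear form,
  and symmetrization leaves its diagonal values unchanged.\<close>

lemma section_symmetric_form:
  assumes s: "s \<in> H0_O M E p" and p: "1 \<le> p"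
  shows "\<exists>T. symmetric_form p (dual_fiber E x) T \<and>
    (\<forall>\<tau>\<in>dual_fiber E x. \<tau> \<noteq> (\<lambda>_. 0) \<longrightarrow> T (diag_tuple p \<tau>) = s (x, line \<tau>) (diag_tuple p \<tau>))"
proof -
  let ?D = "dual_fiber E x" and ?r = "brank E"
  obtain U \<phi> where U: "(U, \<phi>) \<in> atlas M" "x \<in> U" by (rule chart_exists)
  obtain V e where V: "(V, e) \<in> frames E" "x \<in> V" by (rule frame_exists)
  have b: "basis_of E x (e x)" by (rule frame_basis[OF V])
  obtain a where a: "\<And>z. (if \<forall>i<?r. z i = 0 then 0
    else s (x, line (lin (e x) z)) (diag_tuple p (lin (e x) z))) = (\<Sum>J\<in>{..<p} \<rightarrow>\<^sub>E {..<?r}. a J * (\<Prod>k<p. z (J k)))"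
    using section_polynomial_form[OF s p U(1) V(1) U(2) V(2)] unfolding form_polynomial_def by blast
  \<comment> \<open>The tuple coefficients become the components on dual basis vectors. They need
    not be symmetric in the entries of the tuple.\<close>
  define T0 :: "'v form" where "T0 t = (if t \<in> {..<p} \<rightarrow>\<^sub>E ?D
    then \<Sum>J\<in>{..<p} \<rightarrow>\<^sub>E {..<?r}. a J * (\<Prod>k<p. t k (e x (J k))) else 0)" for t
  have "T0 \<in> multilinear_forms p ?D"
    unfolding multilinear_forms_def
  proof (intro CollectI conjI allI impI ballI)
    fix t i \<phi> \<psi> c assume *: "t \<in> {..<p} \<rightarrow>\<^sub>E ?D" "i < p" "\<phi> \<in> ?D" "\<psi> \<in> ?D"
    have upd: "t(i := \<alpha>) \<in> {..<p} \<rightarrow>\<^sub>E ?D" if "\<alpha> \<in> ?D" for \<alpha>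
      using that * by (auto simp: PiE_def extensional_def Pi_iff)
    have in_D: "(\<lambda>v. \<phi> v + \<psi> v) \<in> ?D" "(\<lambda>v. c * \<phi> v) \<in> ?D"
      using fib.function_space_dual * by (auto simp: function_space_def)
    have prod: "(\<Prod>k<p. (t(i := \<alpha>)) k (e x (J k))) = \<alpha> (e x (J i)) * (\<Prod>k\<in>{..<p} - {i}. t k (e x (J k)))" for \<alpha> J
    proof -
      have "(\<Prod>k<p. (t(i := \<alpha>)) k (e x (J k))) = (t(i := \<alpha>)) i (e x (J i)) * (\<Prod>k\<in>{..<p} - {i}. (t(i := \<alpha>)) k (e x (J k)))"
        using *(2) by (intro prod.remove) auto
      also have "(\<Prod>k\<in>{..<p} - {i}. (t(i := \<alpha>)) k (e x (J k))) = (\<Prod>k\<in>{..<p} - {i}. t k (e x (J k)))"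
        by (intro prod.cong) auto
      finally show ?thesis by simp
    qed
    have T0: "T0 (t(i := \<alpha>)) = (\<Sum>J\<in>{..<p} \<rightarrow>\<^sub>E {..<?r}. a J * (\<alpha> (e x (J i)) * (\<Prod>k\<in>{..<p} - {i}. t k (e x (J k)))))" if "\<alpha> \<in> ?D" for \<alpha>
      unfolding T0_def prod using upd[OF that] by (simp only: if_True)
    show "T0 (t(i := \<lambda>v. \<phi> v + \<psi> v)) = T0 (t(i := \<phi>)) + T0 (t(i := \<psi>))"
      unfolding T0[OF in_D(1)] T0[OF *(3)] T0[OF *(4)] by (simp add: distrib_left distrib_right sum.distrib)
    show "T0 (t(i := \<lambda>v. c * \<phi> v)) = c * T0 (t(i := \<phi>))"
      unfolding T0[OF in_D(2)] T0[OF *(3)] by (simp add: sum_distrib_left mult.assoc mult.left_commute)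
  qed (simp add: T0_def)
  then obtain T where T: "symmetric_form p ?D T" "\<And>\<tau>. \<tau> \<in> ?D \<Longrightarrow> T (diag_tuple p \<tau>) = T0 (diag_tuple p \<tau>)"
    using multilinear_symmetrize by blast
  have "T (diag_tuple p \<tau>) = s (x, line \<tau>) (diag_tuple p \<tau>)" if \<tau>: "\<tau> \<in> ?D" "\<tau> \<noteq> (\<lambda>_. 0)" for \<tau>
  proof -
    have lin: "lin (e x) (\<lambda>i. \<tau> (e x i)) = \<tau>" by (rule fib.lin_expand[OF b \<tau>(1)])
    then have nz: "\<not> (\<forall>i<?r. \<tau> (e x i) = 0)" using fib.lin_eq_0_iff[OF b, of "\<lambda>i. \<tau> (e x i)"] \<tau>(2) by simp
    have "T (diag_tuple p \<tau>) = (\<Sum>J\<in>{..<p} \<rightarrow>\<^sub>E {..<?r}. a J * (\<Prod>k<p. \<tau> (e x (J k))))"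
      unfolding T(2)[OF \<tau>(1)] T0_def using \<tau>(1) by (simp add: diag_tuple_def)
    then show ?thesis using a[of "\<lambda>i. \<tau> (e x i)"] nz unfolding lin by simp
  qed
  then show ?thesis using T(1) by blast
qed

lemma le_potier_surj:
  assumes s: "s \<in> H0_O M E p" and p: "1 \<le> p"
  obtains S where "S \<in> H0_sym M E p" "le_potier E p S = s"
proof -
  obtain S where S: "\<And>x. symmetric_form p (dual_fiber E x) (S x)"
    "\<And>x \<tau>. \<tau> \<in> dual_fiber E x \<Longrightarrow> \<tau> \<noteq> (\<lambda>_. 0) \<Longrightarrow> S x (diag_tuple p \<tau>) = s (x, line \<tau>) (diag_tuple p \<tau>)"
    using section_symmetric_form[OF s p] by metis
  have Sm: "S x \<in> multilinear_forms p (dual_fiber E x)" for x using S(1) by (simp add: symmetric_form_def)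
  have "holo_on (mdim M) (\<phi> ` (U \<inter> V)) (\<lambda>z. S (inv_into U \<phi> z) (\<lambda>k\<in>{..<p}. dual_basis E (e (inv_into U \<phi> z)) (I k)))"
    if V: "(V, e) \<in> frames E" and I: "I \<in> {..<p} \<rightarrow>\<^sub>E {..<brank E}" and U: "(U, \<phi>) \<in> atlas M" for V e I U \<phi>
  proof -
    let ?X = "\<phi> ` (U \<inter> V)" and ?inv = "inv_into U \<phi>" and ?P = "{..<p}"
    \<comment> \<open>Multiplicities again: \<open>c A\<close> lists the frame coordinates of the
      sum over \<open>A\<close> of dual frame vectors, independent of the base point.\<close>
    define c :: "nat set \<Rightarrow> cn" where "c A l = of_nat (card {i \<in> A. I i = l})" for A l
    have A_holo: "holo_on (mdim M) ?X (\<lambda>z. S (?inv z) (diag_tuple p (lin (e (?inv z)) (c A))))" if A: "A \<in> Pow ?P" for A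
    \<comment> \<open>With base point \<open>0\<close> the empty subset gives the zero functional,
      where \<open>s\<close> cannot be used; the form vanishes there because \<open>p\<close> is
      positive.\<close>
    proof (cases "A = {}")
      case True
      then have "lin (e y) (c A) = (\<lambda>_. 0)" for y by (simp add: c_def[abs_def] fib.lin_zero)
      then show ?thesis
        using multilinear_diag_zero[OF Sm fib.function_space_dual] p by (simp add: holo_on_const)
    next
      case False
      then obtain i where i: "i \<in> A" by blast
      then have j: "I i < brank E" using A I by (auto simp: PiE_iff)
      have "finite A" using A finite_subset by blast
      \<comment> \<open>The multiplicity of an index that occurs is nonzero, so \<open>I i\<close>
        serves as the normalization index of a chart over all of
        \<open>U \<inter> V\<close>.\<close>
      then have cj: "c A (I i) \<noteq> 0" using i by (auto simp: c_def card_eq_0_iff)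
      have holo: "holo_on (mdim M) ?X (\<lambda>z. s (?inv z, line (lin (e (?inv z)) (c A))) (diag_tuple p (lin (e (?inv z)) (c A))))"
        using cj by (intro holo_on_section[OF s U V j, where G = "\<lambda>z. z" and C = "\<lambda>_. c A"] holo_on_coord holo_on_const) auto
      have "S (?inv z) (diag_tuple p (lin (e (?inv z)) (c A))) =
          s (?inv z, line (lin (e (?inv z)) (c A))) (diag_tuple p (lin (e (?inv z)) (c A)))" if z: "z \<in> ?X" for z
      proof (rule S(2))
        obtain y where y: "z = \<phi> y" "y \<in> U" "y \<in> V" using z by blast
        have "?inv z = y" unfolding y(1) by (rule inv_into_f_f[OF chart_inj[OF U] y(2)])
        then have b: "basis_of E (?inv z) (e (?inv z))" using frame_basis[OF V] y(3) by simp
        show "lin (e (?inv z)) (c A) \<in> dual_fiber E (?inv z)" by (rule fib.lin_in[OF b])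
        show "lin (e (?inv z)) (c A) \<noteq> (\<lambda>_. 0)" using fib.lin_eq_0_iff[OF b] cj j by blast
      qed
      then show ?thesis by (rule holo_on_eqI[OF holo])
    qed
    have eq: "S (?inv z) (\<lambda>k\<in>?P. dual_basis E (e (?inv z)) (I k)) =
        1 / fact p * (\<Sum>A\<in>Pow ?P. (-1) ^ card (?P - A) * S (?inv z) (diag_tuple p (lin (e (?inv z)) (c A))))"
      if z: "z \<in> ?X" for z
    proof -
      obtain y where y: "z = \<phi> y" "y \<in> U" "y \<in> V" using z by blast
      have inv: "?inv z = y" unfolding y(1) by (rule inv_into_f_f[OF chart_inj[OF U] y(2)])
      have b: "basis_of E y (e y)" using frame_basis[OF V y(3)] .
      let ?t = "\<lambda>k\<in>?P. dual_basis E (e y) (I k)"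
      have t: "?t \<in> ?P \<rightarrow>\<^sub>E dual_fiber E y" using fib.dual_basis_in[OF b] by auto
      have "(\<lambda>v. 0 + (\<Sum>i\<in>A. ?t i v)) = lin (e y) (c A)" if A: "A \<in> Pow ?P" for A
      proof
        fix v
        have "finite A" using A finite_subset by blast
        have "(\<Sum>i\<in>A. ?t i v) = (\<Sum>i\<in>A. dual_basis E (e y) (I i) v)" using A by (intro sum.cong) auto
        also have "\<dots> = (\<Sum>l<brank E. \<Sum>i\<in>{i \<in> A. I i = l}. dual_basis E (e y) (I i) v)"
          using I A \<open>finite A\<close> by (intro sum.group[symmetric]) (auto simp: PiE_iff)
        also have "\<dots> = lin (e y) (c A) v" unfolding fib.lin_def c_def by (intro sum.cong refl) simp
        finally show "0 + (\<Sum>i\<in>A. ?t i v) = lin (e y) (c A) v" by simp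
      qed
      then have "(\<Sum>A\<in>Pow ?P. (-1) ^ card (?P - A) * S y (diag_tuple p (lin (e y) (c A))))
        = (\<Sum>A\<in>Pow ?P. (-1) ^ card (?P - A) * S y (diag_tuple p (\<lambda>v. 0 + (\<Sum>i\<in>A. ?t i v))))"
        by (intro sum.cong refl) (simp only:)
      also have "\<dots> = fact p * S y ?t"
        using fib.function_space_dual by (intro polarization[OF S(1) fib.function_space_dual t]) (simp add: function_space_def)
      finally show ?thesis unfolding inv by simp
    qed
    have "holo_on (mdim M) ?X (\<lambda>z. 1 / fact p * (\<Sum>A\<in>Pow ?P. (-1) ^ card (?P - A) *
        S (?inv z) (diag_tuple p (lin (e (?inv z)) (c A)))))"
      by (intro holo_on_cmult holo_on_sum A_holo)
    then show ?thesis by (rule holo_on_eqI) (rule eq)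
  qed
  then have "S \<in> H0_sym M E p"
    using S(1) by (auto simp: H0_sym_def fib.sym_fiber_iff holo_fun_def)
  moreover have "le_potier E p S q = s q" for q
  proof (cases "q \<in> proj_dual E")
    case True
    then obtain x L where q: "q = (x, L)" "L \<in> proj_fiber E x" by (auto simp: proj_dual_def)
    obtain \<tau> where \<tau>: "L = line \<tau>" "\<tau> \<in> dual_fiber E x" "\<tau> \<noteq> (\<lambda>_. 0)" using fib.proj_fiberE[OF q(2)] .
    have "restrict_form p (line \<tau>) (S x) = s (x, line \<tau>)"
    proof (rule multilinear_line_eqI)
      show "restrict_form p (line \<tau>) (S x) \<in> multilinear_forms p (line \<tau>)"
        by (rule restrict_form_in[OF Sm function_space_line fib.line_subset[OF \<tau>(2)]])
      show "s (x, line \<tau>) \<in> multilinear_forms p (line \<tau>)" using s True q \<tau> by (force simp: H0_O_def)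
      show "restrict_form p (line \<tau>) (S x) (diag_tuple p \<tau>) = s (x, line \<tau>) (diag_tuple p \<tau>)"
        using S(2)[OF \<tau>(2,3)] by (simp only: restrict_form_diag mem_line)
    qed
    then show ?thesis
      using fib.le_potier_eq[where S = S and x = x, OF Sm q(2)] by (simp only: q(1) \<tau>(1))
  next
    case False
    then have "s q = (\<lambda>_. 0)" using s by (cases q) (simp add: H0_O_def)
    moreover have "le_potier E p S q = (\<lambda>_. 0)" using False by (cases q) (simp add: le_potier_def)
    ultimately show ?thesis by simp
  qed
  ultimately show thesis using that by blast
qed

section \<open>Injectivity\<close>

lemma le_potier_inj:
  assumes S: "S \<in> H0_sym M E p" and T: "T \<in> H0_sym M E p" and p: "1 \<le> p"
    and eq: "le_potier E p S = le_potier E p T"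
  shows "S = T"
proof
  fix x
  have sym: "symmetric_form p (dual_fiber E x) (S x)" "symmetric_form p (dual_fiber E x) (T x)"
    using S T by (auto simp: H0_sym_def fib.sym_fiber_iff)
  show "S x = T x"
  proof (rule symmetric_form_eqI[OF sym fib.function_space_dual])
    fix \<tau> assume \<tau>: "\<tau> \<in> dual_fiber E x"
    show "S x (diag_tuple p \<tau>) = T x (diag_tuple p \<tau>)"
    proof (cases "\<tau> = (\<lambda>_. 0)")
      case True
      then show ?thesis
        using multilinear_diag_zero[OF H0_sym_multilinear[OF S] fib.function_space_dual]
          multilinear_diag_zero[OF H0_sym_multilinear[OF T] fib.function_space_dual] p by simp
    next
      case False
      then have L: "line \<tau> \<in> proj_fiber E x" using \<tau> by (auto simp: proj_fiber_def)
      have "restrict_form p (line \<tau>) (S x) = restrict_form p (line \<tau>) (T x)"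
        using fun_cong[OF eq, of "(x, line \<tau>)"]
        unfolding fib.le_potier_eq[where S = S and x = x, OF H0_sym_multilinear[OF S] L]
          fib.le_potier_eq[where S = T and x = x, OF H0_sym_multilinear[OF T] L] .
      from fun_cong[OF this, of "diag_tuple p \<tau>"] show ?thesis by (simp add: restrict_form_diag mem_line)
    qed
  qed
qed

section \<open>Comparison of the square-integrability conditions\<close>

text \<open>Fiber integrals see only genuine lines, exactly the points at which
  \<open>le_potier_eq\<close> applies.\<close>

lemma space_fs_measure: "space (fs_measure E x) = proj_fiber E x"
  by (simp add: fs_measure_def proj_fiber_borel_def space_measure_of_conv)

text \<open>Both fiber estimates have constants free of \<open>x\<close>, so pointwise domination
  transfers finiteness of the integral over \<open>M\<close> in either direction.\<close>

lemma le_potier_L2_iff: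
  assumes S: "S \<in> H0_sym M E p"
  shows "S \<in> H02_sym M E p \<longleftrightarrow> le_potier E p S \<in> H02_O M E p"
proof -
  let ?g = "\<lambda>x. ennreal (tensor_norm2 E p x (S x))"
  let ?h = "\<lambda>x. \<integral>\<^sup>+L. ennreal (O_norm2 E p (x, L) (restrict_form p L (S x))) \<partial>fs_measure E x"
  have sym: "symmetric_form p (dual_fiber E x) (S x)" for x
    using S by (auto simp: H0_sym_def fib.sym_fiber_iff)
  have "(\<integral>\<^sup>+L. ennreal (O_norm2 E p (x, L) (le_potier E p S (x, L))) \<partial>fs_measure E x) = ?h x" for x
    by (intro nn_integral_cong) (simp add: space_fs_measure fib.le_potier_eq[where S = S and x = x, OF H0_sym_multilinear[OF S]])
  then have int: "proj_integral M E (\<lambda>q. ennreal (O_norm2 E p q (le_potier E p S q))) = (\<integral>\<^sup>+x. ?h x \<partial>volume_measure M)"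
    by (simp add: proj_integral_def)
  have "(\<integral>\<^sup>+x. ?g x \<partial>volume_measure M) < \<infinity> \<longleftrightarrow> (\<integral>\<^sup>+x. ?h x \<partial>volume_measure M) < \<infinity>"
  proof
    assume "(\<integral>\<^sup>+x. ?g x \<partial>volume_measure M) < \<infinity>"
    then show "(\<integral>\<^sup>+x. ?h x \<partial>volume_measure M) < \<infinity>"
      using fib.nn_integral_O_norm2_le[OF H0_sym_multilinear[OF S] rank_pos]
      by (intro nn_integral_dominated_finite[of "fs_mass (brank E - 1)" ?h ?g]) (auto simp: fs_mass_def)
  next
    assume "(\<integral>\<^sup>+x. ?h x \<partial>volume_measure M) < \<infinity>"
    then show "(\<integral>\<^sup>+x. ?g x \<partial>volume_measure M) < \<infinity>"
      using fib.tensor_norm2_le[OF sym rank_pos]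
      by (intro nn_integral_dominated_finite[of "norm_const p (brank E - 1)" ?g ?h]) (auto simp: norm_const_nonneg)
  qed
  then show ?thesis using S le_potier_H0[OF S] by (simp add: H02_sym_def H02_O_def int)
qed

section \<open>Linearity and the bijection of square-integrable sections\<close>

lemma le_potier_add:
  assumes S: "S \<in> H0_sym M E p" and T: "T \<in> H0_sym M E p"
  shows "le_potier E p (\<lambda>x t. S x t + T x t) = (\<lambda>q t. le_potier E p S q t + le_potier E p T q t)"
proof (intro ext)
  fix q t
  note mf = H0_sym_multilinear[OF S] H0_sym_multilinear[OF T]
  show "le_potier E p (\<lambda>x t. S x t + T x t) q t = le_potier E p S q t + le_potier E p T q t"
  proof (cases "q \<in> proj_dual E")
    case True
    then obtain x L where q: "q = (x, L)" "L \<in> proj_fiber E x" by (auto simp: proj_dual_def)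
    show ?thesis
      unfolding q(1) fib.le_potier_eq[where S = S and x = x, OF mf(1) q(2)]
        fib.le_potier_eq[where S = T and x = x, OF mf(2) q(2)]
        fib.le_potier_eq[where S = "\<lambda>x t. S x t + T x t" and x = x, OF multilinear_forms_add[OF mf] q(2)]
      by (simp add: restrict_form_def)
  next
    case False
    then show ?thesis by (cases q) (simp add: le_potier_def)
  qed
qed

lemma le_potier_scale:
  assumes S: "S \<in> H0_sym M E p"
  shows "le_potier E p (\<lambda>x t. c * S x t) = (\<lambda>q t. c * le_potier E p S q t)"
proof (intro ext)
  fix q t
  note mf = H0_sym_multilinear[OF S]
  show "le_potier E p (\<lambda>x t. c * S x t) q t = c * le_potier E p S q t"
  proof (cases "q \<in> proj_dual E")
    case True
    then obtain x L where q: "q = (x, L)" "L \<in> proj_fiber E x" by (auto simp: proj_dual_def)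
    show ?thesis
      unfolding q(1) fib.le_potier_eq[where S = S and x = x, OF mf q(2)]
        fib.le_potier_eq[where S = "\<lambda>x t. c * S x t" and x = x, OF multilinear_forms_scale[OF mf] q(2)]
      by (simp add: restrict_form_def)
  next
    case False
    then show ?thesis by (cases q) (simp add: le_potier_def)
  qed
qed

lemma le_potier_bij:
  assumes p: "1 \<le> p"
  shows "bij_betw (le_potier E p) (H02_sym M E p) (H02_O M E p)"
  unfolding bij_betw_def
proof
  have sub: "S \<in> H0_sym M E p" if "S \<in> H02_sym M E p" for S using that by (simp add: H02_sym_def)
  show "inj_on (le_potier E p) (H02_sym M E p)"
    using le_potier_inj p sub by (intro inj_onI) blast
  show "le_potier E p ` H02_sym M E p = H02_O M E p"
  proof (intro subset_antisym subsetI)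
    show "s \<in> H02_O M E p" if "s \<in> le_potier E p ` H02_sym M E p" for s
      using that le_potier_L2_iff sub by blast
    fix s assume s: "s \<in> H02_O M E p"
    then have "s \<in> H0_O M E p" by (simp add: H02_O_def)
    then obtain S where "S \<in> H0_sym M E p" "le_potier E p S = s" using le_potier_surj p by blast
    then show "s \<in> le_potier E p ` H02_sym M E p" using le_potier_L2_iff s by blast
  qed
qed

end

theorem proposition4p2:
  fixes M :: "'m::{t2_space, second_countable_topology} herm_manifold"
    and E :: "('m, 'v::ab_group_add) herm_bundle"
    and p :: nat
  assumes "hermitian_manifold M"
    and "hermitian_bundle M E"
    and "1 \<le> p"
  shows "linear_iso (le_potier E p) (H02_sym M E p) (H02_O M E p)"
proof -
  interpret herm_bundle_over M E by unfold_locales fact+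
  show ?thesis
    unfolding linear_iso_def
    using le_potier_bij[OF assms(3)] le_potier_add[of _ p] le_potier_scale[of _ p] by (simp add: H02_sym_def)
qed

end
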